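(* Let $d\ge1$, let $B$ be a branching function without extinction, and let $(\mathbb{V},\mathbb{A})$ be the rooted tree defined by $B$. Consider the bindweed model in random environment on this tree, with alphabet $\mathcal{S}=\{1,\ldots,d\}$ and independent identically distributed environment vectors $(\Xi(a))_{a\in\mathbb{A}}$ of law $\rho$, as defined in the context. For $a\in\mathbb{A}$ let $\xi_a$ be the random $d\times d$ matrix with entries $\xi_{a,xy}=\nu_{xy}(a)/\mu_y(a)$, $x,y\in\mathcal{S}$, and suppose that the law $\mu$ of $\xi_a$ is a probability measure on $G=\mathsf{GL}(d,\mathbb{R})$ satisfying Conditions 1 (integrability), 2 (strong irreducibility) and 3 (strict positivity) stated in the context. Let $\lambda=\inf_{s\in[0,1]}k(s)$. Then: - if $\lambda\,\overline{\mathsf{gr}}(\mathbb{V})<1$, then for almost every environment the bindweed model is positive recurrent; - if $\|B\|_\infty<\infty$ and $\lambda\,\mathsf{br}(\mathbb{V})>1$, then for almost every environment the bindweed model is not positive recurrent.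
   Context: **Trees.** $\mathbb{N}=\{1,2,3,\ldots\}$, $\mathbb{Z}_+=\{0,1,2,\ldots\}$, $\mathbb{N}_n=\{1,\ldots,n\}$ for $n\ge1$, and $\mathbb{N}_0=\emptyset$. $\mathbb{N}^*$ denotes the set of finite words (including the empty word $\emptyset$) on the alphabet $\mathbb{N}$; $|\mathbf{v}|$ is the length of the word $\mathbf{v}$, and $\mathbf{v}{\upharpoonright}_n$ is the word formed by its first $n$ letters. For $|\mathbf v|\ge1$ the ancestor of $\mathbf{v}$ is $\hat{\mathbf{v}}=\mathbf{v}{\upharpoonright}_{|\mathbf{v}|-1}$. A branching function is a map $B:\mathbb{N}^*\to\mathbb{Z}_+$. It defines a rooted tree with vertex set $\mathbb{V}=\bigcup_{n\ge0}\mathbb{V}^n$, where $\mathbb{V}^0=\{\emptyset\}=\{\mathbf{0}\}$ (the root) and, for $n\ge1$, $\mathbb{V}^n=\{v_1\cdots v_n: v_l\in\mathbb{N}_{B(v_1\cdots v_{l-1})},\ l=1,\ldots,n\}$. The edge set $\mathbb{A}$ consists of the edges $a(\mathbf{v})=[\hat{\mathbf{v}},\mathbf{v}]$, $\mathbf{v}\in\mathbb{V}\setminus\{\mathbf{0}\}$. The boundary $\partial\mathbb{V}$ is the set of infinite words all of whose finite prefixes lie in $\mathbb{V}$; $B$ is without extinction if $\partial\mathbb{V}$ is non-trivial (non-empty). With $\kappa_n=\operatorname{card}\mathbb{V}^n$, the upper growth rate is $\overline{\mathsf{gr}}(\mathbb{V})=\limsup_n\kappa_n^{1/n}$. For $\mathbf{u},\mathbf{v}\in\partial\mathbb{V}$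 let $\mathbf{u}\wedge\mathbf{v}$ be their longest common prefix and $\delta(\mathbf{u},\mathbf{v})=\exp(-|\mathbf{u}\wedge\mathbf{v}|)$, which is a distance on $\partial\mathbb{V}$. When $\|B\|_\infty=\sup_{\mathbf{v}\in\mathbb{V}}B(\mathbf{v})<\infty$, the branching rate is $\mathsf{br}(\mathbb{V})=\exp(\dim_H\partial\mathbb{V})$, where $\dim_H$ is the Hausdorff dimension of $(\partial\mathbb{V},\delta)$. **Bindweed model.** Let $\mathcal{S}=\{1,\ldots,d\}$ and let $\mathcal{S}^{n+1}$ be the set of words $\sigma_0\cdots\sigma_n$ with letters in $\mathcal{S}$. The state space is $\mathfrak{S}=\{\hat\emptyset\}\cup\bigcup_{n\ge0}(\mathbb{V}^n\times\mathcal{S}^{n+1})$, where $\hat\emptyset$ is a special state. For each edge $a\in\mathbb{A}$ let positive numbers $\nu_{yz}(a)$, $y,z\in\mathcal{S}$, and $\mu_y(a)$, $y\in\mathcal{S}$, be given. The bindweed model is the continuous-time Markov chain on $\mathfrak{S}$ with the following transitions. From the state $(\mathbf{u},\sigma_0\cdots\sigma_{n-1}y)$ with $\mathbf{u}\in\mathbb{V}^n$, $y\in\mathcal{S}$: - for $n\ge0$, it jumps to $(\mathbf{v},\sigma_0\cdots\sigma_{n-1}yz)$ with rate $\nu_{yz}(a(\mathbf{v}))$, for every $\mathbf{v}\in\mathbb{V}$ with $\hat{\mathbf{v}}=\mathbf{u}$ and every $z\in\mathcal{S}$; - for $n\ge1$, it jumps to $(\hat{\mathbf{u}},\sigma_0\cdots\sigma_{n-1})$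 with rate $\mu_y(a(\mathbf{u}))$. For every $\sigma_0\in\mathcal{S}$ the transitions $\hat\emptyset\to(\mathbf{0},\sigma_0)$ and $(\mathbf{0},\sigma_0)\to\hat\emptyset$ occur with rate $1$. **Random environment.** The vectors $\Xi(a)=(\nu_{yz}(a),\,y,z\in\mathcal{S};\ \mu_y(a),\,y\in\mathcal{S})$, $a\in\mathbb{A}$, are independent and identically distributed with law $\rho$, a probability measure on $\mathbb{R}_+^{d^2+d}$. A realisation of $(\Xi(a))_{a\in\mathbb{A}}$ (the environment) is fixed and the chain is run with the corresponding rates. **Conditions on the law $\mu$ of $\xi_a$** (not to be confused with the rates $\mu_y(a)$). $\|\cdot\|$ is the operator norm on $d\times d$ matrices induced by the $\ell_1$ norm of $\mathbb{R}^d$. $\sigma_\mu$ is the support of $\mu$ in $G$ and $\Sigma_\mu$ the semigroup generated by $\sigma_\mu$. $G_+$ is the set of elements of $G$ with all entries strictly positive, $\overline{G}_+$ the set of those with all entries nonnegative. - Condition 1: $\int_G\|g\|^s\mu(dg)<\infty$ for all $s\in[0,\infty)$. - Condition 2: there is no finite $\Sigma_\mu$-invariant family of proper (non-zero) linear subspaces of $\mathbb{R}^d$. - Condition 3: $\sigma_\mu\subseteq\overline{G}_+$ and $\mu(\overline{G}_+\setminus G_+)=0$. **The parameter.** For $s\ge0$, $k(s)=\lim_n\left(\int_G\|g\|^s\mu^{\star n}(dg)\right)^{1/n}$, where $\mu^{\star n}$ is the $n$-fold convolution of $\mu$ (the law of a product of $n$ independent random matrices of law $\mu$). Under Conditions 1–3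 this limit exists in $[0,\infty)$. *)

theory Defs
  imports "HOL-Probability.Probability"
begin

section \<open>Trees\<close>

text \<open>Words over \<open>{1, 2, 3, \<dots>}\<close> are lists of naturals; the values of \<open>B\<close> outside the vertex
  set, in particular on words containing the letter 0, are never used.\<close>

type_synonym vertex = "nat list"
type_synonym edge = "vertex \<times> vertex"

definition tree_level :: "(vertex \<Rightarrow> nat) \<Rightarrow> nat \<Rightarrow> vertex set" where
  "tree_level B n = {v. length v = n \<and> (\<forall>l<n. v ! l \<in> {1..B (take l v)})}"

definition vertices :: "(vertex \<Rightarrow> nat) \<Rightarrow> vertex set" where
  "vertices B = (\<Union>n. tree_level B n)"

definition edge_to :: "vertex \<Rightarrow> edge" where
  "edge_to v = (butlast v, v)"

definition edges :: "(vertex \<Rightarrow> nat) \<Rightarrow> edge set" where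
  "edges B = edge_to ` (vertices B - {[]})"

text \<open>An infinite word is a function on \<^typ>\<open>nat\<close>, its first letter having index 0.\<close>

definition boundary :: "(vertex \<Rightarrow> nat) \<Rightarrow> (nat \<Rightarrow> nat) set" where
  "boundary B = {w. \<forall>n. map w [0..<n] \<in> vertices B}"

definition without_extinction :: "(vertex \<Rightarrow> nat) \<Rightarrow> bool" where
  "without_extinction B \<longleftrightarrow> boundary B \<noteq> {}"

definition bounded_branching :: "(vertex \<Rightarrow> nat) \<Rightarrow> bool" where
  "bounded_branching B \<longleftrightarrow> bdd_above (B ` vertices B)"

definition upper_growth_rate :: "(vertex \<Rightarrow> nat) \<Rightarrow> ereal" where
  "upper_growth_rate B = limsup (\<lambda>n. ereal (root n (real (card (tree_level B n)))))"

text \<open>For distinct words, the least index at which they differ is the length of their longest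
  common prefix.\<close>

definition boundary_dist :: "(nat \<Rightarrow> nat) \<Rightarrow> (nat \<Rightarrow> nat) \<Rightarrow> real" where
  "boundary_dist u v = (if u = v then 0 else exp (- real (LEAST n. u n \<noteq> v n)))"


section \<open>Hausdorff dimension\<close>

text \<open>Here \<open>d\<close> is a distance on the carrier \<open>S\<close>.\<close>

definition set_diam :: "('a \<Rightarrow> 'a \<Rightarrow> real) \<Rightarrow> 'a set \<Rightarrow> real" where
  "set_diam d U = (if U = {} then 0 else (SUP (x, y)\<in>U \<times> U. d x y))"

definition hausdorff_premeasure ::
    "('a \<Rightarrow> 'a \<Rightarrow> real) \<Rightarrow> 'a set \<Rightarrow> real \<Rightarrow> real \<Rightarrow> ennreal" where
  "hausdorff_premeasure d S s \<epsilon> =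
     (INF U \<in> {U :: nat \<Rightarrow> 'a set. (\<Union>i. U i) = S \<and> (\<forall>i. \<forall>x\<in>U i. \<forall>y\<in>U i. d x y \<le> \<epsilon>)}.
        \<Sum>i. ennreal (set_diam d (U i) powr s))"

definition hausdorff_measure :: "('a \<Rightarrow> 'a \<Rightarrow> real) \<Rightarrow> 'a set \<Rightarrow> real \<Rightarrow> ennreal" where
  "hausdorff_measure d S s = (SUP \<epsilon>\<in>{0<..}. hausdorff_premeasure d S s \<epsilon>)"

text \<open>Restricting to \<open>s > 0\<close> leaves the infimum unchanged and avoids the convention
  \<open>0 powr 0 = 0\<close>.\<close>

definition hausdorff_dim :: "('a \<Rightarrow> 'a \<Rightarrow> real) \<Rightarrow> 'a set \<Rightarrow> ereal" where
  "hausdorff_dim d S = Inf (ereal ` {s. 0 < s \<and> hausdorff_measure d S s = 0})"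

text \<open>Only used for bounded branching, in which case the dimension is finite.\<close>

definition branching_rate :: "(vertex \<Rightarrow> nat) \<Rightarrow> real" where
  "branching_rate B = exp (real_of_ereal (hausdorff_dim boundary_dist (boundary B)))"


section \<open>Continuous-time Markov chains\<close>

text \<open>A chain on a countable type is given by its jump rates \<open>q x y\<close> for \<open>x \<noteq> y\<close>, with
  \<open>q x x = 0\<close>. The minimal chain is described by its jump chain and its holding times; a state
  with exit rate 0 is absorbing.\<close>

definition exit_rate :: "('s \<Rightarrow> 's \<Rightarrow> real) \<Rightarrow> 's \<Rightarrow> real" where
  "exit_rate q x = (\<Sum>\<^sub>\<infinity>y. q x y)"

definition jump_pmf :: "('s \<Rightarrow> 's \<Rightarrow> real) \<Rightarrow> 's \<Rightarrow> 's pmf" where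
  "jump_pmf q x =
     (if exit_rate q x = 0 then return_pmf x else embed_pmf (\<lambda>y. q x y / exit_rate q x))"

text \<open>The chain is realised on a product space: \<open>U (n, y)\<close>, of law \<open>jump_pmf q y\<close>, is the
  state to which the \<open>n\<close>-th jump leads if it starts in \<open>y\<close>, and \<open>E n\<close> is a standard
  exponential variable which, divided by the exit rate, gives the \<open>n\<close>-th holding time;
  all these variables are independent.\<close>

definition chain_space ::
    "('s \<Rightarrow> 's \<Rightarrow> real) \<Rightarrow> ((nat \<times> 's \<Rightarrow> 's) \<times> (nat \<Rightarrow> real)) measure" where
  "chain_space q =
     (\<Pi>\<^sub>M (n, y)\<in>UNIV. measure_pmf (jump_pmf q y)) \<Otimes>\<^sub>M
     (\<Pi>\<^sub>M n\<in>UNIV. density lborel (\<lambda>t. ennreal (exponential_density 1 t)))"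

primrec jump_chain :: "'s \<Rightarrow> (nat \<times> 's \<Rightarrow> 's) \<Rightarrow> nat \<Rightarrow> 's" where
  "jump_chain x U 0 = x"
| "jump_chain x U (Suc n) = U (n, jump_chain x U n)"

definition jump_time ::
    "('s \<Rightarrow> 's \<Rightarrow> real) \<Rightarrow> 's \<Rightarrow> (nat \<times> 's \<Rightarrow> 's) \<Rightarrow> (nat \<Rightarrow> real) \<Rightarrow> nat \<Rightarrow> ennreal" where
  "jump_time q x U E n =
     (\<Sum>k<n. ennreal (E k) / ennreal (exit_rate q (jump_chain x U k)))"

text \<open>The infimum is \<open>\<infinity>\<close> if the chain started in \<open>x\<close> never returns to \<open>x\<close>.\<close>

definition return_time ::
    "('s \<Rightarrow> 's \<Rightarrow> real) \<Rightarrow> 's \<Rightarrow> (nat \<times> 's \<Rightarrow> 's) \<Rightarrow> (nat \<Rightarrow> real) \<Rightarrow> ennreal" where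
  "return_time q x U E = (INF n\<in>{n. 1 \<le> n \<and> jump_chain x U n = x}. jump_time q x U E n)"

definition mean_return_time :: "('s \<Rightarrow> 's \<Rightarrow> real) \<Rightarrow> 's \<Rightarrow> ennreal" where
  "mean_return_time q x = (\<integral>\<^sup>+ (U, E). return_time q x U E \<partial>chain_space q)"

definition positive_recurrent :: "'s set \<Rightarrow> ('s \<Rightarrow> 's \<Rightarrow> real) \<Rightarrow> bool" where
  "positive_recurrent S q \<longleftrightarrow> (\<forall>x\<in>S. mean_return_time q x < \<infinity>)"


section \<open>The bindweed model\<close>

text \<open>The alphabet is the finite type \<open>'d\<close>. A value \<open>(\<nu>, \<mu>)\<close> of the environment on an edge
  consists of the rates \<open>\<nu> $ y $ z\<close> and \<open>\<mu> $ y\<close>.\<close>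

type_synonym 'd env = "(real^'d^'d) \<times> (real^'d)"

datatype 'd state = Special | At vertex "'d list"

instance state :: (countable) countable
  by countable_datatype

definition state_space :: "(vertex \<Rightarrow> nat) \<Rightarrow> 'd state set" where
  "state_space B = insert Special {At u \<sigma> | u \<sigma>. u \<in> vertices B \<and> length \<sigma> = Suc (length u)}"

fun jump_rate :: "(edge \<Rightarrow> ('d::finite) env) \<Rightarrow> 'd state \<Rightarrow> 'd state \<Rightarrow> real" where
  "jump_rate \<Xi> Special Special = 0"
| "jump_rate \<Xi> Special (At v \<tau>) = (if v = [] then 1 else 0)"
| "jump_rate \<Xi> (At u \<sigma>) Special = (if u = [] then 1 else 0)"
| "jump_rate \<Xi> (At u \<sigma>) (At v \<tau>) =
     (if v \<noteq> [] \<and> butlast v = u \<and> butlast \<tau> = \<sigma>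
        then fst (\<Xi> (edge_to v)) $ last \<sigma> $ last \<tau>
      else if u \<noteq> [] \<and> v = butlast u \<and> \<tau> = butlast \<sigma>
        then snd (\<Xi> (edge_to u)) $ last \<sigma>
      else 0)"

definition bindweed_rate ::
    "(vertex \<Rightarrow> nat) \<Rightarrow> (edge \<Rightarrow> ('d::finite) env) \<Rightarrow> 'd state \<Rightarrow> 'd state \<Rightarrow> real" where
  "bindweed_rate B \<Xi> x y =
     (if x \<in> state_space B \<and> y \<in> state_space B then jump_rate \<Xi> x y else 0)"

definition bindweed_positive_recurrent ::
    "(vertex \<Rightarrow> nat) \<Rightarrow> (edge \<Rightarrow> ('d::finite) env) \<Rightarrow> bool" where
  "bindweed_positive_recurrent B \<Xi> \<longleftrightarrow> positive_recurrent (state_space B) (bindweed_rate B \<Xi>)"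

definition positive_env :: "('d::finite) env \<Rightarrow> bool" where
  "positive_env e \<longleftrightarrow> (\<forall>y z. 0 < fst e $ y $ z) \<and> (\<forall>y. 0 < snd e $ y)"

definition ratio_matrix :: "('d::finite) env \<Rightarrow> real^'d^'d" where
  "ratio_matrix e = (\<chi> x y. fst e $ x $ y / snd e $ y)"


section \<open>Random matrices\<close>

text \<open>A probability measure on the general linear group is represented by a Borel measure on
  the space of all matrices that is carried by \<open>GL\<close>. As \<open>GL\<close> is open, the support in \<open>GL\<close> can be
  computed with open sets of matrices.\<close>

definition GL :: "(real^'d^'d::finite) set" where
  "GL = {g. invertible g}"

definition G_pos :: "(real^'d^'d::finite) set" where
  "G_pos = {g \<in> GL. \<forall>x y. 0 < g $ x $ y}"

definition G_nonneg :: "(real^'d^'d::finite) set" where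
  "G_nonneg = {g \<in> GL. \<forall>x y. 0 \<le> g $ x $ y}"

definition l1_norm :: "real^'d::finite \<Rightarrow> real" where
  "l1_norm x = (\<Sum>i\<in>UNIV. \<bar>x $ i\<bar>)"

definition l1_opnorm :: "real^'d^'d::finite \<Rightarrow> real" where
  "l1_opnorm g = (SUP x\<in>{x. l1_norm x = 1}. l1_norm (g *v x))"

definition GL_support :: "(real^'d^'d::finite) measure \<Rightarrow> (real^'d^'d) set" where
  "GL_support \<mu> = {g \<in> GL. \<forall>U. open U \<longrightarrow> g \<in> U \<longrightarrow> 0 < emeasure \<mu> U}"

inductive_set generated_semigroup :: "(real^'d^'d::finite) set \<Rightarrow> (real^'d^'d) set"
  for S where
  "g \<in> S \<Longrightarrow> g \<in> generated_semigroup S"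
| "g \<in> generated_semigroup S \<Longrightarrow> h \<in> generated_semigroup S \<Longrightarrow> g ** h \<in> generated_semigroup S"

definition integrability_condition :: "(real^'d^'d::finite) measure \<Rightarrow> bool" where
  "integrability_condition \<mu> \<longleftrightarrow> (\<forall>s\<ge>0. (\<integral>\<^sup>+ g. ennreal (l1_opnorm g powr s) \<partial>\<mu>) < \<infinity>)"

definition strong_irreducibility_condition :: "(real^'d^'d::finite) measure \<Rightarrow> bool" where
  "strong_irreducibility_condition \<mu> \<longleftrightarrow>
     \<not> (\<exists>F :: (real^'d) set set. finite F \<and> F \<noteq> {} \<and>
          (\<forall>W\<in>F. subspace W \<and> W \<noteq> {0} \<and> W \<noteq> UNIV) \<and>
          (\<forall>g\<in>generated_semigroup (GL_support \<mu>). \<forall>W\<in>F. (\<lambda>x. g *v x) ` W \<in> F))"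

definition strict_positivity_condition :: "(real^'d^'d::finite) measure \<Rightarrow> bool" where
  "strict_positivity_condition \<mu> \<longleftrightarrow>
     GL_support \<mu> \<subseteq> G_nonneg \<and> emeasure \<mu> (G_nonneg - G_pos) = 0"

primrec convolution_power :: "(real^'d^'d::finite) measure \<Rightarrow> nat \<Rightarrow> (real^'d^'d) measure" where
  "convolution_power \<mu> 0 = return borel (mat 1)"
| "convolution_power \<mu> (Suc n) =
     distr (convolution_power \<mu> n \<Otimes>\<^sub>M \<mu>) borel (\<lambda>(g, h). g ** h)"

definition moment_rate :: "(real^'d^'d::finite) measure \<Rightarrow> real \<Rightarrow> real" where
  "moment_rate \<mu> s =
     lim (\<lambda>n. root n (\<integral>g. l1_opnorm g powr s \<partial>convolution_power \<mu> n))"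

definition min_moment_rate :: "(real^'d^'d::finite) measure \<Rightarrow> real" where
  "min_moment_rate \<mu> = (INF s\<in>{0..1}. moment_rate \<mu> s)"

end

theory Submission
  imports Defs
begin

text \<open>The state space is itself a tree: the parent of a state is obtained by deleting the last letter
  of both words.  The chain only moves along the edges of this tree, hence is reversible, and the
  weight of the state at \<open>v\<close> with word \<open>\<sigma>\<close> is the product of the entries of the matrices \<open>\<xi>\<close> along
  the path to \<open>v\<close> that are picked out by \<open>\<sigma>\<close>.  Summing over \<open>\<sigma>\<close>, the total weight of generation \<open>n\<close>
  is the sum over the vertices \<open>v\<close> of that generation of all entries of the matrix product along the
  path to \<open>v\<close> (\<open>sum_states_at\<close>).  So everything depends on whether this \<open>level_mass\<close> is summable.

  A positive recurrent chain has a finite invariant measure, so its weights are summable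
  (\<open>summable_if_positive_recurrent\<close>).  The converse needs an argument that the jump chain returns:
  a chain with summable weights may be transient if its rates are large.  It returns if the finite
  sets of states have boundaries of arbitrarily small total conductance.  As the conductance of an
  edge is the weight of its lower end times the downward rate, and as edges with a large downward
  rate are too rare to percolate on a tree of finite growth (\<open>slow_cutsets\<close>), such boundaries exist
  once the weights are summable (\<open>positive_recurrent_if_summable\<close>).

  Summability when \<open>\<lambda>\<close> times the growth rate is below 1 is a first moment bound.  For a suitable
  \<open>s \<le> 1\<close> the sum over all vertices of the \<open>s\<close>-th powers of the norms has finite mean, by the root test,
  and for small norms the \<open>s\<close>-th power dominates the norm (\<open>finite_mass\<close>).

  Divergence when \<open>\<lambda>\<close> times the branching rate exceeds 1 is a second moment bound for a
  percolation.  Call a path of \<open>k\<close> edges open if all entries of its matrix product are at least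
  \<open>t\<close>.  If \<open>p\<close> is the probability of this, large deviations provide \<open>k\<close> and \<open>t \<le> 1\<close> with
  \<open>t \<alpha>\<^sup>k p > 1\<close> for some \<open>\<alpha>\<close> below the branching rate (\<open>percolation_parameters\<close>); they apply because, on
  the exponential scale in \<open>k\<close>, the maximum of \<open>t p\<close> over \<open>t \<le> 1\<close> is the \<open>k\<close>-th power of the infimum of
  \<open>k(s)\<close> over \<open>s \<in> [0,1]\<close>.  The tree carries a flow that is at most \<open>\<alpha>\<^sup>-\<^sup>n\<close> in generation \<open>n\<close>
  (\<open>flow_exists\<close>).  Its open part, if only the blocks beyond generation \<open>n0\<close> have to be open, has a
  relative variance of order \<open>\<alpha>\<close> to the power \<open>-n0\<close> (\<open>open_flow_large\<close>).  If the open part is not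
  small, then there are so many open paths that, each having entries of order \<open>t\<close> per block, they
  keep the level mass away from 0.  So summability has probability of order \<open>\<alpha>\<close> to the power
  \<open>-n0\<close> for every \<open>n0\<close> (\<open>infinite_mass\<close>).\<close>

section \<open>The jump chain and its taboo probabilities\<close>

abbreviation jump_measure :: "('s \<Rightarrow> 's pmf) \<Rightarrow> (nat \<times> 's \<Rightarrow> 's) measure" where
  "jump_measure p \<equiv> (\<Pi>\<^sub>M (n, y)\<in>UNIV. measure_pmf (p y))"

lemma prob_space_jump_measure: "prob_space (jump_measure p)"
  by (intro prob_space_PiM) (auto simp: prob_space_measure_pmf split: prod.split)

lemma space_jump_measure [simp]: "space (jump_measure p) = UNIV"
  by (auto simp: space_PiM split: prod.split)

text \<open>The first \<open>N\<close> steps use only the moves with first index below \<open>N\<close>, so they are independent of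
  the later moves.\<close>

lemma jump_chain_measurable_restrict:
  fixes x :: "'s::countable"
  assumes "n \<le> N"
  shows "(\<lambda>U. jump_chain x U n)
    \<in> measurable (\<Pi>\<^sub>M (n, y)\<in>{..<N} \<times> UNIV. measure_pmf (p y)) (count_space UNIV)"
  using assms
proof (induction n)
  case (Suc n)
  have m: "(\<lambda>U. U (n, z)) \<in>
      measurable (\<Pi>\<^sub>M (n, y)\<in>{..<N} \<times> UNIV. measure_pmf (p y)) (count_space UNIV)" for z
  proof -
    have "(\<lambda>U. U (n, z)) \<in> measurable (\<Pi>\<^sub>M (n, y)\<in>{..<N} \<times> UNIV. measure_pmf (p y)) (measure_pmf (p z))"
      using Suc.prems
        measurable_component_singleton[of "(n, z)" "{..<N} \<times> UNIV" "\<lambda>(n, y). measure_pmf (p y)"] by simp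
    then show ?thesis by (simp cong: measurable_cong_sets)
  qed
  show ?case
    using measurable_compose_countable[OF m Suc.IH] Suc.prems by simp
qed simp

lemma jump_chain_measurable:
  fixes x :: "'s::countable"
  shows "(\<lambda>U. jump_chain x U n) \<in> measurable (jump_measure p) (count_space UNIV)"
proof (induction n)
  case (Suc n)
  have m: "(\<lambda>U. U (n, z)) \<in> measurable (jump_measure p) (count_space UNIV)" for z
  proof -
    have "(\<lambda>U. U (n, z)) \<in> measurable (jump_measure p) (measure_pmf (p z))"
      using measurable_component_singleton[of "(n, z)" UNIV "\<lambda>(n, y). measure_pmf (p y)"] by simp
    then show ?thesis by (simp cong: measurable_cong_sets)
  qed
  show ?case
    using measurable_compose_countable[OF m Suc.IH] by simp
qed simp

lemma jump_chain_restrict: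
  "n \<le> N \<Longrightarrow> jump_chain x (restrict U ({..<N} \<times> UNIV)) n = jump_chain x U n"
  by (induction n) auto

text \<open>The moves of the chain are independent, but the chain decides at each time which of them it
  uses; this lemma is the Markov property for that choice.\<close>

lemma emeasure_history_and_move:
  fixes x :: "'s::countable"
  assumes H: "\<And>U U'. (\<forall>k\<le>n. jump_chain x U k = jump_chain x U' k) \<Longrightarrow> Q U = Q U'"
    and Q: "{U \<in> space (\<Pi>\<^sub>M (n, y)\<in>{..<n} \<times> UNIV. measure_pmf (p y)). Q U}
       \<in> sets (\<Pi>\<^sub>M (n, y)\<in>{..<n} \<times> UNIV. measure_pmf (p y))"
  shows "emeasure (jump_measure p) {U. Q U \<and> U (n, z) = y} =
    emeasure (jump_measure p) {U. Q U} * pmf (p z) y"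
proof -
  let ?K = "\<lambda>(n::nat, y). measure_pmf (p y)"
  interpret P: prob_space "jump_measure p" by (rule prob_space_jump_measure)
  have K: "prob_space (?K i)" for i
    by (cases i) (simp, unfold_locales)
  have ind: "P.indep_vars ?K (\<lambda>i U. U i) UNIV"
  proof (subst P.indep_vars_iff_distr_eq_PiM)
    have "distr (jump_measure p) (?K i) (\<lambda>U. U i) = ?K i" for i
      by (rule distr_PiM_component) (rule K, simp)
    then show "distr (jump_measure p) (Pi\<^sub>M UNIV ?K) (\<lambda>x. \<lambda>i\<in>UNIV. x i) =
        (\<Pi>\<^sub>M i\<in>UNIV. distr (jump_measure p) (?K i) (\<lambda>U. U i))"
      by (subst PiM_cong[OF refl, where N = ?K]) (simp_all add: restrict_UNIV)
  qed (auto simp: measurable_component_singleton)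
  let ?A = "{..<n} \<times> (UNIV::'s set)" and ?B = "{(n, z)}"
  have iv: "P.indep_var (PiM ?A ?K) (\<lambda>U. restrict U ?A) (PiM ?B ?K) (\<lambda>U. restrict U ?B)"
    using P.indep_var_restrict[OF ind, of ?A ?B] by auto
  let ?EA = "{U \<in> space (PiM ?A ?K). Q U}"
  let ?EB = "{U \<in> space (PiM ?B ?K). U (n, z) = y}"
  have mB: "?EB \<in> sets (PiM ?B ?K)"
  proof -
    have "(\<lambda>U. U (n, z)) \<in> measurable (PiM ?B ?K) (measure_pmf (p z))"
      using measurable_component_singleton[of "(n, z)" ?B ?K] by simp
    from measurable_sets[OF this, of "{y}"] show ?thesis
      by (simp add: vimage_def Int_def conj_commute)
  qed
  have QA: "Q (restrict U ?A) = Q U" for U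
    by (rule H) (auto simp: jump_chain_restrict)
  have sA: "restrict U ?A \<in> space (PiM ?A ?K)" for U
    by (auto simp: space_PiM)
  have sB: "restrict U ?B \<in> space (PiM ?B ?K)" for U
    by (auto simp: space_PiM)
  have "P.prob ((\<lambda>U. (restrict U ?A, restrict U ?B)) -` (?EA \<times> ?EB) \<inter> space (jump_measure p)) =
      P.prob ((\<lambda>U. restrict U ?A) -` ?EA \<inter> space (jump_measure p)) *
      P.prob ((\<lambda>U. restrict U ?B) -` ?EB \<inter> space (jump_measure p))"
    using Q mB by (intro P.indep_varD[OF iv]) auto
  also have "(\<lambda>U. (restrict U ?A, restrict U ?B)) -` (?EA \<times> ?EB) \<inter> space (jump_measure p) =
      {U. Q U \<and> U (n, z) = y}"
    using sA sB by (auto simp: QA)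
  also have "(\<lambda>U. restrict U ?A) -` ?EA \<inter> space (jump_measure p) = {U. Q U}"
    using sA by (auto simp: QA)
  also have "(\<lambda>U. restrict U ?B) -` ?EB \<inter> space (jump_measure p) = {U. U (n, z) = y}"
    using sB by auto
  also have "P.prob {U. U (n, z) = y} = pmf (p z) y"
  proof -
    have "pmf (p z) y = measure (distr (jump_measure p) (?K (n, z)) (\<lambda>U. U (n, z))) {y}"
      by (subst distr_PiM_component) (rule K, simp_all add: measure_pmf_single)
    also have "\<dots> = P.prob {U. U (n, z) = y}"
      using measurable_component_singleton[of "(n, z)" UNIV ?K]
      by (subst measure_distr) (auto simp: vimage_def)
    finally show ?thesis by simp
  qed
  finally show ?thesis
    by (simp add: P.emeasure_eq_measure ennreal_mult)
qed

text \<open>The probability that a chain with transition law \<open>p\<close> started in \<open>x\<close> is at \<open>y\<close> at time \<open>n\<close> without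
  having returned to \<open>x\<close> at the times \<open>1, \<dots>, n\<close>; see \<open>emeasure_taboo\<close>.\<close>

primrec taboo :: "('s \<Rightarrow> 's pmf) \<Rightarrow> 's \<Rightarrow> nat \<Rightarrow> 's \<Rightarrow> ennreal" where
  "taboo p x 0 y = (if y = x then 1 else 0)"
| "taboo p x (Suc n) y =
     (if y = x then 0 else \<integral>\<^sup>+ z. taboo p x n z * pmf (p z) y \<partial>count_space UNIV)"

definition unreturned :: "'s \<Rightarrow> nat \<Rightarrow> (nat \<times> 's \<Rightarrow> 's) \<Rightarrow> bool" where
  "unreturned x n U \<longleftrightarrow> (\<forall>k\<in>{1..n}. jump_chain x U k \<noteq> x)"

lemma unreturned_Suc:
  "unreturned x (Suc n) U \<longleftrightarrow> unreturned x n U \<and> jump_chain x U (Suc n) \<noteq> x"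
  unfolding unreturned_def by (auto simp: atLeastAtMostSuc_conv simp del: jump_chain.simps)

lemma unreturned_measurable_restrict:
  fixes x :: "'s::countable"
  assumes "n \<le> N"
  shows "{U \<in> space (\<Pi>\<^sub>M (n, y)\<in>{..<N} \<times> UNIV. measure_pmf (p y)).
       jump_chain x U n = y \<and> unreturned x n U} \<in> sets (\<Pi>\<^sub>M (n, y)\<in>{..<N} \<times> UNIV. measure_pmf (p y))"
proof -
  let ?P = "\<Pi>\<^sub>M (n, y)\<in>{..<N} \<times> UNIV. measure_pmf (p y)"
  have m: "(\<lambda>U. jump_chain x U k) \<in> measurable ?P (count_space UNIV)" if "k \<le> n" for k
    using jump_chain_measurable_restrict[of k N x p] that assms by simp
  have "{U \<in> space ?P. jump_chain x U k \<in> A} \<in> sets ?P" if "k \<le> n" for k A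
    using measurable_sets[OF m[OF that], of A] by (simp add: vimage_def Int_def conj_commute)
  from this[of _ "{y}"] this[of _ "- {x}"]
  show ?thesis unfolding unreturned_def
    by (intro sets.sets_Collect_conj sets.sets_Collect_finite_All) auto
qed

lemma unreturned_measurable:
  fixes x :: "'s::countable"
  shows "{U. jump_chain x U n = y \<and> unreturned x n U} \<in> sets (jump_measure p)"
    "{U. unreturned x n U} \<in> sets (jump_measure p)"
proof -
  have "{U \<in> space (jump_measure p). jump_chain x U k \<in> A} \<in> sets (jump_measure p)" for k A
    using measurable_sets[OF jump_chain_measurable, of A x k p]
    by (simp add: vimage_def Int_def conj_commute)
  from this[of _ "{y}"] this[of _ "- {x}"]
  have "{U \<in> space (jump_measure p). jump_chain x U n = y \<and> unreturned x n U} \<in> sets (jump_measure p)"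
    "{U \<in> space (jump_measure p). unreturned x n U} \<in> sets (jump_measure p)"
    unfolding unreturned_def
    by (intro sets.sets_Collect_conj sets.sets_Collect_finite_All; auto)+
  then show "{U. jump_chain x U n = y \<and> unreturned x n U} \<in> sets (jump_measure p)"
    "{U. unreturned x n U} \<in> sets (jump_measure p)" by simp_all
qed

lemma emeasure_taboo:
  fixes x :: "'s::countable"
  shows "emeasure (jump_measure p) {U. jump_chain x U n = y \<and> unreturned x n U} = taboo p x n y"
proof (induction n arbitrary: y)
  case 0
  interpret P: prob_space "jump_measure p" by (rule prob_space_jump_measure)
  show ?case using P.emeasure_space_1 by (auto simp: unreturned_def)
next
  case (Suc n)
  show ?case
  proof (cases "y = x")
    case False
    let ?A = "\<lambda>z. {U. (jump_chain x U n = z \<and> unreturned x n U) \<and> U (n, z) = y}"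
    have m: "?A z \<in> sets (jump_measure p)" for z
    proof -
      have "(\<lambda>U. U (n, z)) \<in> measurable (jump_measure p) (measure_pmf (p z))"
        using measurable_component_singleton[of "(n, z)" UNIV "\<lambda>(n, y). measure_pmf (p y)"] by simp
      from measurable_sets[OF this, of "{y}"] have "{U. U (n, z) = y} \<in> sets (jump_measure p)"
        by (simp add: vimage_def)
      with unreturned_measurable(1)[of x n z p]
      have "{U. jump_chain x U n = z \<and> unreturned x n U} \<inter> {U. U (n, z) = y} \<in> sets (jump_measure p)"
        by (rule sets.Int)
      then show ?thesis by (simp add: Int_def)
    qed
    have "{U. jump_chain x U (Suc n) = y \<and> unreturned x (Suc n) U} = (\<Union>z. ?A z)"
      using False by (auto simp: unreturned_Suc)
    also have "emeasure (jump_measure p) (\<Union>z. ?A z) =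
        (\<integral>\<^sup>+ z. emeasure (jump_measure p) (?A z) \<partial>count_space UNIV)"
      using m by (intro emeasure_UN_countable) (auto simp: disjoint_family_on_def)
    also have "\<dots> = (\<integral>\<^sup>+ z. taboo p x n z * pmf (p z) y \<partial>count_space UNIV)"
    proof (intro nn_integral_cong)
      fix z
      show "emeasure (jump_measure p) (?A z) = taboo p x n z * ennreal (pmf (p z) y)"
        using unreturned_measurable_restrict[where n = n and N = n and x = x and p = p and y = z]
        by (subst emeasure_history_and_move) (auto simp: unreturned_def Suc.IH[of z, unfolded unreturned_def, simplified])
    qed
    finally show ?thesis using False by simp
  qed (simp add: unreturned_Suc cong: conj_cong)
qed

section \<open>Mean return times\<close>

lemma return_time_eq_PInf:
  assumes "\<forall>n. unreturned x n U"
  shows "return_time q x U E = \<infinity>"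
proof -
  have "{n. 1 \<le> n \<and> jump_chain x U n = x} = {}"
    using assms unfolding unreturned_def by (metis (mono_tags, lifting) Collect_empty_eq atLeastAtMost_iff order_refl)
  then show ?thesis unfolding return_time_def by (simp only: INF_empty) simp
qed

text \<open>A sum over all steps, unlike the return time, so that its mean can be computed term by term.
  If the chain never comes back, then the return time is infinite but this sum need not be.\<close>

definition excursion_length ::
    "('s \<Rightarrow> 's \<Rightarrow> real) \<Rightarrow> 's \<Rightarrow> (nat \<times> 's \<Rightarrow> 's) \<Rightarrow> (nat \<Rightarrow> real) \<Rightarrow> ennreal" where
  "excursion_length q x U E = (\<Sum>k. if unreturned x k U
     then ennreal (E k) / ennreal (exit_rate q (jump_chain x U k)) else 0)"

lemma return_time_eq_excursion_length:
  assumes "\<not> (\<forall>n. unreturned x n U)"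
  shows "return_time q x U E = excursion_length q x U E"
proof -
  let ?h = "\<lambda>k. ennreal (E k) / ennreal (exit_rate q (jump_chain x U k))"
  define R where "R = {n. 1 \<le> n \<and> jump_chain x U n = x}"
  define \<tau> where "\<tau> = (LEAST n. n \<in> R)"
  have "\<exists>n. n \<in> R" using assms by (auto simp: unreturned_def R_def)
  then have \<tau>: "\<tau> \<in> R" unfolding \<tau>_def by (metis LeastI)
  have least: "\<tau> \<le> n" if "n \<in> R" for n
    unfolding \<tau>_def using that by (rule Least_le)
  have unret: "unreturned x k U \<longleftrightarrow> k < \<tau>" for k
  proof
    assume "unreturned x k U"
    then show "k < \<tau>"
      using \<tau> unfolding unreturned_def R_def by (metis (mono_tags) atLeastAtMost_iff linorder_not_less mem_Collect_eq)
  next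
    assume "k < \<tau>"
    then show "unreturned x k U"
      using least unfolding unreturned_def R_def
      by (metis (mono_tags, lifting) atLeastAtMost_iff leD le_less_trans mem_Collect_eq)
  qed
  have "return_time q x U E = jump_time q x U E \<tau>"
    unfolding return_time_def R_def[symmetric]
  proof (rule antisym)
    show "(INF n\<in>R. jump_time q x U E n) \<le> jump_time q x U E \<tau>"
      using \<tau> by (rule INF_lower)
    show "jump_time q x U E \<tau> \<le> (INF n\<in>R. jump_time q x U E n)"
      unfolding jump_time_def
      by (intro INF_greatest sum_mono2) (auto dest: least)
  qed
  also have "\<dots> = (\<Sum>k<\<tau>. ?h k)" by (simp add: jump_time_def)
  also have "\<dots> = (\<Sum>k. if unreturned x k U then ?h k else 0)"
    by (subst suminf_finite[of "{..<\<tau>}"]) (auto simp: unret)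
  finally show ?thesis by (simp add: excursion_length_def)
qed

lemma excursion_length_le_return_time: "excursion_length q x U E \<le> return_time q x U E"
  by (cases "\<forall>n. unreturned x n U")
     (simp_all add: return_time_eq_PInf return_time_eq_excursion_length)

abbreviation clock_measure :: "(nat \<Rightarrow> real) measure" where
  "clock_measure \<equiv> (\<Pi>\<^sub>M n\<in>UNIV. density lborel (\<lambda>t. ennreal (exponential_density 1 t)))"

lemma prob_space_exponential: "prob_space (density lborel (\<lambda>t. ennreal (exponential_density 1 t)))"
  by (rule prob_space_exponential_density) simp

lemma prob_space_clock_measure: "prob_space clock_measure"
  by (intro prob_space_PiM prob_space_exponential)

lemma nn_integral_exponential:
  "(\<integral>\<^sup>+ t. ennreal t \<partial>density lborel (\<lambda>t. ennreal (exponential_density 1 t))) = 1"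
proof -
  let ?D = "density lborel (\<lambda>t. ennreal (exponential_density 1 t))"
  have "(\<integral>\<^sup>+ t. ennreal t \<partial>?D) =
      (\<integral>\<^sup>+ t. ennreal (exponential_density 1 t) * ennreal t \<partial>lborel)"
    by (subst nn_integral_density) auto
  also have "\<dots> = (\<integral>\<^sup>+ t. ennreal (erlang_density 0 1 t * t ^ 1) \<partial>lborel)"
    by (intro nn_integral_cong) (auto simp: ennreal_mult' exponential_density_def erlang_density_def)
  also have "\<dots> = 1"
    using nn_integral_erlang_ith_moment[of 1 0 1] by simp
  finally show ?thesis .
qed

lemma nn_integral_clock: "(\<integral>\<^sup>+ E. ennreal (E n) \<partial>clock_measure) = 1"
proof -
  let ?D = "density lborel (\<lambda>t. ennreal (exponential_density 1 t))"
  have "(\<integral>\<^sup>+ E. ennreal (E n) \<partial>clock_measure) =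
      (\<integral>\<^sup>+ t. ennreal t \<partial>distr clock_measure ?D (\<lambda>E. E n))"
    by (subst nn_integral_distr) auto
  also have "distr clock_measure ?D (\<lambda>E. E n) = ?D"
    by (rule distr_PiM_component[of UNIV "\<lambda>_. ?D" n]) (auto intro: prob_space_exponential)
  finally show ?thesis by (simp add: nn_integral_exponential)
qed

lemma emeasure_unreturned:
  fixes x :: "'s::countable"
  shows "emeasure (jump_measure p) {U. unreturned x n U} = (\<integral>\<^sup>+ y. taboo p x n y \<partial>count_space UNIV)"
proof -
  have "{U. unreturned x n U} = (\<Union>y. {U. jump_chain x U n = y \<and> unreturned x n U})" by auto
  also have "emeasure (jump_measure p) \<dots> =
      (\<integral>\<^sup>+ y. emeasure (jump_measure p) {U. jump_chain x U n = y \<and> unreturned x n U} \<partial>count_space UNIV)"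
    by (intro emeasure_UN_countable) (auto simp: disjoint_family_on_def unreturned_measurable)
  finally show ?thesis by (simp add: emeasure_taboo)
qed

text \<open>By continuity from above, the mass that has not yet returned decreases to the probability that
  the chain never returns.\<close>

lemma emeasure_never_returned:
  fixes x :: "'s::countable"
  shows "(\<lambda>n. \<integral>\<^sup>+ y. taboo p x n y \<partial>count_space UNIV)
    \<longlonglongrightarrow> emeasure (jump_measure p) {U. \<forall>n. unreturned x n U}"
proof -
  interpret P: prob_space "jump_measure p" by (rule prob_space_jump_measure)
  have "(\<lambda>n. emeasure (jump_measure p) {U. unreturned x n U})
    \<longlonglongrightarrow> emeasure (jump_measure p) (\<Inter>n. {U. unreturned x n U})"
    by (intro Lim_emeasure_decseq)
       (auto simp: unreturned_measurable decseq_Suc_iff unreturned_Suc P.emeasure_eq_measure)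
  moreover have "(\<Inter>n. {U. unreturned x n U}) = {U. \<forall>n. unreturned x n U}" by auto
  ultimately show ?thesis by (simp add: emeasure_unreturned)
qed

lemma excursion_length_measurable:
  fixes x :: "'s::countable"
  shows "(\<lambda>(U, E). if unreturned x k U
     then ennreal (E k) / ennreal (exit_rate q (jump_chain x U k)) else 0) \<in>
    borel_measurable (jump_measure p \<Otimes>\<^sub>M clock_measure)"
proof -
  let ?N = "jump_measure p \<Otimes>\<^sub>M clock_measure"
  have j: "(\<lambda>z. jump_chain x (fst z) k) \<in> measurable ?N (count_space UNIV)"
    by (rule measurable_compose[OF measurable_fst jump_chain_measurable])
  have 1: "(\<lambda>z. ennreal (exit_rate q (jump_chain x (fst z) k))) \<in> borel_measurable ?N"
    by (rule measurable_compose[OF j]) simp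
  have "(\<lambda>E. E k) \<in> measurable clock_measure (density lborel (\<lambda>t. ennreal (exponential_density 1 t)))"
    by simp
  then have "(\<lambda>E. E k) \<in> borel_measurable clock_measure"
    by (simp cong: measurable_cong_sets)
  then have 2: "(\<lambda>z. snd z k) \<in> borel_measurable ?N"
    by (rule measurable_compose[OF measurable_snd])
  have 3: "{z \<in> space ?N. unreturned x k (fst z)} \<in> sets ?N"
    using measurable_sets[OF measurable_fst unreturned_measurable(2)[of x k p], of clock_measure]
    by (simp add: vimage_def Int_def conj_commute)
  have "(\<lambda>z. if unreturned x k (fst z)
     then ennreal (snd z k) / ennreal (exit_rate q (jump_chain x (fst z) k)) else 0) \<in> borel_measurable ?N"
    using 1 2 3 by (intro measurable_If) auto
  then show ?thesis by (simp add: case_prod_beta)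
qed

text \<open>The holding times have mean 1 after scaling and are independent of the jump chain, so each visit
  of \<open>y\<close> contributes the mean holding time there.\<close>

lemma nn_integral_excursion_length:
  fixes x :: "'s::countable"
  shows "(\<integral>\<^sup>+ (U, E). excursion_length q x U E \<partial>chain_space q) =
    (\<Sum>k. \<integral>\<^sup>+ y. taboo (jump_pmf q) x k y / ennreal (exit_rate q y) \<partial>count_space UNIV)"
proof -
  let ?P = "jump_measure (jump_pmf q)"
  let ?f = "\<lambda>k U E. if unreturned x k U
     then ennreal (E k) / ennreal (exit_rate q (jump_chain x U k)) else 0"
  interpret C: prob_space clock_measure by (rule prob_space_clock_measure)
  have "(\<integral>\<^sup>+ (U, E). excursion_length q x U E \<partial>chain_space q) =
      (\<integral>\<^sup>+ z. (\<Sum>k. ?f k (fst z) (snd z)) \<partial>(?P \<Otimes>\<^sub>M clock_measure))"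
    by (simp add: chain_space_def excursion_length_def case_prod_beta')
  also have "\<dots> = (\<Sum>k. \<integral>\<^sup>+ z. ?f k (fst z) (snd z) \<partial>(?P \<Otimes>\<^sub>M clock_measure))"
    using excursion_length_measurable[of x _ q "jump_pmf q"]
    by (intro nn_integral_suminf) (simp add: case_prod_beta)
  also have "\<dots> = (\<Sum>k. \<integral>\<^sup>+ y. taboo (jump_pmf q) x k y / ennreal (exit_rate q y) \<partial>count_space UNIV)"
  proof (intro suminf_cong)
    fix k
    let ?A = "\<lambda>y. {U. jump_chain x U k = y \<and> unreturned x k U}"
    have "(\<integral>\<^sup>+ z. ?f k (fst z) (snd z) \<partial>(?P \<Otimes>\<^sub>M clock_measure)) =
        (\<integral>\<^sup>+ U. \<integral>\<^sup>+ E. ?f k U E \<partial>clock_measure \<partial>?P)"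
      using C.nn_integral_fst[OF excursion_length_measurable[of x k q "jump_pmf q"]]
      by (simp add: case_prod_beta' cong: if_cong)
    also have "\<dots> = (\<integral>\<^sup>+ U. (if unreturned x k U then 1 / ennreal (exit_rate q (jump_chain x U k)) else 0) \<partial>?P)"
    proof (intro nn_integral_cong)
      fix U
      have "(\<lambda>E. E k) \<in> measurable clock_measure (density lborel (\<lambda>t. ennreal (exponential_density 1 t)))"
        by simp
      then have "(\<lambda>E. E k) \<in> borel_measurable clock_measure"
        by (simp cong: measurable_cong_sets)
      then show "(\<integral>\<^sup>+ E. ?f k U E \<partial>clock_measure) =
          (if unreturned x k U then 1 / ennreal (exit_rate q (jump_chain x U k)) else 0)"
        by (auto simp: nn_integral_divide nn_integral_clock)
    qed
    also have "\<dots> = (\<integral>\<^sup>+ U. \<integral>\<^sup>+ y. indicator (?A y) U / ennreal (exit_rate q y) \<partial>count_space UNIV \<partial>?P)"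
    proof (intro nn_integral_cong)
      fix U
      have "(\<integral>\<^sup>+ y. indicator (?A y) U / ennreal (exit_rate q y) \<partial>count_space UNIV) =
         (\<integral>\<^sup>+ y. (if unreturned x k U then 1 / ennreal (exit_rate q (jump_chain x U k)) else 0) *
           indicator {jump_chain x U k} y \<partial>count_space UNIV)"
        by (intro nn_integral_cong) (auto split: split_indicator)
      then show "(if unreturned x k U then 1 / ennreal (exit_rate q (jump_chain x U k)) else 0) =
         (\<integral>\<^sup>+ y. indicator (?A y) U / ennreal (exit_rate q y) \<partial>count_space UNIV)"
        by simp
    qed
    also have "\<dots> = (\<integral>\<^sup>+ y. \<integral>\<^sup>+ U. indicator (?A y) U / ennreal (exit_rate q y) \<partial>?P \<partial>count_space UNIV)"
      using unreturned_measurable(1)[of x k _ "jump_pmf q"]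
      by (intro nn_integral_count_space_nn_integral borel_measurable_divide borel_measurable_indicator) auto
    also have "\<dots> = (\<integral>\<^sup>+ y. taboo (jump_pmf q) x k y / ennreal (exit_rate q y) \<partial>count_space UNIV)"
    proof (intro nn_integral_cong)
      fix y
      have "?A y \<in> sets ?P" by (rule unreturned_measurable)
      then show "(\<integral>\<^sup>+ U. indicator (?A y) U / ennreal (exit_rate q y) \<partial>?P) =
          taboo (jump_pmf q) x k y / ennreal (exit_rate q y)"
        by (subst nn_integral_divide) (simp_all add: emeasure_taboo)
    qed
    finally show "(\<integral>\<^sup>+ z. ?f k (fst z) (snd z) \<partial>(?P \<Otimes>\<^sub>M clock_measure)) =
       (\<integral>\<^sup>+ y. taboo (jump_pmf q) x k y / ennreal (exit_rate q y) \<partial>count_space UNIV)" .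
  qed
  finally show ?thesis .
qed

lemma mean_return_time_eq:
  fixes x :: "'s::countable"
  assumes rec: "(\<lambda>n. \<integral>\<^sup>+ y. taboo (jump_pmf q) x n y \<partial>count_space UNIV) \<longlonglongrightarrow> 0"
  shows "mean_return_time q x =
    (\<Sum>k. \<integral>\<^sup>+ y. taboo (jump_pmf q) x k y / ennreal (exit_rate q y) \<partial>count_space UNIV)"
proof -
  let ?P = "jump_measure (jump_pmf q)"
  interpret C: prob_space clock_measure by (rule prob_space_clock_measure)
  have m: "{U. \<forall>n. unreturned x n U} \<in> sets ?P"
    using sets.countable_INT[of "\<lambda>n. {U. unreturned x n U}" UNIV ?P]
    by (simp add: unreturned_measurable image_subset_iff Collect_all_eq)
  have "emeasure ?P {U. \<forall>n. unreturned x n U} = 0"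
    using LIMSEQ_unique[OF emeasure_never_returned rec] .
  then have "{U. \<forall>n. unreturned x n U} \<times> space clock_measure \<in> null_sets (chain_space q)"
    unfolding chain_space_def using m
    by (intro null_setsI) (auto simp: C.emeasure_pair_measure_Times)
  then have "AE z in chain_space q. return_time q x (fst z) (snd z) = excursion_length q x (fst z) (snd z)"
    by (rule AE_I') (auto simp: chain_space_def space_pair_measure space_PiM
        intro: return_time_eq_excursion_length)
  then have "mean_return_time q x = (\<integral>\<^sup>+ (U, E). excursion_length q x U E \<partial>chain_space q)"
    unfolding mean_return_time_def by (intro nn_integral_cong_AE) (simp add: case_prod_beta')
  then show ?thesis by (simp add: nn_integral_excursion_length)
qed

text \<open>On the event that the chain never returns the return time is infinite, so a finite mean makes this
  event null.\<close>

lemma mean_return_time_finite: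
  fixes x :: "'s::countable"
  assumes fin: "mean_return_time q x < \<infinity>"
  shows "(\<lambda>n. \<integral>\<^sup>+ y. taboo (jump_pmf q) x n y \<partial>count_space UNIV) \<longlonglongrightarrow> 0"
    "(\<Sum>k. \<integral>\<^sup>+ y. taboo (jump_pmf q) x k y / ennreal (exit_rate q y) \<partial>count_space UNIV) < \<infinity>"
proof -
  let ?P = "jump_measure (jump_pmf q)"
  interpret C: prob_space clock_measure by (rule prob_space_clock_measure)
  let ?N = "{U. \<forall>n. unreturned x n U}"
  have m: "?N \<in> sets ?P"
    using sets.countable_INT[of "\<lambda>n. {U. unreturned x n U}" UNIV ?P]
    by (simp add: unreturned_measurable image_subset_iff Collect_all_eq)
  have mm: "?N \<times> space clock_measure \<in> sets (chain_space q)"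
    unfolding chain_space_def using m by (intro pair_measureI) auto
  have "\<infinity> * emeasure (chain_space q) (?N \<times> space clock_measure) =
      (\<integral>\<^sup>+ z. \<infinity> * indicator (?N \<times> space clock_measure) z \<partial>chain_space q)"
    using mm by (simp add: nn_integral_cmult_indicator)
  also have "\<dots> \<le> mean_return_time q x"
    unfolding mean_return_time_def
    by (intro nn_integral_mono) (auto split: split_indicator simp: return_time_eq_PInf)
  finally have "\<infinity> * emeasure (chain_space q) (?N \<times> space clock_measure) < \<infinity>"
    using fin by simp
  then have "emeasure (chain_space q) (?N \<times> space clock_measure) = 0"
    by (auto simp: ennreal_top_mult split: if_splits)
  then have "emeasure ?P ?N = 0"
    unfolding chain_space_def using m
    by (subst (asm) C.emeasure_pair_measure_Times) (auto simp: C.emeasure_space_1)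
  then show "(\<lambda>n. \<integral>\<^sup>+ y. taboo (jump_pmf q) x n y \<partial>count_space UNIV) \<longlonglongrightarrow> 0"
    using emeasure_never_returned[of "jump_pmf q" x] by simp
  have "(\<Sum>k. \<integral>\<^sup>+ y. taboo (jump_pmf q) x k y / ennreal (exit_rate q y) \<partial>count_space UNIV)
     \<le> mean_return_time q x"
    unfolding nn_integral_excursion_length[symmetric] mean_return_time_def
    by (intro nn_integral_mono) (auto simp: excursion_length_le_return_time)
  with fin show "(\<Sum>k. \<integral>\<^sup>+ y. taboo (jump_pmf q) x k y / ennreal (exit_rate q y) \<partial>count_space UNIV) < \<infinity>"
    by simp
qed

section \<open>Recurrence of reversible chains\<close>

lemma ennreal_le_divide:
  fixes a b c :: ennreal
  assumes "a * b \<le> c" "0 < a" "a < top"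
  shows "b \<le> c / a"
proof -
  have "b = a * b / a" using assms(2,3)
    by (metis ennreal_mult_divide_eq less_irrefl mult.commute)
  also have "\<dots> \<le> c / a" using assms(1) by (rule divide_right_mono_ennreal)
  finally show ?thesis .
qed

lemma ennreal_terms_tendsto_0:
  fixes f :: "nat \<Rightarrow> ennreal"
  assumes "suminf f < top"
  shows "f \<longlonglongrightarrow> 0"
proof -
  have f: "f = (\<lambda>n. ennreal (enn2real (f n)))"
    using ennreal_suminf_lessD[OF assms] by (auto simp: less_top)
  have "summable (\<lambda>n. enn2real (f n))"
    using assms f by (intro summable_suminf_not_top) auto
  then have "(\<lambda>n. ennreal (enn2real (f n))) \<longlonglongrightarrow> ennreal 0"
    by (intro tendsto_ennrealI summable_LIMSEQ_zero)
  with f show ?thesis by simp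
qed

text \<open>In the language of electrical networks, \<open>\<pi> x * q x y\<close> is the conductance of the edge between \<open>x\<close> and
  \<open>y\<close>.\<close>

locale reversible_chain =
  fixes S :: "'s::countable set" and q :: "'s \<Rightarrow> 's \<Rightarrow> real" and \<pi> :: "'s \<Rightarrow> real"
  assumes rate_nonneg: "x \<in> S \<Longrightarrow> 0 \<le> q x y"
    and finite_neighbours: "x \<in> S \<Longrightarrow> finite {y. q x y \<noteq> 0}"
    and rate_inside: "x \<in> S \<Longrightarrow> q x y \<noteq> 0 \<Longrightarrow> y \<in> S"
    and has_neighbour: "x \<in> S \<Longrightarrow> \<exists>y. q x y \<noteq> 0"
    and weight_pos: "x \<in> S \<Longrightarrow> 0 < \<pi> x"
    and balance: "x \<in> S \<Longrightarrow> y \<in> S \<Longrightarrow> \<pi> x * q x y = \<pi> y * q y x"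
begin

abbreviation "P x y \<equiv> ennreal (pmf (jump_pmf q x) y)"

lemma exit_rate_eq: "x \<in> S \<Longrightarrow> exit_rate q x = (\<Sum>y | q x y \<noteq> 0. q x y)"
  unfolding exit_rate_def
  by (subst infsum_cong_neutral[where T = "{y. q x y \<noteq> 0}" and g = "q x"])
     (auto simp: finite_neighbours)

lemma exit_rate_pos: "x \<in> S \<Longrightarrow> 0 < exit_rate q x"
  unfolding exit_rate_eq using has_neighbour[of x] rate_nonneg[of x] finite_neighbours[of x]
  by (intro sum_pos) (auto simp: less_le)

lemma nn_integral_rate: "x \<in> S \<Longrightarrow> (\<integral>\<^sup>+ y. ennreal (q x y) \<partial>count_space UNIV) = ennreal (exit_rate q x)"
  using finite_neighbours[of x] rate_nonneg[of x]
  by (subst nn_integral_count_space'[where A = "{y. q x y \<noteq> 0}"])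
     (auto simp: exit_rate_eq sum_ennreal)

lemma pmf_jump: "x \<in> S \<Longrightarrow> pmf (jump_pmf q x) y = q x y / exit_rate q x"
proof -
  assume x: "x \<in> S"
  have "(\<integral>\<^sup>+ y. ennreal (q x y / exit_rate q x) \<partial>count_space UNIV) =
      (\<integral>\<^sup>+ y. ennreal (q x y) / ennreal (exit_rate q x) \<partial>count_space UNIV)"
    using x exit_rate_pos rate_nonneg by (intro nn_integral_cong) (simp add: divide_ennreal)
  also have "\<dots> = 1"
    using exit_rate_pos[OF x] by (simp add: nn_integral_divide nn_integral_rate[OF x] divide_ennreal)
  finally show ?thesis
    using exit_rate_pos[OF x] rate_nonneg[OF x] unfolding jump_pmf_def
    by (subst if_not_P) (auto intro!: pmf_embed_pmf)
qed

text \<open>Up to a factor, the stationary weight of the jump chain.\<close>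

definition w :: "'s \<Rightarrow> ennreal" where
  "w z = (if z \<in> S then ennreal (\<pi> z * exit_rate q z) else 0)"

lemma w_finite: "w z < \<infinity>"
  by (simp add: w_def)

lemma w_pos: "z \<in> S \<Longrightarrow> 0 < w z"
  by (simp add: w_def weight_pos exit_rate_pos)

lemma w_flow: "w z * P z y = (if z \<in> S then ennreal (\<pi> z * q z y) else 0)"
  using exit_rate_pos[of z] weight_pos[of z] rate_nonneg[of z y]
  by (auto simp: w_def pmf_jump ennreal_mult[symmetric])

text \<open>Detailed balance turns the flow into \<open>y\<close> into the flow out of \<open>y\<close>.\<close>

lemma w_invariant:
  assumes "y \<in> S"
  shows "(\<integral>\<^sup>+ z. w z * P z y \<partial>count_space UNIV) = w y"
proof -
  have "w z * P z y = ennreal (\<pi> y) * ennreal (q y z)" for z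
  proof (cases "z \<in> S")
    case True
    then show ?thesis
      using balance[of z y] assms weight_pos[of y] rate_nonneg[of y z]
      by (simp add: w_flow ennreal_mult)
  next
    case False
    then have "q y z = 0" using rate_inside[OF assms, of z] by blast
    with False show ?thesis by (simp add: w_flow)
  qed
  then show ?thesis
    using assms weight_pos[of y] exit_rate_pos[of y]
    by (simp add: nn_integral_cmult nn_integral_rate w_def ennreal_mult)
qed

lemma taboo_outside:
  assumes "x \<in> S" "y \<notin> S"
  shows "taboo (jump_pmf q) x n y = 0"
  using assms(2)
proof (induction n arbitrary: y)
  case 0
  then show ?case using assms(1) by auto
next
  case (Suc n)
  have "taboo (jump_pmf q) x n z * P z y = 0" for z
  proof (cases "z \<in> S")
    case True
    then have "q z y = 0" using rate_inside Suc.prems by blast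
    with True show ?thesis by (simp add: pmf_jump)
  qed (simp add: Suc.IH)
  then have *: "(\<lambda>z. taboo (jump_pmf q) x n z * P z y) = (\<lambda>z. 0)" by blast
  show ?case unfolding taboo.simps * by simp
qed

text \<open>Among the measures that are invariant off \<open>x\<close>, the expected occupation of an excursion from
  \<open>x\<close> is the smallest; this bounds it by the stationary weight.\<close>

lemma occupation_le:
  assumes x: "x \<in> S"
  shows "w x * (\<Sum>k<n. taboo (jump_pmf q) x k y) \<le> w y"
proof (induction n arbitrary: y)
  case (Suc n)
  have shift: "(\<Sum>k<Suc n. taboo (jump_pmf q) x k y) =
      taboo (jump_pmf q) x 0 y + (\<Sum>k<n. taboo (jump_pmf q) x (Suc k) y)"
    by (rule sum.lessThan_Suc_shift)
  consider "y = x" | "y \<noteq> x" "y \<in> S" | "y \<notin> S" by blast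
  then show ?case
  proof cases
    case 1
    then show ?thesis unfolding shift by simp
  next
    case 2
    have "w x * (\<Sum>k<Suc n. taboo (jump_pmf q) x k y) =
        w x * (\<Sum>k<n. \<integral>\<^sup>+ z. taboo (jump_pmf q) x k z * P z y \<partial>count_space UNIV)"
      unfolding shift using 2 by simp
    also have "\<dots> = (\<integral>\<^sup>+ z. (w x * (\<Sum>k<n. taboo (jump_pmf q) x k z)) * P z y \<partial>count_space UNIV)"
      by (simp add: nn_integral_sum[symmetric] nn_integral_cmult[symmetric] sum_distrib_right mult.assoc)
    also have "\<dots> \<le> (\<integral>\<^sup>+ z. w z * P z y \<partial>count_space UNIV)"
      by (intro nn_integral_mono mult_right_mono Suc.IH) auto
    also have "\<dots> = w y" by (rule w_invariant[OF 2(2)])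
    finally show ?thesis .
  next
    case 3
    then show ?thesis by (simp add: taboo_outside[OF x])
  qed
qed simp

definition occupation :: "'s \<Rightarrow> 's \<Rightarrow> ennreal" where
  "occupation x y = (\<Sum>k. taboo (jump_pmf q) x k y)"

lemma occupation_le_w:
  assumes "x \<in> S"
  shows "w x * occupation x y \<le> w y"
proof -
  have "w x * occupation x y = (\<Sum>k. w x * taboo (jump_pmf q) x k y)"
    unfolding occupation_def by (rule ennreal_suminf_cmult[symmetric])
  also have "\<dots> \<le> w y"
    by (rule suminf_le_const) (auto simp only: sum_distrib_left[symmetric] intro: occupation_le[OF assms])
  finally show ?thesis .
qed

lemma occupation_finite: "x \<in> S \<Longrightarrow> occupation x y < \<infinity>"
  using occupation_le_w[of x y] w_pos[of x] w_finite[of y]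
  by (auto simp: less_top[symmetric] ennreal_mult_eq_top_iff top_unique)

lemma sum_occupation_time:
  "(\<Sum>k. \<integral>\<^sup>+ y. taboo (jump_pmf q) x k y / ennreal (exit_rate q y) \<partial>count_space UNIV) =
   (\<integral>\<^sup>+ y. occupation x y / ennreal (exit_rate q y) \<partial>count_space UNIV)"
  unfolding occupation_def divide_ennreal_def ennreal_suminf_multc[symmetric]
  by (rule nn_integral_suminf[symmetric]) simp

abbreviation mass :: "'s \<Rightarrow> nat \<Rightarrow> ennreal" where
  "mass x n \<equiv> \<integral>\<^sup>+ y. taboo (jump_pmf q) x n y \<partial>count_space UNIV"

lemma nn_integral_P: "(\<integral>\<^sup>+ y. P z y \<partial>count_space UNIV) = 1"
  using measure_pmf.emeasure_space_1[of "jump_pmf q z"] by (simp add: nn_integral_pmf)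

text \<open>Mass that is outside of \<open>\<Lambda>\<close> at time \<open>N\<close> must have crossed the boundary of \<open>\<Lambda>\<close> outwards before, and
  the right hand side counts these crossings.\<close>

lemma escape_le:
  assumes x: "x \<in> \<Lambda>"
  shows "(\<integral>\<^sup>+ z. taboo (jump_pmf q) x N z * indicator (-\<Lambda>) z \<partial>count_space UNIV) \<le>
    (\<integral>\<^sup>+ y. indicator \<Lambda> y * (\<Sum>n<N. taboo (jump_pmf q) x n y) *
       (\<integral>\<^sup>+ z. P y z * indicator (-\<Lambda>) z \<partial>count_space UNIV) \<partial>count_space UNIV)"
    (is "?out N \<le> ?flow N")
proof (induction N)
  case 0
  have "?out 0 = 0" using x by (subst nn_integral_0_iff_AE) (auto simp: AE_count_space indicator_def)
  then show ?case by simp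
next
  case (Suc N)
  let ?e = "\<lambda>y. \<integral>\<^sup>+ z. P y z * indicator (-\<Lambda>) z \<partial>count_space UNIV"
  have e1: "?e y \<le> 1" for y
    unfolding nn_integral_P[of y, symmetric] by (intro nn_integral_mono) (auto split: split_indicator)
  have "?out (Suc N) \<le> (\<integral>\<^sup>+ z. \<integral>\<^sup>+ y. taboo (jump_pmf q) x N y * P y z * indicator (-\<Lambda>) z
      \<partial>count_space UNIV \<partial>count_space UNIV)"
    by (intro nn_integral_mono) (auto split: split_indicator)
  also have "\<dots> = (\<integral>\<^sup>+ y. \<integral>\<^sup>+ z. taboo (jump_pmf q) x N y * P y z * indicator (-\<Lambda>) z
      \<partial>count_space UNIV \<partial>count_space UNIV)"
    by (rule nn_integral_count_space_nn_integral) auto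
  also have "\<dots> = (\<integral>\<^sup>+ y. taboo (jump_pmf q) x N y * ?e y \<partial>count_space UNIV)"
    by (simp add: mult.assoc nn_integral_cmult)
  also have "\<dots> \<le> (\<integral>\<^sup>+ y. taboo (jump_pmf q) x N y * indicator (-\<Lambda>) y +
      indicator \<Lambda> y * taboo (jump_pmf q) x N y * ?e y \<partial>count_space UNIV)"
    using mult_left_mono[OF e1, of "taboo (jump_pmf q) x N _"]
    by (intro nn_integral_mono) (auto split: split_indicator)
  also have "\<dots> = ?out N + (\<integral>\<^sup>+ y. indicator \<Lambda> y * taboo (jump_pmf q) x N y * ?e y \<partial>count_space UNIV)"
    by (rule nn_integral_add) auto
  also have "\<dots> \<le> ?flow N + (\<integral>\<^sup>+ y. indicator \<Lambda> y * taboo (jump_pmf q) x N y * ?e y \<partial>count_space UNIV)"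
    using Suc.IH by (rule add_right_mono)
  also have "\<dots> = ?flow (Suc N)"
    by (subst nn_integral_add[symmetric]) (auto simp: algebra_simps intro!: nn_integral_cong)
  finally show ?case .
qed

text \<open>Let \<open>\<Lambda>\<close> be a finite set of states around \<open>x\<close>.  An excursion that has not ended at time \<open>n\<close> is
  either still in \<open>\<Lambda>\<close>, which becomes unlikely as the occupation of \<open>\<Lambda>\<close> is finite, or it has crossed
  the boundary of \<open>\<Lambda>\<close>.  By minimality of the occupation measure the expected number of such
  crossings is at most the conductance of the boundary, relative to the weight of \<open>x\<close>.  So the
  excursion ends almost surely, and its mean length is bounded by the total weight.\<close>

lemma positive_recurrent_at:
  assumes x: "x \<in> S"
    and fin: "(\<integral>\<^sup>+ y. ennreal (\<pi> y) \<partial>count_space S) < \<infinity>"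
    and cuts: "\<And>\<epsilon>::real. 0 < \<epsilon> \<Longrightarrow> \<exists>\<Lambda>. finite \<Lambda> \<and> \<Lambda> \<subseteq> S \<and> x \<in> \<Lambda> \<and>
        (\<Sum>y\<in>\<Lambda>. \<Sum>z | q y z \<noteq> 0 \<and> z \<notin> \<Lambda>. \<pi> y * q y z) \<le> \<epsilon>"
  shows "mean_return_time q x < \<infinity>"
proof -
  have inside: "(\<lambda>n. \<Sum>y\<in>\<Lambda>. taboo (jump_pmf q) x n y) \<longlonglongrightarrow> 0" if "finite \<Lambda>" for \<Lambda>
  proof -
    have "(\<lambda>n. taboo (jump_pmf q) x n y) \<longlonglongrightarrow> 0" for y
      using occupation_finite[OF x, of y] unfolding occupation_def by (intro ennreal_terms_tendsto_0) simp
    then have "(\<lambda>n. \<Sum>y\<in>\<Lambda>. taboo (jump_pmf q) x n y) \<longlonglongrightarrow> (\<Sum>y\<in>\<Lambda>. 0)"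
      by (intro tendsto_sum)
    then show ?thesis by simp
  qed
  have bound: "limsup (mass x) \<le> ennreal \<epsilon> / w x" if \<epsilon>: "0 < \<epsilon>" for \<epsilon>
  proof -
    obtain \<Lambda> where \<Lambda>: "finite \<Lambda>" "\<Lambda> \<subseteq> S" "x \<in> \<Lambda>"
      and cut: "(\<Sum>y\<in>\<Lambda>. \<Sum>z | q y z \<noteq> 0 \<and> z \<notin> \<Lambda>. \<pi> y * q y z) \<le> \<epsilon>"
      using cuts[OF \<epsilon>] by blast
    have out: "w x * (\<integral>\<^sup>+ z. taboo (jump_pmf q) x N z * indicator (-\<Lambda>) z \<partial>count_space UNIV) \<le> ennreal \<epsilon>" for N
    proof -
      let ?e = "\<lambda>y. \<integral>\<^sup>+ z. P y z * indicator (-\<Lambda>) z \<partial>count_space UNIV"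
      have "w x * (\<integral>\<^sup>+ z. taboo (jump_pmf q) x N z * indicator (-\<Lambda>) z \<partial>count_space UNIV) \<le>
        w x * (\<integral>\<^sup>+ y. indicator \<Lambda> y * (\<Sum>n<N. taboo (jump_pmf q) x n y) * ?e y \<partial>count_space UNIV)"
        by (intro mult_left_mono escape_le \<Lambda>) auto
      also have "\<dots> = (\<integral>\<^sup>+ y. indicator \<Lambda> y * (w x * (\<Sum>n<N. taboo (jump_pmf q) x n y)) * ?e y \<partial>count_space UNIV)"
        by (simp add: nn_integral_cmult[symmetric] mult_ac)
      also have "\<dots> \<le> (\<integral>\<^sup>+ y. indicator \<Lambda> y * w y * ?e y \<partial>count_space UNIV)"
        by (intro nn_integral_mono mult_right_mono mult_left_mono occupation_le x) auto
      also have "\<dots> = (\<integral>\<^sup>+ y. (w y * ?e y) * indicator \<Lambda> y \<partial>count_space UNIV)"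
        by (simp add: mult_ac)
      also have "\<dots> = (\<Sum>y\<in>\<Lambda>. w y * ?e y)"
        using \<Lambda>(1) by (simp add: nn_integral_count_space_indicator[symmetric] nn_integral_count_space_finite)
      also have "\<dots> = (\<Sum>y\<in>\<Lambda>. ennreal (\<Sum>z | q y z \<noteq> 0 \<and> z \<notin> \<Lambda>. \<pi> y * q y z))"
      proof (intro sum.cong refl)
        fix y assume "y \<in> \<Lambda>"
        then have y: "y \<in> S" using \<Lambda> by blast
        have "w y * ?e y = (\<integral>\<^sup>+ z. (w y * P y z) * indicator (-\<Lambda>) z \<partial>count_space UNIV)"
          by (simp add: nn_integral_cmult[symmetric] mult.assoc)
        also have "\<dots> = (\<Sum>z | q y z \<noteq> 0 \<and> z \<notin> \<Lambda>. ennreal (\<pi> y * q y z))"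
          using y finite_neighbours[OF y]
          by (subst nn_integral_count_space'[where A = "{z. q y z \<noteq> 0 \<and> z \<notin> \<Lambda>}"])
             (auto simp: w_flow split: split_indicator)
        also have "\<dots> = ennreal (\<Sum>z | q y z \<noteq> 0 \<and> z \<notin> \<Lambda>. \<pi> y * q y z)"
          using weight_pos[OF y] rate_nonneg[OF y] by (intro sum_ennreal) auto
        finally show "w y * ?e y = ennreal (\<Sum>z | q y z \<noteq> 0 \<and> z \<notin> \<Lambda>. \<pi> y * q y z)" .
      qed
      also have "\<dots> = ennreal (\<Sum>y\<in>\<Lambda>. \<Sum>z | q y z \<noteq> 0 \<and> z \<notin> \<Lambda>. \<pi> y * q y z)"
        using weight_pos rate_nonneg \<Lambda>(2) by (intro sum_ennreal sum_nonneg) (auto simp: subset_iff less_imp_le)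
      also have "\<dots> \<le> ennreal \<epsilon>" using cut by (rule ennreal_leI)
      finally show ?thesis .
    qed
    have split: "mass x n = (\<Sum>y\<in>\<Lambda>. taboo (jump_pmf q) x n y) +
        (\<integral>\<^sup>+ z. taboo (jump_pmf q) x n z * indicator (-\<Lambda>) z \<partial>count_space UNIV)" for n
    proof -
      have "mass x n = (\<integral>\<^sup>+ z. taboo (jump_pmf q) x n z * indicator \<Lambda> z +
          taboo (jump_pmf q) x n z * indicator (-\<Lambda>) z \<partial>count_space UNIV)"
        by (intro nn_integral_cong) (auto split: split_indicator)
      then show ?thesis
        using \<Lambda>(1) by (simp add: nn_integral_add nn_integral_count_space_indicator[symmetric]
            nn_integral_count_space_finite)
    qed
    have "mass x n \<le> (\<Sum>y\<in>\<Lambda>. taboo (jump_pmf q) x n y) + ennreal \<epsilon> / w x" for n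
      unfolding split using out[of n] w_pos[OF x] w_finite[of x]
      by (intro add_left_mono ennreal_le_divide) auto
    then have "limsup (mass x) \<le> limsup (\<lambda>n. (\<Sum>y\<in>\<Lambda>. taboo (jump_pmf q) x n y) + ennreal \<epsilon> / w x)"
      by (intro Limsup_mono) auto
    also have "\<dots> = 0 + ennreal \<epsilon> / w x"
      by (intro lim_imp_Limsup tendsto_add inside \<Lambda>) auto
    finally show ?thesis by simp
  qed
  have "limsup (mass x) \<le> 0"
  proof (rule ennreal_le_epsilon)
    fix e :: real assume e: "0 < e"
    obtain r where r: "w x = ennreal r" "0 < r"
      using w_pos[OF x] w_finite[of x] by (cases "w x") (auto simp: less_top[symmetric])
    have "limsup (mass x) \<le> ennreal (e * r) / w x"
      using e r by (intro bound) auto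
    also have "\<dots> = ennreal e" using e r by (simp add: divide_ennreal)
    finally show "limsup (mass x) \<le> 0 + ennreal e" by simp
  qed
  then have "mass x \<longlonglongrightarrow> 0"
    using Liminf_le_Limsup[of sequentially "mass x"]
    by (intro Liminf_eq_Limsup) (auto simp: order_antisym)
  then have "mean_return_time q x = (\<integral>\<^sup>+ y. occupation x y / ennreal (exit_rate q y) \<partial>count_space UNIV)"
    by (simp add: mean_return_time_eq sum_occupation_time)
  also have "\<dots> \<le> (\<integral>\<^sup>+ y. (ennreal (\<pi> y) * indicator S y) / w x \<partial>count_space UNIV)"
  proof (intro nn_integral_mono)
    fix y
    show "occupation x y / ennreal (exit_rate q y) \<le> (ennreal (\<pi> y) * indicator S y) / w x"
    proof (cases "y \<in> S")
      case True
      obtain r where r: "w x = ennreal r" "0 < r"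
        using w_pos[OF x] w_finite[of x] by (cases "w x") (auto simp: less_top[symmetric])
      have "occupation x y / ennreal (exit_rate q y) \<le> w y / w x / ennreal (exit_rate q y)"
        using occupation_le_w[OF x, of y] w_pos[OF x] w_finite[of x]
        by (intro divide_right_mono_ennreal ennreal_le_divide) auto
      also have "\<dots> = (ennreal (\<pi> y) * indicator S y) / w x"
        using True r exit_rate_pos[OF True] weight_pos[OF True] by (simp add: w_def divide_ennreal)
      finally show ?thesis .
    next
      case False
      then have "occupation x y = 0" by (simp add: occupation_def taboo_outside[OF x])
      then show ?thesis by simp
    qed
  qed
  also have "\<dots> = (\<integral>\<^sup>+ y. ennreal (\<pi> y) \<partial>count_space S) / w x"
    by (simp add: nn_integral_divide nn_integral_count_space_indicator)
  also have "\<dots> < \<infinity>"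
    using fin w_pos[OF x] by (auto simp: ennreal_divide_eq_top_iff less_top[symmetric])
  finally show ?thesis .
qed

text \<open>If the chain returns almost surely, the occupation measure is itself invariant at \<open>x\<close>, so it
  touches the stationary weight there; touching propagates to all neighbours.\<close>

lemma summable_weight_if_finite_mean:
  assumes x: "x \<in> S"
    and fin: "mean_return_time q x < \<infinity>"
    and conn: "\<And>y. y \<in> S \<Longrightarrow> (x, y) \<in> {(a, b). a \<in> S \<and> q a b \<noteq> 0}\<^sup>*"
  shows "(\<integral>\<^sup>+ y. ennreal (\<pi> y) \<partial>count_space S) < \<infinity>"
proof -
  let ?t = "taboo (jump_pmf q) x" and ?G = "occupation x"
  have mass0: "mass x \<longlonglongrightarrow> 0"
    by (rule mean_return_time_finite(1)[OF fin])
  have G_fin: "(\<integral>\<^sup>+ y. ?G y / ennreal (exit_rate q y) \<partial>count_space UNIV) < \<infinity>"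
    using mean_return_time_finite(2)[OF fin] by (simp add: sum_occupation_time)
  have GP: "(\<integral>\<^sup>+ z. ?G z * P z y \<partial>count_space UNIV) = (\<Sum>n. \<integral>\<^sup>+ z. ?t n z * P z y \<partial>count_space UNIV)" for y
    unfolding occupation_def ennreal_suminf_multc[symmetric] by (rule nn_integral_suminf) simp
  have G_off: "?G y = (\<integral>\<^sup>+ z. ?G z * P z y \<partial>count_space UNIV)" if "y \<noteq> x" for y
  proof -
    have "?G y = (\<Sum>n. ?t (n + 1) y) + (\<Sum>n<1. ?t n y)"
      unfolding occupation_def by (rule suminf_offset) (rule summableI)
    then show ?thesis unfolding GP using that by simp
  qed
  have Gx: "?G x = 1"
  proof -
    have "?G x = (\<Sum>n. ?t (n + 1) x) + (\<Sum>n<1. ?t n x)"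
      unfolding occupation_def by (rule suminf_offset) (rule summableI)
    then show ?thesis by simp
  qed
  \<comment> \<open>The mass at time \<open>n\<close> either returns in the next step or survives.\<close>
  have step: "mass x n = (\<integral>\<^sup>+ z. ?t n z * P z x \<partial>count_space UNIV) + mass x (Suc n)" for n
  proof -
    have "mass x n = (\<integral>\<^sup>+ z. \<integral>\<^sup>+ y. ?t n z * P z y \<partial>count_space UNIV \<partial>count_space UNIV)"
      by (simp add: nn_integral_cmult nn_integral_P)
    also have "\<dots> = (\<integral>\<^sup>+ y. \<integral>\<^sup>+ z. ?t n z * P z y \<partial>count_space UNIV \<partial>count_space UNIV)"
      by (rule nn_integral_count_space_nn_integral) auto
    also have "\<dots> = (\<integral>\<^sup>+ y. (\<integral>\<^sup>+ z. ?t n z * P z x \<partial>count_space UNIV) * indicator {x} y + ?t (Suc n) y \<partial>count_space UNIV)"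
      by (intro nn_integral_cong) (auto split: split_indicator)
    also have "\<dots> = (\<integral>\<^sup>+ z. ?t n z * P z x \<partial>count_space UNIV) + mass x (Suc n)"
      by (subst nn_integral_add) auto
    finally show ?thesis .
  qed
  have total: "(\<Sum>n<N. \<integral>\<^sup>+ z. ?t n z * P z x \<partial>count_space UNIV) + mass x N = 1" for N
  proof (induction N)
    case 0
    have "mass x 0 = (\<integral>\<^sup>+ y. indicator {x} y \<partial>count_space UNIV)"
      by (intro nn_integral_cong) (auto split: split_indicator)
    then show ?case by simp
  next
    case (Suc N)
    then show ?case using step[of N] by (simp add: add.assoc)
  qed
  have "(\<lambda>N. (\<Sum>n<N. \<integral>\<^sup>+ z. ?t n z * P z x \<partial>count_space UNIV) + mass x N)
      \<longlonglongrightarrow> (\<Sum>n. \<integral>\<^sup>+ z. ?t n z * P z x \<partial>count_space UNIV) + 0"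
    by (intro tendsto_add mass0 summable_LIMSEQ summableI)
  then have G_at: "(\<integral>\<^sup>+ z. ?G z * P z x \<partial>count_space UNIV) = 1"
    unfolding total GP by (simp add: LIMSEQ_const_iff)
  have inv: "?G y = (\<integral>\<^sup>+ z. ?G z * P z y \<partial>count_space UNIV)" for y
    using G_off[of y] G_at Gx by (cases "y = x") auto
  \<comment> \<open>Two comparable measures with the same flow into \<open>y\<close> agree at the neighbours of \<open>y\<close>.\<close>
  have spread: "w x * ?G z = w z" if eq: "w x * ?G y = w y" and y: "y \<in> S" and z: "q y z \<noteq> 0" for y z
  proof -
    let ?f = "\<lambda>z. w x * ?G z * P z y" and ?g = "\<lambda>z. w z * P z y"
    have zS: "z \<in> S" using rate_inside y z by blast
    have fg: "?f u \<le> ?g u" for u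
      by (intro mult_right_mono occupation_le_w x) auto
    have f: "(\<integral>\<^sup>+ u. ?f u \<partial>count_space UNIV) = w y"
      unfolding eq[symmetric] by (subst (2) inv) (simp add: mult.assoc nn_integral_cmult)
    have g: "(\<integral>\<^sup>+ u. ?g u \<partial>count_space UNIV) = w y"
      by (rule w_invariant[OF y])
    have "(\<integral>\<^sup>+ u. ?g u - ?f u \<partial>count_space UNIV) =
        (\<integral>\<^sup>+ u. ?g u \<partial>count_space UNIV) - (\<integral>\<^sup>+ u. ?f u \<partial>count_space UNIV)"
      using fg f w_finite[of y] by (intro nn_integral_diff) auto
    also have "\<dots> = 0" using f g w_finite[of y] by simp
    finally have "?g z - ?f z = 0"
      by (subst (asm) nn_integral_0_iff_AE) (auto simp: AE_count_space)
    then have "?g z \<le> ?f z" using w_finite[of z] by (auto simp: ennreal_minus_eq_0)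
    then have e: "?g z = ?f z" using fg[of z] by (rule antisym)
    have "q z y \<noteq> 0"
      using balance[OF y zS] z weight_pos[OF y] by auto
    then have "pmf (jump_pmf q z) y \<noteq> 0"
      using pmf_jump[OF zS, of y] exit_rate_pos[OF zS] by simp
    then have "P z y \<noteq> 0" "P z y \<noteq> top"
      by (simp_all add: pmf_pos)
    then have "w x * ?G z = ?f z / P z y" "w z = ?g z / P z y"
      by (simp_all add: ennreal_mult_divide_eq)
    then show ?thesis using e by simp
  qed
  have touch: "w x * ?G y = w y" if "y \<in> S" for y
    using conn[OF that]
  proof (induction rule: rtrancl_induct)
    case base
    then show ?case by (simp add: Gx)
  next
    case (step y z)
    then show ?case using spread[of y z] by auto
  qed
  have "(\<integral>\<^sup>+ y. ennreal (\<pi> y) \<partial>count_space S) =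
      (\<integral>\<^sup>+ y. ennreal (\<pi> y) * indicator S y \<partial>count_space UNIV)"
    by (simp add: nn_integral_count_space_indicator)
  also have "\<dots> \<le> (\<integral>\<^sup>+ y. w x * (?G y / ennreal (exit_rate q y)) \<partial>count_space UNIV)"
  proof (intro nn_integral_mono)
    fix y
    show "ennreal (\<pi> y) * indicator S y \<le> w x * (?G y / ennreal (exit_rate q y))"
    proof (cases "y \<in> S")
      case True
      have "w x * (?G y / ennreal (exit_rate q y)) = w y / ennreal (exit_rate q y)"
        using touch[OF True] by (simp add: ennreal_times_divide)
      also have "\<dots> = ennreal (\<pi> y)"
        using True exit_rate_pos[OF True] weight_pos[OF True] by (simp add: w_def divide_ennreal)
      finally show ?thesis
        using True by (simp only: indicator_simps mult_1_right order_refl)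
    qed simp
  qed
  also have "\<dots> = w x * (\<integral>\<^sup>+ y. ?G y / ennreal (exit_rate q y) \<partial>count_space UNIV)"
    by (simp add: nn_integral_cmult)
  also have "\<dots> < \<infinity>"
    using G_fin w_finite[of x] by (simp add: ennreal_mult_less_top)
  finally show ?thesis .
qed

end

section \<open>Submultiplicative sequences\<close>

text \<open>Fekete's lemma in multiplicative form, with the limit identified as a lower bound of all the
  roots.  The geometric lower bound keeps the limit of the logarithms finite.\<close>

lemma submultiplicative_root_converges:
  fixes a :: "nat \<Rightarrow> real"
  assumes pos: "0 < c" and low: "\<And>n. c ^ n \<le> a n"
    and sub: "\<And>m n. a (m + n) \<le> a m * a n"
  obtains L where "(\<lambda>n. root n (a n)) \<longlonglongrightarrow> L" "0 \<le> L" "\<And>n. 0 < n \<Longrightarrow> L ^ n \<le> a n"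
proof -
  have a_pos: "0 < a n" for n
    using low[of n] zero_less_power[OF pos, of n] by linarith
  define b where "b n = ln (a n)" for n
  have b_sub: "b (m + n) \<le> b m + b n" for m n
    using sub[of m n] a_pos[of m] a_pos[of n] a_pos[of "m + n"]
    by (simp add: b_def flip: ln_mult_pos)
  have b_mult: "b (k * m + r) \<le> real k * b m + b r" for k m r
  proof (induction k)
    case (Suc k)
    have "b (Suc k * m + r) = b (m + (k * m + r))" by (simp add: add.assoc)
    also have "\<dots> \<le> b m + b (k * m + r)" by (rule b_sub)
    finally show ?case using Suc by (simp add: algebra_simps)
  qed simp
  have b_low: "ln c \<le> b n / real n" if "0 < n" for n
  proof -
    have "ln (c ^ n) \<le> b n" unfolding b_def using low[of n] pos a_pos[of n] by simp
    then show ?thesis using that pos by (simp add: ln_realpow field_simps)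
  qed
  define I where "I = (INF n\<in>{0<..}. b n / real n)"
  have bdd: "bdd_below ((\<lambda>n. b n / real n) ` {0<..})"
    by (rule bdd_belowI2[of _ "ln c"]) (use b_low in auto)
  have I_le: "I \<le> b n / real n" if "0 < n" for n
    unfolding I_def using bdd that by (intro cINF_lower) auto
  have lim: "(\<lambda>n. b n / real n) \<longlonglongrightarrow> I"
  proof (rule LIMSEQ_I)
    fix e :: real assume e: "0 < e"
    have "\<exists>m\<in>{0<..}. b m / real m < I + e / 2"
    proof (rule ccontr)
      assume "\<not> ?thesis"
      then have "I + e / 2 \<le> I" unfolding I_def
        by (intro cINF_greatest) (auto simp: I_def not_less)
      with e show False by simp
    qed
  \<comment> \<open>Division with remainder by an almost optimal \<open>m\<close> bounds \<open>b n / n\<close> for all large \<open>n\<close>.\<close>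
    then obtain m where m: "0 < m" "b m / real m < I + e / 2" by auto
    define C where "C = (\<Sum>r<m. \<bar>b r\<bar>) + \<bar>b m\<bar>"
    have up: "b n / real n \<le> b m / real m + C / real n" if n: "0 < n" for n
    proof -
      have r: "n mod m < m" using m by simp
      have "b n \<le> real (n div m) * b m + b (n mod m)"
        using b_mult[of "n div m" m "n mod m"] by (simp add: mult.commute)
      also have "b (n mod m) \<le> (\<Sum>r<m. \<bar>b r\<bar>)"
        using r member_le_sum[of "n mod m" "{..<m}" "\<lambda>r. \<bar>b r\<bar>"] by auto
      also have "real (n div m) * b m \<le> real n / real m * b m + \<bar>b m\<bar>"
      proof -
        have "real n = real m * real (n div m) + real (n mod m)"
          by (metis mult_div_mod_eq of_nat_add of_nat_mult)
        then have "real n / real m - real (n div m) = real (n mod m) / real m"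
          using m by (simp add: field_simps)
        moreover have "0 \<le> real (n mod m) / real m" "real (n mod m) / real m \<le> 1"
          using r m by (auto simp: field_simps)
        ultimately have "\<bar>real (n div m) - real n / real m\<bar> \<le> 1"
          by linarith
        then have "\<bar>(real (n div m) - real n / real m) * b m\<bar> \<le> 1 * \<bar>b m\<bar>"
          unfolding abs_mult by (intro mult_right_mono) auto
        then show ?thesis by (auto simp: algebra_simps abs_le_iff)
      qed
      finally have "b n \<le> real n / real m * b m + C" by (simp add: C_def)
      then have "b n / real n \<le> (real n / real m * b m + C) / real n"
        using n by (intro divide_right_mono) auto
      also have "\<dots> = b m / real m + C / real n" using n m by (simp add: field_simps)
      finally show ?thesis .
    qed
    obtain N where N: "C / (e / 2) < real N" using reals_Archimedean2 by blast
    show "\<exists>no. \<forall>n\<ge>no. norm (b n / real n - I) < e"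
    proof (intro exI[of _ "Suc N"] allI impI)
      fix n assume n: "Suc N \<le> n"
      then have "C / (e / 2) < real n" using N by linarith
      then have "C / real n < e / 2" using e n by (simp add: field_simps)
      then have "b n / real n < I + e" using up[of n] m(2) n by linarith
      then show "norm (b n / real n - I) < e" using I_le[of n] n by auto
    qed
  qed
  have "(\<lambda>n. exp (b n / real n)) \<longlonglongrightarrow> exp I"
    by (intro tendsto_exp lim)
  moreover have "\<forall>\<^sub>F n in sequentially. exp (b n / real n) = root n (a n)"
    using eventually_gt_at_top[of 0]
  proof eventually_elim
    case (elim n)
    then have "root n (a n) = a n powr (1 / real n)"
      using a_pos[of n] by (simp add: root_powr_inverse)
    then show ?case using a_pos[of n] by (simp add: b_def powr_def)
  qed
  ultimately have 1: "(\<lambda>n. root n (a n)) \<longlonglongrightarrow> exp I"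
    by (rule Lim_transform_eventually)
  have 2: "exp I ^ n \<le> a n" if n: "0 < n" for n
  proof -
    have "exp I ^ n = exp (real n * I)" by (simp add: exp_of_nat_mult)
    also have "real n * I \<le> b n" using I_le[OF n] n by (simp add: field_simps)
    also have "exp (b n) = a n" using a_pos by (simp add: b_def)
    finally show ?thesis by simp
  qed
  from 1 2 show thesis by (intro that[of "exp I"]) auto
qed

section \<open>Entries of matrices\<close>

definition column_sum :: "real^'d^'d::finite \<Rightarrow> 'd \<Rightarrow> real" where
  "column_sum g j = (\<Sum>i\<in>UNIV. \<bar>g $ i $ j\<bar>)"

definition entry_sum :: "real^'d^'d::finite \<Rightarrow> real" where
  "entry_sum g = (\<Sum>i\<in>UNIV. \<Sum>j\<in>UNIV. g $ i $ j)"

definition min_entry :: "real^'d^'d::finite \<Rightarrow> real" where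
  "min_entry g = Min (range (\<lambda>(i, j). g $ i $ j))"

lemma le_min_entry_iff: "t \<le> min_entry g \<longleftrightarrow> (\<forall>i j. t \<le> g $ i $ j)"
  unfolding min_entry_def by (subst Min_ge_iff) auto

lemma min_entry_le: "min_entry g \<le> g $ i $ j"
  using le_min_entry_iff[of "min_entry g" g] by simp

lemma min_entry_pos_iff: "0 < min_entry g \<longleftrightarrow> (\<forall>i j. 0 < g $ i $ j)"
  unfolding min_entry_def by (subst Min_gr_iff) auto

lemma entry_measurable [measurable]: "(\<lambda>g::real^'d^'d::finite. g $ i $ j) \<in> borel_measurable borel"
  by (intro borel_measurable_continuous_onI continuous_intros)

lemma min_entry_measurable [measurable]: "min_entry \<in> borel_measurable borel"
  unfolding borel_measurable_iff_ge le_min_entry_iff by measurable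

lemma column_sum_nonneg: "0 \<le> column_sum g j"
  by (simp add: column_sum_def sum_nonneg)

text \<open>The operator norm for the \<open>\<ell>\<^sub>1\<close> norm is attained at a unit vector.  This makes measurability and
  submultiplicativity elementary.\<close>

lemma l1_opnorm_eq_Max: "l1_opnorm g = Max (range (column_sum g))"
proof -
  have le: "l1_norm (g *v x) \<le> Max (range (column_sum g))" if x: "l1_norm x = 1" for x
  proof -
    have "l1_norm (g *v x) \<le> (\<Sum>i\<in>UNIV. \<Sum>j\<in>UNIV. \<bar>g $ i $ j\<bar> * \<bar>x $ j\<bar>)"
      unfolding l1_norm_def matrix_vector_mult_def
      by (intro sum_mono) (auto simp: abs_mult intro: order_trans[OF sum_abs])
    also have "\<dots> = (\<Sum>j\<in>UNIV. column_sum g j * \<bar>x $ j\<bar>)"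
      unfolding column_sum_def sum_distrib_right by (rule sum.swap)
    also have "\<dots> \<le> (\<Sum>j\<in>UNIV. Max (range (column_sum g)) * \<bar>x $ j\<bar>)"
      by (intro sum_mono mult_right_mono) auto
    also have "\<dots> = Max (range (column_sum g))"
      using x by (simp add: sum_distrib_left[symmetric] l1_norm_def)
    finally show ?thesis .
  qed
  obtain j where j: "Max (range (column_sum g)) = column_sum g j"
    using Max_in[of "range (column_sum g)"] by (metis UNIV_not_empty empty_is_image finite finite_imageI imageE)
  have ax: "l1_norm (axis j 1 :: real^'a) = 1"
    unfolding l1_norm_def axis_def by (simp add: if_distrib cong: if_cong)
  have "l1_norm (g *v axis j 1) = column_sum g j"
    unfolding l1_norm_def column_sum_def matrix_vector_mult_def axis_def
    by (simp add: if_distrib cong: if_cong)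
  with j ax show ?thesis
    unfolding l1_opnorm_def
    by (intro antisym cSUP_least cSUP_upper2[where x = "axis j 1"])
       (auto intro: bdd_aboveI2[OF le] simp: le[unfolded j])
qed

lemma column_sum_le_l1_opnorm: "column_sum g j \<le> l1_opnorm g"
  unfolding l1_opnorm_eq_Max by simp

lemma l1_opnorm_le_iff: "l1_opnorm g \<le> c \<longleftrightarrow> (\<forall>j. column_sum g j \<le> c)"
  unfolding l1_opnorm_eq_Max by (subst Max_le_iff) auto

lemma l1_opnorm_nonneg: "0 \<le> l1_opnorm g"
  using column_sum_le_l1_opnorm column_sum_nonneg by (rule order_trans[rotated])

lemma l1_opnorm_measurable [measurable]: "l1_opnorm \<in> borel_measurable borel"
  unfolding borel_measurable_iff_le l1_opnorm_le_iff column_sum_def by measurable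

lemma l1_opnorm_mat_1: "l1_opnorm (mat 1 :: real^'d^'d::finite) = 1"
proof -
  have "column_sum (mat 1 :: real^'d^'d) j = 1" for j
    unfolding column_sum_def mat_def by (simp add: if_distrib cong: if_cong)
  then have "column_sum (mat 1 :: real^'d^'d) = (\<lambda>_. 1)" by auto
  then show ?thesis unfolding l1_opnorm_eq_Max by simp
qed

lemma l1_opnorm_mult_le: "l1_opnorm (g ** h) \<le> l1_opnorm g * l1_opnorm h"
  unfolding l1_opnorm_le_iff
proof
  fix j
  have "column_sum (g ** h) j \<le> (\<Sum>i\<in>UNIV. \<Sum>k\<in>UNIV. \<bar>g $ i $ k\<bar> * \<bar>h $ k $ j\<bar>)"
    unfolding column_sum_def matrix_matrix_mult_def
    by (intro sum_mono) (auto simp: abs_mult intro: order_trans[OF sum_abs])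
  also have "\<dots> = (\<Sum>k\<in>UNIV. column_sum g k * \<bar>h $ k $ j\<bar>)"
    unfolding column_sum_def sum_distrib_right by (rule sum.swap)
  also have "\<dots> \<le> (\<Sum>k\<in>UNIV. l1_opnorm g * \<bar>h $ k $ j\<bar>)"
    by (intro sum_mono mult_right_mono column_sum_le_l1_opnorm) auto
  also have "\<dots> = l1_opnorm g * column_sum h j"
    by (simp add: column_sum_def sum_distrib_left)
  also have "\<dots> \<le> l1_opnorm g * l1_opnorm h"
    by (intro mult_left_mono column_sum_le_l1_opnorm l1_opnorm_nonneg)
  finally show "column_sum (g ** h) j \<le> l1_opnorm g * l1_opnorm h" .
qed

lemma entry_sum_le_l1_opnorm:
  fixes g :: "real^'d^'d::finite"
  shows "entry_sum g \<le> real CARD('d) * l1_opnorm g"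
proof -
  have "entry_sum g = (\<Sum>j\<in>UNIV. \<Sum>i\<in>UNIV. g $ i $ j)"
    unfolding entry_sum_def by (rule sum.swap)
  also have "\<dots> \<le> (\<Sum>j\<in>(UNIV::'d set). l1_opnorm g)"
  proof (intro sum_mono)
    fix j
    have "(\<Sum>i\<in>UNIV. g $ i $ j) \<le> column_sum g j"
      unfolding column_sum_def by (intro sum_mono) auto
    then show "(\<Sum>i\<in>UNIV. g $ i $ j) \<le> l1_opnorm g"
      using column_sum_le_l1_opnorm by (rule order_trans)
  qed
  finally show ?thesis by simp
qed

definition nonneg_entries :: "real^'d^'d::finite \<Rightarrow> bool" where
  "nonneg_entries g \<longleftrightarrow> (\<forall>i j. 0 \<le> g $ i $ j)"

lemma nonneg_entries_iff_min_entry: "nonneg_entries g \<longleftrightarrow> 0 \<le> min_entry g"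
  by (simp add: nonneg_entries_def le_min_entry_iff)

lemma nonneg_entries_mult: "nonneg_entries g \<Longrightarrow> nonneg_entries h \<Longrightarrow> nonneg_entries (g ** h)"
  by (auto simp: nonneg_entries_def matrix_matrix_mult_def intro!: sum_nonneg)

lemma nonneg_entries_mat_1: "nonneg_entries (mat 1)"
  by (auto simp: nonneg_entries_def mat_def)

lemma min_entry_le_entry_sum: "nonneg_entries g \<Longrightarrow> min_entry g \<le> entry_sum g"
proof -
  assume g: "nonneg_entries g"
  obtain i :: 'a where True by blast
  have "min_entry g \<le> g $ i $ i" by (rule min_entry_le)
  also have "\<dots> \<le> (\<Sum>j\<in>UNIV. g $ i $ j)" using g by (intro member_le_sum) (auto simp: nonneg_entries_def)
  also have "\<dots> \<le> entry_sum g" unfolding entry_sum_def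
    using g by (intro member_le_sum[of i UNIV "\<lambda>i. \<Sum>j\<in>UNIV. g $ i $ j"]) (auto simp: nonneg_entries_def intro: sum_nonneg)
  finally show ?thesis .
qed

lemma l1_opnorm_le_entry_sum: "nonneg_entries g \<Longrightarrow> l1_opnorm g \<le> entry_sum g"
  unfolding l1_opnorm_le_iff
proof
  fix j assume g: "nonneg_entries g"
  have "column_sum g j = (\<Sum>i\<in>UNIV. g $ i $ j)"
    using g by (simp add: column_sum_def nonneg_entries_def)
  also have "\<dots> \<le> (\<Sum>j\<in>UNIV. \<Sum>i\<in>UNIV. g $ i $ j)"
    using g by (intro member_le_sum[of j UNIV "\<lambda>j. \<Sum>i\<in>UNIV. g $ i $ j"]) (auto simp: nonneg_entries_def intro: sum_nonneg)
  also have "\<dots> = entry_sum g" unfolding entry_sum_def by (rule sum.swap)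
  finally show "column_sum g j \<le> entry_sum g" .
qed

lemma sum_row_mult_ge:
  assumes g: "nonneg_entries g" and h: "nonneg_entries h"
  shows "min_entry g * (\<Sum>k\<in>UNIV. h $ k $ j) \<le> (g ** h) $ i $ j"
  unfolding matrix_matrix_mult_def sum_distrib_left
  using g h by (auto simp: nonneg_entries_def intro!: sum_mono mult_right_mono min_entry_le)

lemma entry_mult_ge:
  assumes g: "nonneg_entries g" and h: "nonneg_entries h"
  shows "(\<Sum>k\<in>UNIV. g $ i $ k) * min_entry h \<le> (g ** h) $ i $ j"
  unfolding matrix_matrix_mult_def sum_distrib_right
  using g h by (auto simp: nonneg_entries_def intro!: sum_mono mult_left_mono min_entry_le)

lemma min_entry_mult:
  assumes g: "nonneg_entries g" and h: "nonneg_entries h"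
  shows "min_entry g * min_entry h \<le> min_entry (g ** h)"
  unfolding le_min_entry_iff
proof (intro allI)
  fix i j
  have "min_entry g \<le> (\<Sum>k\<in>UNIV. g $ i $ k)"
    using g min_entry_le[of g i undefined] member_le_sum[of undefined UNIV "\<lambda>k. g $ i $ k"]
    by (force simp: nonneg_entries_def)
  then have "min_entry g * min_entry h \<le> (\<Sum>k\<in>UNIV. g $ i $ k) * min_entry h"
    using h by (intro mult_right_mono) (auto simp: nonneg_entries_iff_min_entry)
  also have "\<dots> \<le> (g ** h) $ i $ j" by (rule entry_mult_ge[OF g h])
  finally show "min_entry g * min_entry h \<le> (g ** h) $ i $ j" .
qed

lemma entry_sum_mult_min_entry:
  assumes g: "nonneg_entries g" and h: "nonneg_entries h"
  shows "entry_sum g * min_entry h \<le> l1_opnorm (g ** h)"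
proof -
  obtain j :: 'a where True by blast
  have "entry_sum g * min_entry h \<le> (\<Sum>i\<in>UNIV. (g ** h) $ i $ j)"
    unfolding entry_sum_def sum_distrib_right[of "\<lambda>i. \<Sum>j\<in>UNIV. g $ i $ j"]
    by (intro sum_mono entry_mult_ge g h)
  also have "\<dots> \<le> column_sum (g ** h) j"
    unfolding column_sum_def by (intro sum_mono) auto
  also have "\<dots> \<le> l1_opnorm (g ** h)" by (rule column_sum_le_l1_opnorm)
  finally show ?thesis .
qed

text \<open>A factor with positive entries on either side spreads the largest column of \<open>h\<close> over all entries,
  so that the least entry is controlled from below by the norm of \<open>h\<close>.\<close>

lemma min_entry_mult3:
  assumes g: "nonneg_entries g" and h: "nonneg_entries h" and k: "nonneg_entries k"
  shows "min_entry g * l1_opnorm h * min_entry k \<le> min_entry (g ** h ** k)"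
  unfolding le_min_entry_iff
proof (intro allI)
  fix i j
  have "min_entry g * l1_opnorm h \<le> min_entry g * entry_sum h"
    using g h by (intro mult_left_mono l1_opnorm_le_entry_sum) (auto simp: nonneg_entries_iff_min_entry)
  also have "\<dots> = (\<Sum>j\<in>UNIV. min_entry g * (\<Sum>k\<in>UNIV. h $ k $ j))"
    unfolding entry_sum_def by (subst sum.swap) (simp add: sum_distrib_left)
  also have "\<dots> \<le> (\<Sum>j\<in>UNIV. (g ** h) $ i $ j)"
    by (intro sum_mono sum_row_mult_ge g h)
  finally have "min_entry g * l1_opnorm h * min_entry k \<le> (\<Sum>j\<in>UNIV. (g ** h) $ i $ j) * min_entry k"
    using k by (intro mult_right_mono) (auto simp: nonneg_entries_iff_min_entry)
  also have "\<dots> \<le> (g ** h ** k) $ i $ j"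
    by (intro entry_mult_ge nonneg_entries_mult g h k)
  finally show "min_entry g * l1_opnorm h * min_entry k \<le> (g ** h ** k) $ i $ j" .
qed

lemma matrix_mult_measurable [measurable]:
  "(\<lambda>(g :: real^'d^'d, h :: real^'d^'d::finite). g ** h) \<in> borel \<Otimes>\<^sub>M borel \<rightarrow>\<^sub>M borel"
proof -
  have "continuous_on UNIV (\<lambda>p::(real^'d^'d) \<times> (real^'d^'d). fst p ** snd p)"
    unfolding matrix_matrix_mult_def by (intro continuous_intros)
  then have "(\<lambda>p::(real^'d^'d) \<times> (real^'d^'d). fst p ** snd p) \<in> borel_measurable borel"
    by (rule borel_measurable_continuous_onI)
  then show ?thesis by (simp add: borel_prod case_prod_beta')
qed

section \<open>Moments of random matrix products\<close>

lemma mult_measurable_pair: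
  fixes f :: "real^'d^'d::finite \<Rightarrow> 'b::topological_space"
  assumes "f \<in> borel_measurable borel"
  shows "(\<lambda>(g :: real^'d^'d, h :: real^'d^'d). f (g ** h)) \<in> borel_measurable (borel \<Otimes>\<^sub>M borel)"
  using measurable_compose[OF matrix_mult_measurable assms]
  by (simp add: case_prod_beta')

lemma mult_measurable_right:
  fixes f :: "real^'d^'d::finite \<Rightarrow> 'b::topological_space" and g :: "real^'d^'d"
  assumes "f \<in> borel_measurable borel"
  shows "(\<lambda>h. f (g ** h)) \<in> borel_measurable borel"
  using measurable_compose[OF measurable_Pair1' mult_measurable_pair[OF assms], of g] by simp

text \<open>Almost sure positivity makes all entries of a product comparable to its norm.\<close>

locale positive_matrix_law =
  fixes \<mu> :: "(real^'d^'d::finite) measure"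
  assumes law_prob_space: "prob_space \<mu>"
    and law_sets: "sets \<mu> = sets borel"
    and law_pos: "AE g in \<mu>. 0 < min_entry g"
    and law_integrable: "integrability_condition \<mu>"
begin

lemma convolution_sets: "sets (convolution_power \<mu> n) = sets borel"
  by (cases n) auto

lemma mult_measurable_convolution:
  "(\<lambda>(g, h). g ** h) \<in> measurable (convolution_power \<mu> n \<Otimes>\<^sub>M \<mu>) borel"
  using matrix_mult_measurable
  by (simp cong: measurable_cong_sets sets_pair_measure_cong add: convolution_sets law_sets)

lemma convolution_prob_space: "prob_space (convolution_power \<mu> n)"
proof (induction n)
  case 0
  then show ?case by (simp add: prob_space_return)
next
  case (Suc n)
  interpret A: prob_space "convolution_power \<mu> n" by fact
  interpret B: prob_space \<mu> by (rule law_prob_space)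
  interpret P: pair_prob_space "convolution_power \<mu> n" \<mu> ..
  show ?case
    unfolding convolution_power.simps
    by (rule P.prob_space_distr) (rule mult_measurable_convolution)
qed

lemma convolution_measurable: "f \<in> borel_measurable borel \<Longrightarrow> f \<in> borel_measurable (convolution_power \<mu> n)"
  by (simp cong: measurable_cong_sets add: convolution_sets)

lemma nn_integral_convolution_Suc:
  fixes f :: "real^'d^'d \<Rightarrow> ennreal"
  assumes f [measurable]: "f \<in> borel_measurable borel"
  shows "(\<integral>\<^sup>+ g. f g \<partial>convolution_power \<mu> (Suc n)) =
    (\<integral>\<^sup>+ g. \<integral>\<^sup>+ h. f (g ** h) \<partial>\<mu> \<partial>convolution_power \<mu> n)"
proof -
  interpret A: prob_space "convolution_power \<mu> n" by (rule convolution_prob_space)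
  interpret B: prob_space \<mu> by (rule law_prob_space)
  have "(\<integral>\<^sup>+ g. f g \<partial>convolution_power \<mu> (Suc n)) =
      (\<integral>\<^sup>+ p. f (case p of (g, h) \<Rightarrow> g ** h) \<partial>(convolution_power \<mu> n \<Otimes>\<^sub>M \<mu>))"
    unfolding convolution_power.simps
    by (rule nn_integral_distr[OF mult_measurable_convolution]) simp
  also have "\<dots> = (\<integral>\<^sup>+ g. \<integral>\<^sup>+ h. f (case (g, h) of (g, h) \<Rightarrow> g ** h) \<partial>\<mu> \<partial>convolution_power \<mu> n)"
    by (rule B.nn_integral_fst[symmetric]) (rule measurable_compose[OF mult_measurable_convolution f])
  finally show ?thesis by simp
qed

text \<open>Associativity of the convolution, in the form of iterated integrals.\<close>

lemma nn_integral_convolution_add: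
  fixes f :: "real^'d^'d \<Rightarrow> ennreal"
  assumes "f \<in> borel_measurable borel"
  shows "(\<integral>\<^sup>+ g. f g \<partial>convolution_power \<mu> (m + n)) =
    (\<integral>\<^sup>+ g. \<integral>\<^sup>+ h. f (g ** h) \<partial>convolution_power \<mu> n \<partial>convolution_power \<mu> m)"
  using assms
proof (induction n arbitrary: f)
  case 0
  have "(\<lambda>h. f (g ** h)) \<in> borel_measurable borel" for g :: "real^'d^'d"
    using 0 by (rule mult_measurable_right)
  then show ?case by (simp add: nn_integral_return)
next
  case (Suc n)
  note f [measurable] = Suc.prems
  have fg: "(\<lambda>h. f (g ** h)) \<in> borel_measurable borel" for g :: "real^'d^'d"
    using f by (rule mult_measurable_right)
  interpret B: prob_space \<mu> by (rule law_prob_space)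
  have "(\<lambda>(g :: real^'d^'d, h :: real^'d^'d). f (g ** h)) \<in> borel_measurable (borel \<Otimes>\<^sub>M borel)"
    using f by (rule mult_measurable_pair)
  then have "(\<lambda>(g :: real^'d^'d, h :: real^'d^'d). f (g ** h)) \<in> borel_measurable (borel \<Otimes>\<^sub>M \<mu>)"
    by (simp cong: measurable_cong_sets sets_pair_measure_cong add: law_sets)
  from B.borel_measurable_nn_integral_fst[OF this]
  have F: "(\<lambda>g :: real^'d^'d. \<integral>\<^sup>+ h. f (g ** h) \<partial>\<mu>) \<in> borel_measurable borel" by simp
  have "(\<integral>\<^sup>+ g. f g \<partial>convolution_power \<mu> (m + Suc n)) =
      (\<integral>\<^sup>+ g. \<integral>\<^sup>+ h. f (g ** h) \<partial>\<mu> \<partial>convolution_power \<mu> (m + n))"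
    using nn_integral_convolution_Suc[OF f, of "m + n"] by simp
  also have "\<dots> = (\<integral>\<^sup>+ g. \<integral>\<^sup>+ g'. \<integral>\<^sup>+ h. f (g ** g' ** h) \<partial>\<mu> \<partial>convolution_power \<mu> n \<partial>convolution_power \<mu> m)"
    by (rule Suc.IH[OF F])
  also have "\<dots> = (\<integral>\<^sup>+ g. \<integral>\<^sup>+ h. f (g ** h) \<partial>convolution_power \<mu> (Suc n) \<partial>convolution_power \<mu> m)"
    using nn_integral_convolution_Suc[OF fg] by (simp add: matrix_mul_assoc)
  finally show ?case .
qed

lemma convolution_power_1: "convolution_power \<mu> 1 = \<mu>"
proof (rule measure_eqI)
  show "sets (convolution_power \<mu> 1) = sets \<mu>" by (simp add: law_sets)
  fix A assume "A \<in> sets (convolution_power \<mu> 1)"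
  then have A: "A \<in> sets borel" by simp
  interpret B: prob_space \<mu> by (rule law_prob_space)
  have m: "(\<lambda>g::real^'d^'d. \<integral>\<^sup>+ h. indicator A (g ** h) \<partial>\<mu>) \<in> borel_measurable borel"
  proof -
    have "(\<lambda>(g :: real^'d^'d, h :: real^'d^'d). indicator A (g ** h) :: ennreal) \<in> borel_measurable (borel \<Otimes>\<^sub>M borel)"
      using borel_measurable_indicator[OF A] by (rule mult_measurable_pair)
    then have "(\<lambda>(g :: real^'d^'d, h :: real^'d^'d). indicator A (g ** h) :: ennreal) \<in> borel_measurable (borel \<Otimes>\<^sub>M \<mu>)"
      by (simp cong: measurable_cong_sets sets_pair_measure_cong add: law_sets)
    from B.borel_measurable_nn_integral_fst[OF this] show ?thesis by simp
  qed
  have "emeasure (convolution_power \<mu> 1) A = (\<integral>\<^sup>+ g. indicator A g \<partial>convolution_power \<mu> (Suc 0))"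
    using A by (simp add: nn_integral_indicator convolution_sets del: convolution_power.simps(2))
  also have "\<dots> = (\<integral>\<^sup>+ g. \<integral>\<^sup>+ h. indicator A (g ** h) \<partial>\<mu> \<partial>return borel (mat 1))"
    using A by (subst nn_integral_convolution_Suc) auto
  also have "\<dots> = (\<integral>\<^sup>+ h. indicator A h \<partial>\<mu>)"
    using m by (subst nn_integral_return) auto
  also have "\<dots> = emeasure \<mu> A" using A by (simp add: nn_integral_indicator law_sets)
  finally show "emeasure (convolution_power \<mu> 1) A = emeasure \<mu> A" .
qed

lemma AE_convolution_Suc:
  assumes P: "{g. P g} \<in> sets borel"
    and AE: "AE g in convolution_power \<mu> n. AE h in \<mu>. P (g ** h)"
  shows "AE g in convolution_power \<mu> (Suc n). P g"
proof -
  have N: "{g. \<not> P g} \<in> sets borel"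
    using borel_comp[OF P] by (simp add: Compl_eq)
  have "emeasure (convolution_power \<mu> (Suc n)) {g. \<not> P g} =
      (\<integral>\<^sup>+ g. indicator {g. \<not> P g} g \<partial>convolution_power \<mu> (Suc n))"
    using N by (subst nn_integral_indicator) (simp_all add: convolution_sets del: convolution_power.simps(2))
  also have "\<dots> = (\<integral>\<^sup>+ g. \<integral>\<^sup>+ h. indicator {g. \<not> P g} (g ** h) \<partial>\<mu> \<partial>convolution_power \<mu> n)"
    using N by (intro nn_integral_convolution_Suc) simp
  also have "\<dots> = (\<integral>\<^sup>+ g. 0 \<partial>convolution_power \<mu> n)"
  proof (rule nn_integral_cong_AE)
    show "AE g in convolution_power \<mu> n. (\<integral>\<^sup>+ h. indicator {g. \<not> P g} (g ** h) \<partial>\<mu>) = 0"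
      using AE
    proof eventually_elim
      case (elim g)
      then have "(\<integral>\<^sup>+ h. indicator {g. \<not> P g} (g ** h) \<partial>\<mu>) = (\<integral>\<^sup>+ h. 0 \<partial>\<mu>)"
        by (intro nn_integral_cong_AE) (auto elim!: eventually_mono)
      then show ?case by simp
    qed
  qed
  finally have "emeasure (convolution_power \<mu> (Suc n)) {g. \<not> P g} = 0" by simp
  then show ?thesis
    using N by (intro AE_I[of _ _ "{g. \<not> P g}"]) (auto simp: convolution_sets simp del: convolution_power.simps(2))
qed

lemma convolution_pos: "0 < n \<Longrightarrow> AE g in convolution_power \<mu> n. 0 < min_entry g"
  and convolution_nonneg: "AE g in convolution_power \<mu> n. nonneg_entries g"
proof -
  have m: "{g :: real^'d^'d. 0 < min_entry g} \<in> sets borel" by measurable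
  have *: "AE g in convolution_power \<mu> n. if n = 0 then g = mat 1 else 0 < min_entry g" for n
  proof (induction n)
    case 0
    have "{g :: real^'d^'d. g = mat 1} \<in> sets borel" by simp
    then have "AE g in return borel (mat 1 :: real^'d^'d). g = mat 1"
      by (subst AE_return) (auto simp: pred_def)
    then show ?case unfolding convolution_power.simps if_P[OF refl] .
  next
    case (Suc n)
    have "AE g in convolution_power \<mu> n. AE h in \<mu>. 0 < min_entry (g ** h)"
      using Suc.IH
    proof eventually_elim
      case (elim g)
      show ?case using law_pos
      proof eventually_elim
        case (elim h)
        show ?case
        proof (cases "n = 0")
          case False
          with \<open>if n = 0 then g = mat 1 else 0 < min_entry g\<close> have "0 < min_entry g" by simp
          with elim have "0 < min_entry g * min_entry h" by simp
          also have "\<dots> \<le> min_entry (g ** h)"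
            using \<open>0 < min_entry g\<close> elim
            by (intro min_entry_mult) (auto simp: nonneg_entries_iff_min_entry)
          finally show ?thesis .
        qed (use \<open>if n = 0 then g = mat 1 else 0 < min_entry g\<close> elim in simp)
      qed
    qed
    from AE_convolution_Suc[OF m this] show ?case by simp
  qed
  show "0 < n \<Longrightarrow> AE g in convolution_power \<mu> n. 0 < min_entry g" using *[of n] by auto
  show "AE g in convolution_power \<mu> n. nonneg_entries g"
    using *[of n]
    by eventually_elim (use nonneg_entries_mat_1 in \<open>auto simp: nonneg_entries_iff_min_entry split: if_splits\<close>)
qed

definition moment :: "nat \<Rightarrow> real \<Rightarrow> ennreal" where
  "moment n s = (\<integral>\<^sup>+ g. ennreal (l1_opnorm g powr s) \<partial>convolution_power \<mu> n)"

lemma moment_0: "moment 0 s = 1"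
proof -
  have "(\<lambda>g::real^'d^'d. ennreal (l1_opnorm g powr s)) \<in> borel_measurable borel" by measurable
  then show ?thesis by (simp add: moment_def nn_integral_return l1_opnorm_mat_1)
qed

lemma moment_1_finite: "0 \<le> s \<Longrightarrow> moment 1 s < \<infinity>"
  using law_integrable unfolding moment_def integrability_condition_def convolution_power_1 by blast

lemma moment_add_le:
  assumes "0 \<le> s"
  shows "moment (m + n) s \<le> moment m s * moment n s"
proof -
  have "moment (m + n) s = (\<integral>\<^sup>+ g. \<integral>\<^sup>+ h. ennreal (l1_opnorm (g ** h) powr s)
      \<partial>convolution_power \<mu> n \<partial>convolution_power \<mu> m)"
    unfolding moment_def by (rule nn_integral_convolution_add) measurable
  also have "\<dots> \<le> (\<integral>\<^sup>+ g. \<integral>\<^sup>+ h. ennreal (l1_opnorm g powr s) * ennreal (l1_opnorm h powr s)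
      \<partial>convolution_power \<mu> n \<partial>convolution_power \<mu> m)"
  proof (intro nn_integral_mono)
    fix g h :: "real^'d^'d"
    have "l1_opnorm (g ** h) powr s \<le> (l1_opnorm g * l1_opnorm h) powr s"
      using assms by (intro powr_mono2 l1_opnorm_mult_le l1_opnorm_nonneg)
    also have "\<dots> = l1_opnorm g powr s * l1_opnorm h powr s"
      by (rule powr_mult)
    finally show "ennreal (l1_opnorm (g ** h) powr s) \<le> ennreal (l1_opnorm g powr s) * ennreal (l1_opnorm h powr s)"
      by (simp add: ennreal_mult[symmetric] ennreal_leI)
  qed
  also have "\<dots> = moment m s * moment n s"
    unfolding moment_def
    by (simp add: nn_integral_cmult nn_integral_multc convolution_measurable)
  finally show ?thesis .
qed

lemma moment_finite: "0 \<le> s \<Longrightarrow> moment n s < \<infinity>"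
proof (induction n)
  case (Suc n)
  have "moment (n + 1) s \<le> moment n s * moment 1 s" using Suc.prems by (rule moment_add_le)
  also have "\<dots> < \<infinity>" using Suc moment_1_finite[of s] by (simp add: ennreal_mult_less_top)
  finally show ?case by simp
qed (simp add: moment_0)

text \<open>The truncation at 1 makes this a lower bound for all moments of the least entry of order at
  most 1.\<close>

definition c0 :: real where
  "c0 = enn2real (\<integral>\<^sup>+ g. ennreal (min 1 (min_entry g)) \<partial>\<mu>)"

lemma ennreal_c0: "ennreal c0 = (\<integral>\<^sup>+ g. ennreal (min 1 (min_entry g)) \<partial>\<mu>)"
proof -
  interpret prob_space \<mu> by (rule law_prob_space)
  have "(\<integral>\<^sup>+ g. ennreal (min 1 (min_entry g)) \<partial>\<mu>) \<le> (\<integral>\<^sup>+ g. 1 \<partial>\<mu>)"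
    by (intro nn_integral_mono) (simp add: min_def)
  then have "(\<integral>\<^sup>+ g. ennreal (min 1 (min_entry g)) \<partial>\<mu>) \<le> 1"
    by (simp add: emeasure_space_1)
  then have "(\<integral>\<^sup>+ g. ennreal (min 1 (min_entry g)) \<partial>\<mu>) < top"
    by (rule le_less_trans) simp
  then show ?thesis by (simp add: c0_def)
qed

lemma law_measurable: "f \<in> borel_measurable borel \<Longrightarrow> f \<in> borel_measurable \<mu>"
  by (simp cong: measurable_cong_sets add: law_sets)

lemma c0_pos: "0 < c0"
proof -
  interpret prob_space \<mu> by (rule law_prob_space)
  have "(\<integral>\<^sup>+ g. ennreal (min 1 (min_entry g)) \<partial>\<mu>) \<noteq> 0"
  proof
    assume "(\<integral>\<^sup>+ g. ennreal (min 1 (min_entry g)) \<partial>\<mu>) = 0"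
    then have "AE g in \<mu>. ennreal (min 1 (min_entry g)) = 0"
      by (subst (asm) nn_integral_0_iff_AE) (auto intro!: law_measurable)
    with law_pos have "AE g in \<mu>. False"
      by eventually_elim (auto simp: min_def split: if_splits)
    then show False by simp
  qed
  then show ?thesis unfolding ennreal_c0[symmetric] by (simp add: less_le c0_def)
qed

lemma powr_ge_min_1:
  fixes x :: real
  assumes "0 < x" "0 \<le> s" "s \<le> 1"
  shows "min 1 x \<le> x powr s"
proof (cases "x \<le> 1")
  case True
  then have "x powr 1 \<le> x powr s" using assms by (intro powr_mono') auto
  then show ?thesis using assms True by simp
next
  case False
  then have "1 \<le> x powr s" using assms by (intro ge_one_powr_ge_zero) auto
  then show ?thesis by simp
qed

text \<open>A further positive factor costs at most the fraction \<open>c0\<close>; this excludes that a moment rate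
  vanishes.\<close>

lemma moment_Suc_ge:
  assumes s: "0 \<le> s" "s \<le> 1"
  shows "moment n s * ennreal c0 \<le> moment (Suc n) s"
proof -
  have "moment n s * ennreal c0 = (\<integral>\<^sup>+ g. \<integral>\<^sup>+ h. ennreal (l1_opnorm g powr s) * ennreal (min 1 (min_entry h))
      \<partial>\<mu> \<partial>convolution_power \<mu> n)"
    unfolding moment_def ennreal_c0
    by (simp add: nn_integral_cmult nn_integral_multc convolution_measurable law_measurable)
  also have "\<dots> \<le> (\<integral>\<^sup>+ g. \<integral>\<^sup>+ h. ennreal (l1_opnorm (g ** h) powr s) \<partial>\<mu> \<partial>convolution_power \<mu> n)"
  proof (rule nn_integral_mono_AE)
    show "AE g in convolution_power \<mu> n.
        (\<integral>\<^sup>+ h. ennreal (l1_opnorm g powr s) * ennreal (min 1 (min_entry h)) \<partial>\<mu>)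
        \<le> (\<integral>\<^sup>+ h. ennreal (l1_opnorm (g ** h) powr s) \<partial>\<mu>)"
      using convolution_nonneg[of n]
    proof eventually_elim
      case (elim g)
      show ?case
      proof (rule nn_integral_mono_AE)
        show "AE h in \<mu>. ennreal (l1_opnorm g powr s) * ennreal (min 1 (min_entry h)) \<le>
            ennreal (l1_opnorm (g ** h) powr s)"
          using law_pos
        proof eventually_elim
          case h: (elim h)
          have "l1_opnorm g * min_entry h \<le> entry_sum g * min_entry h"
            using h by (intro mult_right_mono l1_opnorm_le_entry_sum elim) auto
          also have "\<dots> \<le> l1_opnorm (g ** h)"
            using elim h by (intro entry_sum_mult_min_entry) (auto simp: nonneg_entries_iff_min_entry)
          finally have "(l1_opnorm g * min_entry h) powr s \<le> l1_opnorm (g ** h) powr s"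
            using s h by (intro powr_mono2) (auto simp: l1_opnorm_nonneg)
          moreover have "l1_opnorm g powr s * min 1 (min_entry h) \<le> l1_opnorm g powr s * min_entry h powr s"
            using powr_ge_min_1[OF h s] by (intro mult_left_mono) auto
          moreover have "(l1_opnorm g * min_entry h) powr s = l1_opnorm g powr s * min_entry h powr s"
            by (rule powr_mult)
          ultimately show ?case
            using h by (simp add: ennreal_mult[symmetric] ennreal_leI)
        qed
      qed
    qed
  qed
  also have "\<dots> = moment (Suc n) s"
    unfolding moment_def by (rule nn_integral_convolution_Suc[symmetric]) measurable
  finally show ?thesis .
qed

lemma c0_power_le_moment: "0 \<le> s \<Longrightarrow> s \<le> 1 \<Longrightarrow> ennreal (c0 ^ n) \<le> moment n s"
proof (induction n)
  case (Suc n)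
  have "ennreal (c0 ^ Suc n) = ennreal (c0 ^ n) * ennreal c0"
    using c0_pos by (simp add: ennreal_mult[symmetric] mult.commute)
  also have "\<dots> \<le> moment n s * ennreal c0" using Suc by (intro mult_right_mono) auto
  also have "\<dots> \<le> moment (Suc n) s" using Suc.prems by (rule moment_Suc_ge)
  finally show ?case .
qed (simp add: moment_0)

lemma integral_eq_moment: "(\<integral> g. l1_opnorm g powr s \<partial>convolution_power \<mu> n) = enn2real (moment n s)"
  unfolding moment_def
  by (rule integral_eq_nn_integral) (auto intro!: convolution_measurable)

text \<open>The limit that defines the moment rate exists, and being an infimum it bounds each single moment
  from below.\<close>

lemma moment_rate_properties:
  assumes s: "0 \<le> s" "s \<le> 1"
  shows "(\<lambda>n. root n (enn2real (moment n s))) \<longlonglongrightarrow> moment_rate \<mu> s"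
    and "c0 \<le> moment_rate \<mu> s"
    and "ennreal (moment_rate \<mu> s ^ n) \<le> moment n s"
proof -
  let ?a = "\<lambda>n. enn2real (moment n s)"
  have low: "c0 ^ n \<le> ?a n" for n
    using c0_power_le_moment[OF s, of n] moment_finite[OF s(1), of n]
    by (metis c0_pos enn2real_ennreal enn2real_mono infinity_ennreal_def less_imp_le zero_le_power)
  have sub: "?a (m + n) \<le> ?a m * ?a n" for m n
    using moment_add_le[OF s(1), of m n] moment_finite[OF s(1), of m] moment_finite[OF s(1), of n]
    by (metis enn2real_mono enn2real_mult ennreal_mult_less_top infinity_ennreal_def)
  obtain L where L: "(\<lambda>n. root n (?a n)) \<longlonglongrightarrow> L" "0 \<le> L" "\<And>n. 0 < n \<Longrightarrow> L ^ n \<le> ?a n"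
    using submultiplicative_root_converges[OF c0_pos low sub] by blast
  have eq: "moment_rate \<mu> s = L"
    unfolding moment_rate_def integral_eq_moment using L(1) by (rule limI)
  show "(\<lambda>n. root n (?a n)) \<longlonglongrightarrow> moment_rate \<mu> s" using L(1) eq by simp
  show "c0 \<le> moment_rate \<mu> s"
    unfolding eq
  proof (rule LIMSEQ_le_const[OF L(1)])
    show "\<exists>N. \<forall>n\<ge>N. c0 \<le> root n (?a n)"
    proof (intro exI[of _ 1] allI impI)
      fix n :: nat assume n: "1 \<le> n"
      have "root n (c0 ^ n) \<le> root n (?a n)" using n low by (intro real_root_le_mono) auto
      then show "c0 \<le> root n (?a n)" using n c0_pos by (simp add: real_root_power_cancel)
    qed
  qed
  show "ennreal (moment_rate \<mu> s ^ n) \<le> moment n s"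
  proof (cases "n = 0")
    case False
    then have "ennreal (L ^ n) \<le> ennreal (?a n)" using L(3) by (intro ennreal_leI) auto
    also have "\<dots> = moment n s"
      using moment_finite[OF s(1), of n] by (intro ennreal_enn2real) simp
    finally show ?thesis using eq by simp
  qed (simp add: moment_0)
qed

lemma min_moment_rate_le: "s \<in> {0..1} \<Longrightarrow> min_moment_rate \<mu> \<le> moment_rate \<mu> s"
  unfolding min_moment_rate_def
  by (intro cINF_lower bdd_belowI2[of _ c0]) (auto simp: moment_rate_properties)

lemma min_moment_rate_pos: "0 < min_moment_rate \<mu>"
proof -
  have "c0 \<le> min_moment_rate \<mu>"
    unfolding min_moment_rate_def by (intro cINF_greatest) (auto simp: moment_rate_properties)
  with c0_pos show ?thesis by simp
qed

lemma moment_rate_0: "moment_rate \<mu> 0 \<le> 1"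
proof -
  have m0: "moment n 0 \<le> 1" for n
  proof -
    interpret prob_space "convolution_power \<mu> n" by (rule convolution_prob_space)
    have "moment n 0 \<le> (\<integral>\<^sup>+ g. 1 \<partial>convolution_power \<mu> n)"
      unfolding moment_def by (intro nn_integral_mono) simp
    then show ?thesis by (simp add: emeasure_space_1)
  qed
  have "ennreal (moment_rate \<mu> 0 ^ 1) \<le> 1"
    by (rule order_trans[OF moment_rate_properties(3) m0]) auto
  then show ?thesis by simp
qed

text \<open>Sandwiching a product of \<open>n\<close> factors between two positive factors makes all of its entries
  comparable to its norm.\<close>

lemma min_entry_moment_ge:
  assumes s: "0 \<le> s" "s \<le> 1"
  shows "ennreal (c0\<^sup>2 * min_moment_rate \<mu> ^ n) \<le>
    (\<integral>\<^sup>+ g. ennreal (min_entry g powr s) \<partial>convolution_power \<mu> (n + 2))"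
proof -
  let ?E = "\<integral>\<^sup>+ g. ennreal (min 1 (min_entry g)) \<partial>\<mu>"
  have "ennreal (c0\<^sup>2 * min_moment_rate \<mu> ^ n) \<le> ennreal c0 * (ennreal (moment_rate \<mu> s ^ n) * ennreal c0)"
  proof -
    have "min_moment_rate \<mu> ^ n \<le> moment_rate \<mu> s ^ n"
      using min_moment_rate_pos s by (intro power_mono min_moment_rate_le) auto
    then have "c0\<^sup>2 * min_moment_rate \<mu> ^ n \<le> c0 * (moment_rate \<mu> s ^ n * c0)"
      using c0_pos by (simp add: power2_eq_square mult_ac)
    moreover have "0 \<le> moment_rate \<mu> s"
      using moment_rate_properties(2)[OF s] c0_pos by simp
    ultimately show ?thesis using c0_pos by (simp add: ennreal_mult[symmetric] ennreal_leI)
  qed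
  also have "\<dots> \<le> ?E * (moment n s * ?E)"
    unfolding ennreal_c0 by (intro mult_left_mono mult_right_mono moment_rate_properties s) auto
  also have "\<dots> = (\<integral>\<^sup>+ g. \<integral>\<^sup>+ h. \<integral>\<^sup>+ k. ennreal (min 1 (min_entry g)) * (ennreal (l1_opnorm h powr s) *
      ennreal (min 1 (min_entry k))) \<partial>\<mu> \<partial>convolution_power \<mu> n \<partial>\<mu>)"
    unfolding moment_def
    by (simp add: nn_integral_cmult nn_integral_multc convolution_measurable law_measurable)
  also have "\<dots> \<le> (\<integral>\<^sup>+ g. \<integral>\<^sup>+ h. \<integral>\<^sup>+ k. ennreal (min_entry (g ** (h ** k)) powr s)
      \<partial>\<mu> \<partial>convolution_power \<mu> n \<partial>\<mu>)"
  proof (rule nn_integral_mono_AE)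
    show "AE g in \<mu>. (\<integral>\<^sup>+ h. \<integral>\<^sup>+ k. ennreal (min 1 (min_entry g)) * (ennreal (l1_opnorm h powr s) *
      ennreal (min 1 (min_entry k))) \<partial>\<mu> \<partial>convolution_power \<mu> n) \<le>
      (\<integral>\<^sup>+ h. \<integral>\<^sup>+ k. ennreal (min_entry (g ** (h ** k)) powr s) \<partial>\<mu> \<partial>convolution_power \<mu> n)"
      using law_pos
    proof eventually_elim
      case g: (elim g)
      show ?case
      proof (rule nn_integral_mono_AE)
        show "AE h in convolution_power \<mu> n. (\<integral>\<^sup>+ k. ennreal (min 1 (min_entry g)) * (ennreal (l1_opnorm h powr s) *
          ennreal (min 1 (min_entry k))) \<partial>\<mu>) \<le> (\<integral>\<^sup>+ k. ennreal (min_entry (g ** (h ** k)) powr s) \<partial>\<mu>)"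
          using convolution_nonneg[of n]
        proof eventually_elim
          case h: (elim h)
          show ?case
          proof (rule nn_integral_mono_AE)
            show "AE k in \<mu>. ennreal (min 1 (min_entry g)) * (ennreal (l1_opnorm h powr s) *
              ennreal (min 1 (min_entry k))) \<le> ennreal (min_entry (g ** (h ** k)) powr s)"
              using law_pos
            proof eventually_elim
              case k: (elim k)
              have "min_entry g * l1_opnorm h * min_entry k \<le> min_entry (g ** h ** k)"
                using g h k by (intro min_entry_mult3) (auto simp: nonneg_entries_iff_min_entry)
              then have "(min_entry g * l1_opnorm h * min_entry k) powr s \<le> min_entry (g ** (h ** k)) powr s"
                using s g k by (intro powr_mono2) (auto simp: l1_opnorm_nonneg matrix_mul_assoc)
              moreover have "(min_entry g * l1_opnorm h * min_entry k) powr s =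
                  min_entry g powr s * (l1_opnorm h powr s * min_entry k powr s)"
                using g k by (simp add: powr_mult l1_opnorm_nonneg)
              moreover have "min 1 (min_entry g) * (l1_opnorm h powr s * min 1 (min_entry k)) \<le>
                  min_entry g powr s * (l1_opnorm h powr s * min_entry k powr s)"
                using g k s by (intro mult_mono powr_ge_min_1) auto
              ultimately show ?case
                using g k by (simp add: ennreal_mult[symmetric] ennreal_leI)
            qed
          qed
        qed
      qed
    qed
  qed
  also have "\<dots> = (\<integral>\<^sup>+ g. \<integral>\<^sup>+ h. ennreal (min_entry (g ** h) powr s) \<partial>convolution_power \<mu> (Suc n) \<partial>convolution_power \<mu> 1)"
  proof -
    have "(\<integral>\<^sup>+ h. \<integral>\<^sup>+ k. ennreal (min_entry (g ** (h ** k)) powr s) \<partial>\<mu> \<partial>convolution_power \<mu> n) =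
        (\<integral>\<^sup>+ h. ennreal (min_entry (g ** h) powr s) \<partial>convolution_power \<mu> (Suc n))" for g :: "real^'d^'d"
    proof (rule nn_integral_convolution_Suc[symmetric])
      have "(\<lambda>g. ennreal (min_entry (g :: real^'d^'d) powr s)) \<in> borel_measurable borel" by measurable
      then show "(\<lambda>h. ennreal (min_entry (g ** h) powr s)) \<in> borel_measurable borel"
        by (rule mult_measurable_right)
    qed
    then show ?thesis unfolding convolution_power_1 by simp
  qed
  also have "\<dots> = (\<integral>\<^sup>+ g. ennreal (min_entry g powr s) \<partial>convolution_power \<mu> (1 + Suc n))"
    by (rule nn_integral_convolution_add[symmetric]) measurable
  finally show ?thesis by (simp add: add.commute)
qed

end

section \<open>Large deviations of products of positive numbers\<close>

lemma exp_le_quadratic: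
  fixes u :: real
  assumes "\<bar>u\<bar> \<le> 1"
  shows "exp u \<le> 1 + u + u\<^sup>2"
proof (cases "0 \<le> u")
  case True
  then show ?thesis using assms by (intro exp_bound) auto
next
  case False
  have "1 + - u \<le> exp (- u)" by (rule exp_ge_add_one_self)
  then have "exp u \<le> 1 / (1 - u)"
    using False by (simp add: exp_minus field_simps)
  also have "\<dots> \<le> 1 + u + u\<^sup>2"
  proof -
    have "u ^ 3 \<le> 0" using False by (simp add: power_le_zero_eq)
    moreover have "(1 + u + u\<^sup>2) * (1 - u) = 1 - u ^ 3"
      by (simp add: power2_eq_square power3_eq_cube algebra_simps)
    ultimately show ?thesis using False by (simp add: divide_le_eq)
  qed
  finally show ?thesis .
qed

text \<open>The value 0 is allowed so that a truncation can discard factors.\<close>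

locale bounded_factor_law = prob_space \<nu> for \<nu> :: "real measure" +
  fixes D :: real
  assumes factor_sets [measurable_cong]: "sets \<nu> = sets borel"
    and D: "0 < D"
    and factor_bound: "AE x in \<nu>. x = 0 \<or> (0 < x \<and> \<bar>ln x\<bar> \<le> D)"
begin

definition \<phi> :: "real \<Rightarrow> real" where "\<phi> s = (\<integral>x. x powr s \<partial>\<nu>)"

definition \<psi> :: "real \<Rightarrow> real" where "\<psi> s = (\<integral>x. x powr s * ln x \<partial>\<nu>)"

lemma powr_bound:
  assumes "x = 0 \<or> (0 < x \<and> \<bar>ln x\<bar> \<le> D)"
  shows "x powr s \<le> exp (\<bar>s\<bar> * D)"
proof (cases "x = 0")
  case False
  have "s * ln x \<le> \<bar>s\<bar> * \<bar>ln x\<bar>"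
    unfolding abs_mult[symmetric] by (rule abs_ge_self)
  also have "\<dots> \<le> \<bar>s\<bar> * D"
    using False assms by (intro mult_left_mono) auto
  finally have "s * ln x \<le> \<bar>s\<bar> * D" .
  then show ?thesis using False assms by (simp add: powr_def)
qed auto

lemma integrable_powr: "integrable \<nu> (\<lambda>x. x powr s)"
proof (rule integrable_const_bound[where B = "exp (\<bar>s\<bar> * D)"])
  show "AE x in \<nu>. norm (x powr s) \<le> exp (\<bar>s\<bar> * D)"
    using factor_bound by eventually_elim (use powr_bound in simp)
qed measurable

lemma integrable_powr_ln: "integrable \<nu> (\<lambda>x. x powr s * ln x)"
proof (rule integrable_const_bound[where B = "exp (\<bar>s\<bar> * D) * D"])
  show "AE x in \<nu>. norm (x powr s * ln x) \<le> exp (\<bar>s\<bar> * D) * D"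
    using factor_bound
  proof eventually_elim
    case (elim x)
    show ?case
    proof (cases "x = 0")
      case False
      then show ?thesis using powr_bound[OF elim, of s] elim
        by (auto simp: abs_mult intro!: mult_mono)
    qed (use D in simp)
  qed
qed measurable

text \<open>Positive factors have a bounded logarithm, so the exponential in \<open>x powr (s + \<theta>)\<close> can be expanded to second
  order uniformly.\<close>

lemma \<phi>_upper:
  assumes "\<bar>\<theta>\<bar> * D \<le> 1"
  shows "\<phi> (s + \<theta>) \<le> \<phi> s + \<theta> * \<psi> s + \<theta>\<^sup>2 * D\<^sup>2 * \<phi> s"
proof -
  have "\<phi> (s + \<theta>) \<le> (\<integral>x. x powr s + \<theta> * (x powr s * ln x) + \<theta>\<^sup>2 * D\<^sup>2 * (x powr s) \<partial>\<nu>)"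
    unfolding \<phi>_def
  proof (rule integral_mono_AE)
    show "AE x in \<nu>. x powr (s + \<theta>) \<le> x powr s + \<theta> * (x powr s * ln x) + \<theta>\<^sup>2 * D\<^sup>2 * (x powr s)"
      using factor_bound
    proof eventually_elim
      case (elim x)
      show ?case
      proof (cases "x = 0")
        case False
        then have x: "0 < x" "\<bar>ln x\<bar> \<le> D" using elim by auto
        have "\<bar>\<theta> * ln x\<bar> \<le> \<bar>\<theta>\<bar> * D" using x by (simp add: abs_mult mult_left_mono)
        then have "exp (\<theta> * ln x) \<le> 1 + \<theta> * ln x + (\<theta> * ln x)\<^sup>2"
          using assms by (intro exp_le_quadratic) simp
        also have "(\<theta> * ln x)\<^sup>2 \<le> \<theta>\<^sup>2 * D\<^sup>2"
          using x D by (simp add: power_mult_distrib abs_le_square_iff[symmetric] mult_left_mono)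
        finally have "x powr s * exp (\<theta> * ln x) \<le> x powr s * (1 + \<theta> * ln x + \<theta>\<^sup>2 * D\<^sup>2)"
          by (intro mult_left_mono) auto
        moreover have "x powr (s + \<theta>) = x powr s * exp (\<theta> * ln x)"
          using x by (simp add: powr_def exp_add[symmetric] algebra_simps)
        ultimately show ?thesis by (simp add: algebra_simps)
      qed simp
    qed
  qed (intro integrable_powr integrable_powr_ln Bochner_Integration.integrable_add integrable_mult_right)+
  also have "\<dots> = \<phi> s + \<theta> * \<psi> s + \<theta>\<^sup>2 * D\<^sup>2 * \<phi> s"
    unfolding \<phi>_def \<psi>_def by (simp add: integrable_powr integrable_powr_ln)
  finally show ?thesis .
qed

lemma \<phi>_continuous: "continuous_on {0..1} \<phi>"
  unfolding continuous_on_sequentially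
proof safe
  fix u :: "nat \<Rightarrow> real" and s assume u: "\<forall>n. u n \<in> {0..1}" "u \<longlonglongrightarrow> s" and s: "s \<in> {0..1}"
  show "(\<phi> \<circ> u) \<longlonglongrightarrow> \<phi> s"
    unfolding \<phi>_def comp_def
  proof (rule integral_dominated_convergence[where w = "\<lambda>_. exp D"])
    show "AE x in \<nu>. (\<lambda>n. x powr u n) \<longlonglongrightarrow> x powr s"
      using factor_bound
    proof eventually_elim
      case (elim x)
      show ?case
      proof (cases "x = 0")
        case False
        then show ?thesis using u by (intro tendsto_powr) auto
      qed simp
    qed
    show "AE x in \<nu>. norm (x powr u n) \<le> exp D" for n
      using factor_bound
    proof eventually_elim
      case (elim x)
      have "\<bar>u n\<bar> * D \<le> 1 * D" using u(1)[rule_format, of n] D by (intro mult_right_mono) auto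
      then show ?case using powr_bound[OF elim, of "u n"] by simp (meson exp_le_cancel_iff order_trans)
    qed
  qed simp_all
qed

text \<open>At a minimum of \<open>\<phi>\<close> on \<open>[0,1]\<close> the logarithmic derivative \<open>M\<close> vanishes in the interior, is
  nonnegative at 0 and nonpositive at 1.  These three cases are summarised by \<open>min M 0 = s M\<close>.\<close>

lemma minimizer:
  assumes L: "0 < L" "\<And>s. 0 \<le> s \<Longrightarrow> s \<le> 1 \<Longrightarrow> L \<le> \<phi> s"
  obtains s M where "0 \<le> s" "s \<le> 1" "L \<le> \<phi> s" "min M 0 = s * M"
    "\<And>\<theta>. \<bar>\<theta>\<bar> * D \<le> 1 \<Longrightarrow> \<phi> (s + \<theta>) \<le> \<phi> s * exp (\<theta> * M + \<theta>\<^sup>2 * D\<^sup>2)"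
proof -
  obtain s where s: "s \<in> {0..1}" and min: "\<And>t. t \<in> {0..1} \<Longrightarrow> \<phi> s \<le> \<phi> t"
    using continuous_attains_inf[OF compact_Icc _ \<phi>_continuous] by auto
  have pos: "0 < \<phi> s" using L s by force
  have small: "0 \<le> c * \<psi> s" if c: "\<bar>c\<bar> = 1" "\<And>\<theta>. 0 < \<theta> \<Longrightarrow> \<theta> \<le> e \<Longrightarrow> s + c * \<theta> \<in> {0..1}" "0 < e" for c e
  proof (rule ccontr)
    assume "\<not> 0 \<le> c * \<psi> s"
    then have neg: "c * \<psi> s < 0" by simp
    define \<theta> where "\<theta> = min (min e (1 / D)) (- (c * \<psi> s) / (2 * D\<^sup>2 * \<phi> s))"
    have \<theta>: "0 < \<theta>" "\<theta> \<le> e" "\<theta> * D \<le> 1" "\<theta> * (2 * D\<^sup>2 * \<phi> s) \<le> - (c * \<psi> s)"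
    proof -
      show "0 < \<theta>" unfolding \<theta>_def using c(3) D pos neg by (auto intro!: divide_neg_pos mult_pos_pos)
      show "\<theta> \<le> e" by (simp add: \<theta>_def)
      have "\<theta> \<le> 1 / D" by (simp add: \<theta>_def)
      then show "\<theta> * D \<le> 1" using D by (simp add: field_simps)
      have "\<theta> \<le> - (c * \<psi> s) / (2 * D\<^sup>2 * \<phi> s)" by (simp add: \<theta>_def)
      then show "\<theta> * (2 * D\<^sup>2 * \<phi> s) \<le> - (c * \<psi> s)"
        using D pos by (subst (asm) pos_le_divide_eq) auto
    qed
    have c2: "c\<^sup>2 = 1" using c(1) by (metis power2_abs one_power2)
    have "\<phi> s \<le> \<phi> (s + c * \<theta>)" by (intro min c \<theta>)
    also have "\<dots> \<le> \<phi> s + (c * \<theta>) * \<psi> s + (c * \<theta>)\<^sup>2 * D\<^sup>2 * \<phi> s"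
      using c(1) \<theta> by (intro \<phi>_upper) (simp add: abs_mult)
    finally have "0 \<le> \<theta> * (c * \<psi> s + \<theta> * (D\<^sup>2 * \<phi> s))"
      using c2 unfolding power_mult_distrib by (simp add: algebra_simps power2_eq_square[of \<theta>])
    then have "0 \<le> c * \<psi> s + \<theta> * (D\<^sup>2 * \<phi> s)" using \<theta>(1) by (simp add: zero_le_mult_iff)
    moreover have "c * \<psi> s + \<theta> * (D\<^sup>2 * \<phi> s) < 0" using \<theta>(4) neg by (simp add: algebra_simps)
    ultimately show False by simp
  qed
  have right: "0 \<le> \<psi> s" if "s < 1"
    using small[of 1 "1 - s"] that s by auto
  have left: "\<psi> s \<le> 0" if "0 < s"
    using small[of "-1" s] that s by auto
  define M where "M = \<psi> s / \<phi> s"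
  have 1: "min M 0 = s * M"
  proof -
    consider "s = 0" | "s = 1" | "0 < s" "s < 1" using s by force
    then show ?thesis
      using left right pos by cases (auto simp: M_def min_def divide_le_0_iff zero_le_divide_iff)
  qed
  have 2: "\<phi> (s + \<theta>) \<le> \<phi> s * exp (\<theta> * M + \<theta>\<^sup>2 * D\<^sup>2)" if "\<bar>\<theta>\<bar> * D \<le> 1" for \<theta>
  proof -
    have "\<phi> (s + \<theta>) \<le> \<phi> s * (1 + (\<theta> * M + \<theta>\<^sup>2 * D\<^sup>2))"
    proof -
      have "\<phi> s * M = \<psi> s" using pos by (simp add: M_def)
      moreover have "\<phi> s * (1 + (\<theta> * M + \<theta>\<^sup>2 * D\<^sup>2)) = \<phi> s + \<theta> * (\<phi> s * M) + \<theta>\<^sup>2 * D\<^sup>2 * \<phi> s"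
        by (simp add: algebra_simps)
      ultimately show ?thesis using \<phi>_upper[OF that, of s] by simp
    qed
    also have "\<dots> \<le> \<phi> s * exp (\<theta> * M + \<theta>\<^sup>2 * D\<^sup>2)"
      using pos by (intro mult_left_mono exp_ge_add_one_self) auto
    finally show ?thesis .
  qed
  show thesis using s L(2)[of s] 1 2 by (intro that[of s M]) auto
qed

primrec product_law :: "nat \<Rightarrow> real measure" where
  "product_law 0 = return borel 1"
| "product_law (Suc n) = distr (\<nu> \<Otimes>\<^sub>M product_law n) borel (\<lambda>(x, y). x * y)"

lemma product_law_sets [measurable_cong]: "sets (product_law n) = sets borel"
  by (cases n) auto

lemma product_law_prob_space: "prob_space (product_law n)"
proof (induction n)
  case (Suc n)
  interpret A: prob_space "product_law n" by fact
  interpret P: pair_prob_space \<nu> "product_law n" ..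
  show ?case unfolding product_law.simps by (rule P.prob_space_distr) measurable
qed (simp add: prob_space_return)

lemma nn_integral_product_law_Suc:
  assumes f [measurable]: "f \<in> borel_measurable borel"
  shows "(\<integral>\<^sup>+ x. f x \<partial>product_law (Suc n)) = (\<integral>\<^sup>+ x. \<integral>\<^sup>+ y. f (x * y) \<partial>product_law n \<partial>\<nu>)"
proof -
  interpret A: prob_space "product_law n" by (rule product_law_prob_space)
  have "(\<integral>\<^sup>+ x. f x \<partial>product_law (Suc n)) =
      (\<integral>\<^sup>+ p. f (case p of (x, y) \<Rightarrow> x * y) \<partial>(\<nu> \<Otimes>\<^sub>M product_law n))"
    unfolding product_law.simps by (rule nn_integral_distr) measurable
  also have "\<dots> = (\<integral>\<^sup>+ x. \<integral>\<^sup>+ y. f (case (x, y) of (x, y) \<Rightarrow> x * y) \<partial>product_law n \<partial>\<nu>)"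
    by (rule A.nn_integral_fst[symmetric]) measurable
  finally show ?thesis by simp
qed

lemma \<phi>_nonneg: "0 \<le> \<phi> s"
  by (simp add: \<phi>_def integral_nonneg)

lemma nn_integral_product_law_powr: "(\<integral>\<^sup>+ x. ennreal (x powr s) \<partial>product_law n) = ennreal (\<phi> s ^ n)"
proof (induction n)
  case 0
  have "(\<lambda>x. ennreal (x powr s)) \<in> borel_measurable borel" by measurable
  then show ?case by (simp add: nn_integral_return)
next
  case (Suc n)
  have "(\<integral>\<^sup>+ x. ennreal (x powr s) \<partial>product_law (Suc n)) =
      (\<integral>\<^sup>+ x. \<integral>\<^sup>+ y. ennreal (x powr s) * ennreal (y powr s) \<partial>product_law n \<partial>\<nu>)"
    by (subst nn_integral_product_law_Suc) (auto simp: powr_mult ennreal_mult)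
  also have "\<dots> = (\<integral>\<^sup>+ x. ennreal (x powr s) \<partial>\<nu>) * ennreal (\<phi> s ^ n)"
    by (simp add: nn_integral_cmult nn_integral_multc Suc.IH)
  also have "(\<integral>\<^sup>+ x. ennreal (x powr s) \<partial>\<nu>) = ennreal (\<phi> s)"
    unfolding \<phi>_def by (rule nn_integral_eq_integral) (auto simp: integrable_powr)
  finally show ?case by (simp add: ennreal_mult \<phi>_nonneg)
qed

lemma product_law_nonneg: "AE x in product_law n. 0 \<le> x"
proof -
  have "(\<integral>\<^sup>+ x. indicator {..<0} x \<partial>product_law n) = 0"
  proof (induction n)
    case (Suc n)
    then have IH: "AE y in product_law n. 0 \<le> y"
      by (subst (asm) nn_integral_0_iff_AE) (auto simp: indicator_def not_less split: if_splits)
    have "(\<integral>\<^sup>+ x. indicator {..<0} x \<partial>product_law (Suc n)) =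
        (\<integral>\<^sup>+ x. \<integral>\<^sup>+ y. indicator {..<0} (x * y) \<partial>product_law n \<partial>\<nu>)"
      by (rule nn_integral_product_law_Suc) measurable
    also have "\<dots> = (\<integral>\<^sup>+ x. 0 \<partial>\<nu>)"
    proof (rule nn_integral_cong_AE)
      show "AE x in \<nu>. (\<integral>\<^sup>+ y. indicator {..<0} (x * y) \<partial>product_law n) = 0"
        using factor_bound
      proof eventually_elim
        case (elim x)
        have "(\<integral>\<^sup>+ y. indicator {..<0} (x * y) \<partial>product_law n) = (\<integral>\<^sup>+ y. 0 \<partial>product_law n)"
        proof (rule nn_integral_cong_AE)
          show "AE y in product_law n. indicator {..<0} (x * y) = 0"
            using IH by eventually_elim (use elim in \<open>auto simp: indicator_def mult_less_0_iff\<close>)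
        qed
        then show ?case by simp
      qed
    qed
    finally show ?case by simp
  qed (simp add: nn_integral_return)
  then show ?thesis
    by (subst (asm) nn_integral_0_iff_AE) (auto simp: indicator_def not_less split: if_splits)
qed

text \<open>Cramer's lower bound.  The \<open>s\<close>-th moment of a product of \<open>n\<close> factors, \<open>s\<close> being the minimizer, comes
  mainly from values near \<open>exp (n M)\<close>: by Chernoff's bound with the exponents \<open>s \<plusminus> \<theta>\<close> the values that
  deviate by a factor \<open>exp (n \<delta>)\<close> contribute exponentially less.  So values of this size have a
  probability of order \<open>\<phi> s ^ n * exp (- n s M)\<close>.  If \<open>M \<le> 0\<close>, take \<open>t\<close> slightly below \<open>exp (n M)\<close>;
  otherwise \<open>s = 0\<close>, and \<open>t\<close> slightly below 1 is enough.\<close>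

lemma large_deviation_lower_bound:
  assumes LA: "0 < L" "1 < L * A" and L: "\<And>s. 0 \<le> s \<Longrightarrow> s \<le> 1 \<Longrightarrow> L \<le> \<phi> s"
  shows "\<exists>n t. 0 < n \<and> 0 < t \<and> t \<le> 1 \<and> 1 < t * A ^ n * measure (product_law n) {x. t \<le> x}"
proof -
  obtain s M where s: "0 \<le> s" "s \<le> 1" "L \<le> \<phi> s" and M: "min M 0 = s * M"
    and up: "\<And>\<theta>. \<bar>\<theta>\<bar> * D \<le> 1 \<Longrightarrow> \<phi> (s + \<theta>) \<le> \<phi> s * exp (\<theta> * M + \<theta>\<^sup>2 * D\<^sup>2)"
    using minimizer[OF LA(1) L] by blast
  have \<phi>: "0 < \<phi> s" using s LA by simp
  have A: "0 < A"
  proof (rule ccontr)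
    assume "\<not> 0 < A"
    then have "L * A \<le> 0" using LA(1) by (simp add: mult_nonneg_nonpos)
    with LA(2) show False by simp
  qed
  have \<phi>A: "1 < \<phi> s * A" using s(3) LA A by (meson less_le_trans mult_right_mono less_imp_le)
  \<comment> \<open>The gap \<open>\<phi> s * A > 1\<close> pays for \<open>\<delta>\<close> twice, once in \<open>t\<close> and once in the bound of \<open>x powr s\<close>; the rest
     of it absorbs the factor \<open>1/2\<close> of the main estimate.\<close>
  define \<delta> where "\<delta> = ln (\<phi> s * A) / 4"
  have \<delta>: "0 < \<delta>" using \<phi>A by (simp add: \<delta>_def)
  have exp\<delta>: "exp (4 * \<delta>) = \<phi> s * A" using \<phi>A by (simp add: \<delta>_def)
  define \<theta> where "\<theta> = min (1 / D) (\<delta> / (2 * D\<^sup>2))"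
  have \<theta>: "0 < \<theta>" "\<theta> * D \<le> 1" "\<theta> * D\<^sup>2 \<le> \<delta> / 2"
  proof -
    show "0 < \<theta>" using D \<delta> by (simp add: \<theta>_def)
    have "\<theta> \<le> 1 / D" by (simp add: \<theta>_def)
    then show "\<theta> * D \<le> 1" using D by (simp add: field_simps)
    have "\<theta> \<le> \<delta> / (2 * D\<^sup>2)" by (simp add: \<theta>_def)
    then show "\<theta> * D\<^sup>2 \<le> \<delta> / 2" using D by (simp add: field_simps)
  qed
  define r where "r = exp (- (\<theta> * \<delta> / 2))"
  have r: "0 < r" "r < 1" using \<theta> \<delta> by (auto simp: r_def)
  have quad: "\<theta>\<^sup>2 * D\<^sup>2 - \<theta> * \<delta> \<le> - (\<theta> * \<delta> / 2)"
  proof -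
    have "\<theta> * (\<theta> * D\<^sup>2) \<le> \<theta> * (\<delta> / 2)" using \<theta> by (intro mult_left_mono) auto
    then show ?thesis by (simp add: power2_eq_square algebra_simps)
  qed
  have tail1: "exp (- (\<theta> * (M + \<delta>))) * \<phi> (s + \<theta>) \<le> \<phi> s * r"
  proof -
    have "exp (- (\<theta> * (M + \<delta>))) * \<phi> (s + \<theta>) \<le> exp (- (\<theta> * (M + \<delta>))) * (\<phi> s * exp (\<theta> * M + \<theta>\<^sup>2 * D\<^sup>2))"
      using \<theta> by (intro mult_left_mono up) auto
    also have "\<dots> = \<phi> s * exp (\<theta>\<^sup>2 * D\<^sup>2 - \<theta> * \<delta>)"
      by (simp add: exp_add[symmetric] algebra_simps)
    also have "\<dots> \<le> \<phi> s * r" unfolding r_def using \<phi> quad by (intro mult_left_mono) auto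
    finally show ?thesis .
  qed
  have tail2: "exp (\<theta> * (M - \<delta>)) * \<phi> (s - \<theta>) \<le> \<phi> s * r"
  proof -
    have "exp (\<theta> * (M - \<delta>)) * \<phi> (s - \<theta>) \<le> exp (\<theta> * (M - \<delta>)) * (\<phi> s * exp (- \<theta> * M + (- \<theta>)\<^sup>2 * D\<^sup>2))"
      using \<theta> up[of "- \<theta>"] by (intro mult_left_mono) auto
    also have "\<dots> = \<phi> s * exp (\<theta>\<^sup>2 * D\<^sup>2 - \<theta> * \<delta>)"
      by (simp add: exp_add[symmetric] algebra_simps)
    also have "\<dots> \<le> \<phi> s * r" unfolding r_def using \<phi> quad by (intro mult_left_mono) auto
    finally show ?thesis .
  qed
  have "(\<lambda>n. r ^ n) \<longlonglongrightarrow> 0" using r by (intro LIMSEQ_power_zero) auto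
  then have "\<forall>\<^sub>F n in sequentially. r ^ n < 1 / 4" by (rule order_tendstoD) simp
  moreover have "\<forall>\<^sub>F n in sequentially. 2 < exp (2 * \<delta>) ^ n"
  proof -
    have "(\<lambda>n. exp (- (2 * \<delta>)) ^ n) \<longlonglongrightarrow> 0" using \<delta> by (intro LIMSEQ_power_zero) auto
    then have "\<forall>\<^sub>F n in sequentially. exp (- (2 * \<delta>)) ^ n < 1 / 2" by (rule order_tendstoD) simp
    then show ?thesis
      by eventually_elim (simp add: exp_minus power_inverse[symmetric] field_simps)
  qed
  ultimately have "\<forall>\<^sub>F n in sequentially. 0 < n \<and> r ^ n < 1 / 4 \<and> 2 < exp (2 * \<delta>) ^ n"
    using eventually_gt_at_top[of "0::nat"] by eventually_elim auto
  then obtain n where n: "0 < n" "r ^ n < 1 / 4" "2 < exp (2 * \<delta>) ^ n"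
    by (auto simp: eventually_sequentially)
  define t where "t = exp (n * (s * M - \<delta>))"
  define p where "p = measure (product_law n) {x. t \<le> x}"
  have sM: "s * M \<le> M" "s * M \<le> 0" using M by (auto simp flip: M)
  have t: "0 < t" "t \<le> 1"
  proof -
    have "s * M - \<delta> \<le> 0" using sM \<delta> by linarith
    then have "real n * (s * M - \<delta>) \<le> 0" by (intro mult_nonneg_nonpos) auto
    then show "0 < t" "t \<le> 1" by (simp_all add: t_def)
  qed
  interpret W: prob_space "product_law n" by (rule product_law_prob_space)
  let ?u = "exp (s * (n * (M + \<delta>)))"
  let ?v = "exp (- (\<theta> * (n * (M + \<delta>))))" and ?w = "exp (\<theta> * (n * (M - \<delta>)))"
  have pointwise: "x powr s \<le> ?u * indicator {x. t \<le> x} x + ?v * x powr (s + \<theta>) + ?w * x powr (s - \<theta>)"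
    if "0 \<le> x" for x
  proof (cases "x = 0")
    case False
    then have x: "0 < x" using that by simp
    consider "n * (M + \<delta>) \<le> ln x" | "ln x \<le> n * (M - \<delta>)" | "n * (M - \<delta>) \<le> ln x" "ln x \<le> n * (M + \<delta>)"
      by linarith
    then show ?thesis
    proof cases
      case 1
      then have "1 \<le> exp (\<theta> * (ln x - n * (M + \<delta>)))" using \<theta> by simp
      then have "x powr s * 1 \<le> x powr s * exp (\<theta> * (ln x - n * (M + \<delta>)))" by (intro mult_left_mono) auto
      also have "\<dots> = ?v * x powr (s + \<theta>)"
        using x by (simp add: powr_def exp_add[symmetric] algebra_simps)
      finally show ?thesis by (simp add: add_nonneg_nonneg add_increasing add_increasing2)
    next
      case 2
      then have "1 \<le> exp (\<theta> * (n * (M - \<delta>) - ln x))" using \<theta> by simp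
      then have "x powr s * 1 \<le> x powr s * exp (\<theta> * (n * (M - \<delta>) - ln x))" by (intro mult_left_mono) auto
      also have "\<dots> = ?w * x powr (s - \<theta>)"
        using x by (simp add: powr_def exp_add[symmetric] algebra_simps)
      finally show ?thesis by (simp add: add_nonneg_nonneg add_increasing add_increasing2)
    next
      case 3
      have "n * (s * M - \<delta>) \<le> n * (M - \<delta>)" using sM by (intro mult_left_mono) auto
      with 3 have "t \<le> x" unfolding t_def using x by (metis exp_le_cancel_iff exp_ln order_trans)
      moreover have "x powr s \<le> ?u"
        using 3(2) x s by (simp add: powr_def mult_left_mono)
      ultimately show ?thesis by (simp add: add_increasing2)
    qed
  qed simp
  have "ennreal (\<phi> s ^ n) = (\<integral>\<^sup>+ x. ennreal (x powr s) \<partial>product_law n)"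
    by (rule nn_integral_product_law_powr[symmetric])
  also have "\<dots> \<le> (\<integral>\<^sup>+ x. ennreal ?u * indicator {x. t \<le> x} x + ennreal ?v * ennreal (x powr (s + \<theta>)) +
      ennreal ?w * ennreal (x powr (s - \<theta>)) \<partial>product_law n)"
  proof (rule nn_integral_mono_AE)
    show "AE x in product_law n. ennreal (x powr s) \<le> ennreal ?u * indicator {x. t \<le> x} x +
       ennreal ?v * ennreal (x powr (s + \<theta>)) + ennreal ?w * ennreal (x powr (s - \<theta>))"
      using product_law_nonneg
    proof eventually_elim
      case (elim x)
      have "ennreal (x powr s) \<le> ennreal (?u * indicator {x. t \<le> x} x + ?v * x powr (s + \<theta>) + ?w * x powr (s - \<theta>))"
        by (intro ennreal_leI pointwise elim)
      then show ?case
        by (simp add: ennreal_plus ennreal_mult ennreal_indicator add_nonneg_nonneg split: split_indicator)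
    qed
  qed
  also have "\<dots> = ennreal ?u * ennreal p + ennreal ?v * ennreal (\<phi> (s + \<theta>) ^ n) + ennreal ?w * ennreal (\<phi> (s - \<theta>) ^ n)"
    by (simp add: nn_integral_add nn_integral_cmult nn_integral_product_law_powr p_def W.emeasure_eq_measure)
  also have "\<dots> = ennreal (?u * p + ?v * \<phi> (s + \<theta>) ^ n + ?w * \<phi> (s - \<theta>) ^ n)"
    by (simp add: ennreal_plus ennreal_mult \<phi>_nonneg p_def)
  finally have "\<phi> s ^ n \<le> ?u * p + ?v * \<phi> (s + \<theta>) ^ n + ?w * \<phi> (s - \<theta>) ^ n"
    by (subst (asm) ennreal_le_iff) (auto simp: \<phi>_nonneg p_def)
  also have "?v * \<phi> (s + \<theta>) ^ n = (exp (- (\<theta> * (M + \<delta>))) * \<phi> (s + \<theta>)) ^ n"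
    by (simp add: power_mult_distrib exp_of_nat_mult[symmetric] mult_ac)
  also have "\<dots> \<le> (\<phi> s * r) ^ n" by (intro power_mono tail1) (simp add: \<phi>_nonneg)
  also have "?w * \<phi> (s - \<theta>) ^ n = (exp (\<theta> * (M - \<delta>)) * \<phi> (s - \<theta>)) ^ n"
    by (simp add: power_mult_distrib exp_of_nat_mult[symmetric] mult_ac)
  also have "\<dots> \<le> (\<phi> s * r) ^ n" by (intro power_mono tail2) (simp add: \<phi>_nonneg)
  finally have "\<phi> s ^ n \<le> ?u * p + 2 * (\<phi> s ^ n * r ^ n)"
    by (simp add: power_mult_distrib mult.commute add.commute)
  moreover have "\<phi> s ^ n * r ^ n \<le> \<phi> s ^ n * (1 / 4)" using n(2) \<phi> by (intro mult_left_mono) auto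
  ultimately have main: "\<phi> s ^ n / 2 \<le> ?u * p" by simp
  have "1 < exp (2 * \<delta>) ^ n / 2" using n(3) by simp
  also have "\<dots> = exp (n * (- (2 * \<delta>))) * exp (4 * \<delta>) ^ n / 2"
    by (simp add: exp_of_nat_mult[symmetric] exp_add[symmetric] algebra_simps)
  also have "\<dots> \<le> exp (n * (- \<delta> - s * \<delta>)) * exp (4 * \<delta>) ^ n / 2"
  proof -
    have "s * \<delta> \<le> 1 * \<delta>" using s \<delta> by (intro mult_right_mono) auto
    then have "real n * (- (2 * \<delta>)) \<le> n * (- \<delta> - s * \<delta>)" by (intro mult_left_mono) auto
    then show ?thesis by (intro divide_right_mono mult_right_mono) auto
  qed
  also have "\<dots> = exp (n * (- \<delta> - s * \<delta>)) * A ^ n * (\<phi> s ^ n / 2)"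
    by (simp add: exp\<delta> power_mult_distrib)
  also have "\<dots> \<le> exp (n * (- \<delta> - s * \<delta>)) * A ^ n * (?u * p)"
    using A by (intro mult_left_mono main) auto
  also have "\<dots> = t * A ^ n * p"
    by (simp add: t_def exp_add[symmetric] algebra_simps)
  finally show ?thesis using n(1) t unfolding p_def by blast
qed

end

section \<open>Large deviations of matrix products\<close>

context positive_matrix_law
begin

lemma min_entry_le_l1_opnorm: "min_entry (g :: real^'d^'d) \<le> l1_opnorm g"
proof -
  obtain i :: 'd where True by blast
  have "min_entry g \<le> g $ i $ i" by (rule min_entry_le)
  also have "\<dots> \<le> column_sum g i"
    unfolding column_sum_def by (rule order_trans[OF abs_ge_self member_le_sum[of i UNIV "\<lambda>k. \<bar>g $ k $ i\<bar>"]]) auto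
  also have "\<dots> \<le> l1_opnorm g" by (rule column_sum_le_l1_opnorm)
  finally show ?thesis .
qed

text \<open>The value 0 marks a factor outside the truncation; it makes the whole product vanish, and by the
  convention \<open>0 powr s = 0\<close> it does not contribute to any moment.\<close>

definition truncated_min_entry :: "real \<Rightarrow> real^'d^'d \<Rightarrow> real" where
  "truncated_min_entry K g = (if \<bar>ln (min_entry g)\<bar> \<le> K then min_entry g else 0)"

lemma truncated_min_entry_measurable [measurable]: "truncated_min_entry K \<in> borel_measurable borel"
  unfolding truncated_min_entry_def by measurable

lemma truncation_tail:
  assumes "0 < n" "0 < \<epsilon>"
  shows "\<exists>K::real. 0 < K \<and> (\<integral>\<^sup>+ g. ennreal (1 + min_entry g) * indicator {g. K < \<bar>ln (min_entry g)\<bar>} g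
    \<partial>convolution_power \<mu> n) \<le> ennreal \<epsilon>"
proof -
  let ?C = "convolution_power \<mu> n"
  interpret C: prob_space ?C by (rule convolution_prob_space)
  let ?f = "\<lambda>(j::nat) g::real^'d^'d. ennreal (1 + min_entry g) * indicator {g. real j < \<bar>ln (min_entry g)\<bar>} g"
  have "(\<lambda>j. \<integral>\<^sup>+ g. ?f j g \<partial>?C) \<longlonglongrightarrow> (\<integral>\<^sup>+ g. 0 \<partial>?C)"
  proof (rule nn_integral_dominated_convergence[where w = "\<lambda>g. ennreal (1 + min_entry g)"])
    show "?f j \<in> borel_measurable ?C" for j by (rule convolution_measurable) measurable
    show "(\<lambda>g. ennreal (1 + min_entry g)) \<in> borel_measurable ?C" by (rule convolution_measurable) measurable
    have "(\<integral>\<^sup>+ g. ennreal (1 + min_entry g) \<partial>?C) \<le> (\<integral>\<^sup>+ g. 1 + ennreal (l1_opnorm g powr 1) \<partial>?C)"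
    proof (intro nn_integral_mono)
      fix g :: "real^'d^'d"
      have "ennreal (1 + min_entry g) \<le> ennreal (1 + l1_opnorm g)"
        by (intro ennreal_leI add_left_mono min_entry_le_l1_opnorm)
      then show "ennreal (1 + min_entry g) \<le> 1 + ennreal (l1_opnorm g powr 1)"
        by (simp add: ennreal_plus l1_opnorm_nonneg)
    qed
    also have "\<dots> = 1 + moment n 1"
      unfolding moment_def
      by (subst nn_integral_add) (auto intro!: convolution_measurable simp: C.emeasure_space_1)
    also have "\<dots> < \<infinity>" using moment_finite[of 1 n] by simp
    finally show "(\<integral>\<^sup>+ g. ennreal (1 + min_entry g) \<partial>?C) < \<infinity>" .
    show "AE g in ?C. ?f j g \<le> ennreal (1 + min_entry g)" for j
      by (auto split: split_indicator)
    show "AE g in ?C. (\<lambda>j. ?f j g) \<longlonglongrightarrow> 0"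
    proof (rule AE_I2)
      fix g :: "real^'d^'d"
      obtain J where J: "\<bar>ln (min_entry g)\<bar> \<le> real J" using real_arch_simple by blast
      have "\<forall>\<^sub>F j in sequentially. 0 = ?f j g"
        using eventually_ge_at_top[of J] by eventually_elim (use J in auto)
      then show "(\<lambda>j. ?f j g) \<longlonglongrightarrow> 0" by (rule Lim_transform_eventually[OF tendsto_const])
    qed
  qed simp
  then have "\<forall>\<^sub>F j in sequentially. (\<integral>\<^sup>+ g. ?f j g \<partial>?C) < ennreal \<epsilon>"
    using assms(2) by (intro order_tendstoD) auto
  then have "\<forall>\<^sub>F j in sequentially. (\<integral>\<^sup>+ g. ?f j g \<partial>?C) < ennreal \<epsilon> \<and> 0 < j"
    using eventually_gt_at_top[of 0] by eventually_elim auto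
  then obtain j where "(\<integral>\<^sup>+ g. ?f j g \<partial>?C) < ennreal \<epsilon>" "0 < j"
    by (auto simp: eventually_sequentially)
  then show ?thesis by (intro exI[of _ "real j"]) auto
qed

text \<open>The moments of the least entry of a product of \<open>m\<close> factors have the same exponential rate as those of
  its norm, so for large \<open>m\<close> they exceed \<open>\<alpha>\<close> to the power \<open>-m\<close>, uniformly in \<open>s \<in> [0,1]\<close>.  As the
  least entry is supermultiplicative, a product of \<open>j\<close> such blocks dominates a product of
  independent real factors, to which the large deviation bound applies.\<close>

lemma percolation_parameters:
  assumes \<alpha>: "0 < \<alpha>" "1 < min_moment_rate \<mu> * \<alpha>"
  obtains k t where "0 < k" "0 < t" "t \<le> 1"
    "1 < t * \<alpha> ^ k * measure (convolution_power \<mu> k) {g. t \<le> min_entry g}"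
proof -
  let ?l = "min_moment_rate \<mu>"
  have "(\<lambda>n. (1 / (?l * \<alpha>)) ^ n) \<longlonglongrightarrow> 0" using \<alpha> by (intro LIMSEQ_power_zero) auto
  moreover have "0 < c0\<^sup>2 * \<alpha>\<^sup>2 / 2" using c0_pos \<alpha> by simp
  ultimately have "\<forall>\<^sub>F n in sequentially. (1 / (?l * \<alpha>)) ^ n < c0\<^sup>2 * \<alpha>\<^sup>2 / 2"
    by (rule order_tendstoD)
  then obtain n where n: "(1 / (?l * \<alpha>)) ^ n < c0\<^sup>2 * \<alpha>\<^sup>2 / 2"
    by (auto simp: eventually_sequentially)
  define m where "m = n + 2"
  define L where "L = c0\<^sup>2 * ?l ^ n / 2"
  have L: "0 < L" using c0_pos min_moment_rate_pos by (simp add: L_def)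
  have LA: "1 < L * \<alpha> ^ m"
  proof -
    have "1 < c0\<^sup>2 * \<alpha>\<^sup>2 / 2 * (?l * \<alpha>) ^ n"
      using n \<alpha> by (simp add: power_one_over divide_less_eq)
    also have "\<dots> = L * \<alpha> ^ m" by (simp add: L_def m_def power_add power_mult_distrib power2_eq_square)
    finally show ?thesis .
  qed
  have m: "0 < m" by (simp add: m_def)
  obtain K :: real where K: "0 < K"
    and tail: "(\<integral>\<^sup>+ g. ennreal (1 + min_entry g) * indicator {g. K < \<bar>ln (min_entry g)\<bar>} g
      \<partial>convolution_power \<mu> m) \<le> ennreal L"
    using truncation_tail[OF m L] by blast
  let ?F = "truncated_min_entry K" and ?C = "convolution_power \<mu> m"
  interpret C: prob_space ?C by (rule convolution_prob_space)
  have Fm [measurable]: "?F \<in> borel_measurable ?C" by (intro convolution_measurable) measurable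
  define \<nu> where "\<nu> = distr ?C borel ?F"
  have Fpos: "AE g in ?C. ?F g = 0 \<or> 0 < ?F g \<and> \<bar>ln (?F g)\<bar> \<le> K"
    using convolution_pos[OF m] by eventually_elim (auto simp: truncated_min_entry_def)
  interpret \<nu>: bounded_factor_law \<nu> K
  proof (rule bounded_factor_law.intro)
    show "prob_space \<nu>" unfolding \<nu>_def by (rule C.prob_space_distr) measurable
    show "bounded_factor_law_axioms \<nu> K"
      unfolding \<nu>_def
    proof
      show "AE x in distr ?C borel ?F. x = 0 \<or> 0 < x \<and> \<bar>ln x\<bar> \<le> K"
        using Fpos by (subst AE_distr_iff) auto
    qed (use K in auto)
  qed
  have \<nu>_int: "(\<integral>\<^sup>+ x. f x \<partial>\<nu>) = (\<integral>\<^sup>+ g. f (?F g) \<partial>?C)" if "f \<in> borel_measurable borel" for f :: "real \<Rightarrow> ennreal"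
    unfolding \<nu>_def using that by (subst nn_integral_distr) auto
  have \<phi>: "L \<le> \<nu>.\<phi> s" if s: "0 \<le> s" "s \<le> 1" for s
  proof -
    have "ennreal (2 * L) \<le> (\<integral>\<^sup>+ g. ennreal (min_entry g powr s) \<partial>?C)"
      using min_entry_moment_ge[OF s, of n] by (simp add: L_def m_def)
    also have "\<dots> \<le> (\<integral>\<^sup>+ g. ennreal (?F g powr s) +
        ennreal (1 + min_entry g) * indicator {g. K < \<bar>ln (min_entry g)\<bar>} g \<partial>?C)"
    proof (rule nn_integral_mono_AE)
      show "AE g in ?C. ennreal (min_entry g powr s) \<le> ennreal (?F g powr s) +
        ennreal (1 + min_entry g) * indicator {g. K < \<bar>ln (min_entry g)\<bar>} g"
        using convolution_pos[OF m]
      proof eventually_elim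
        case (elim g)
        have "min_entry g powr s \<le> 1 + min_entry g"
        proof (cases "min_entry g \<le> 1")
          case True
          then have "min_entry g powr s \<le> 1" using elim s by (simp add: powr_le1)
          then show ?thesis using elim by simp
        next
          case False
          then have "min_entry g powr s \<le> min_entry g powr 1" using s by (intro powr_mono) auto
          then show ?thesis using elim by simp
        qed
        then show ?case by (auto simp: truncated_min_entry_def ennreal_leI split: split_indicator)
      qed
    qed
    also have "\<dots> = (\<integral>\<^sup>+ g. ennreal (?F g powr s) \<partial>?C) +
        (\<integral>\<^sup>+ g. ennreal (1 + min_entry g) * indicator {g. K < \<bar>ln (min_entry g)\<bar>} g \<partial>?C)"
      by (rule nn_integral_add) (auto intro!: convolution_measurable)
    also have "(\<integral>\<^sup>+ g. ennreal (?F g powr s) \<partial>?C) = ennreal (\<nu>.\<phi> s)"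
    proof -
      have "(\<integral>\<^sup>+ g. ennreal (?F g powr s) \<partial>?C) = (\<integral>\<^sup>+ x. ennreal (x powr s) \<partial>\<nu>)"
        by (rule \<nu>_int[symmetric]) measurable
      also have "\<dots> = ennreal (\<nu>.\<phi> s)"
        unfolding \<nu>.\<phi>_def by (rule nn_integral_eq_integral) (auto simp: \<nu>.integrable_powr)
      finally show ?thesis .
    qed
    also have "ennreal (\<nu>.\<phi> s) + (\<integral>\<^sup>+ g. ennreal (1 + min_entry g) * indicator {g. K < \<bar>ln (min_entry g)\<bar>} g \<partial>?C)
        \<le> ennreal (\<nu>.\<phi> s) + ennreal L"
      by (intro add_left_mono tail)
    also have "\<dots> = ennreal (\<nu>.\<phi> s + L)" using L by (simp add: ennreal_plus \<nu>.\<phi>_nonneg)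
    finally have "2 * L \<le> \<nu>.\<phi> s + L"
      using L by (subst (asm) ennreal_le_iff) (auto simp: \<nu>.\<phi>_nonneg)
    then show ?thesis by simp
  qed
  \<comment> \<open>Induction starts with one block: the empty product is the identity, whose least entry is 0 in dimension 2 or more.\<close>
  have compare: "(\<integral>\<^sup>+ x. indicator {u..} x \<partial>\<nu>.product_law (Suc j)) \<le>
      (\<integral>\<^sup>+ g. indicator {g. u \<le> min_entry g} g \<partial>convolution_power \<mu> (m * Suc j))" if "0 < u" for u :: real and j
    using that
  proof (induction j arbitrary: u)
    case 0
    have "(\<integral>\<^sup>+ x. indicator {u..} x \<partial>\<nu>.product_law (Suc 0)) =
        (\<integral>\<^sup>+ x. \<integral>\<^sup>+ y. indicator {u..} (x * y) \<partial>return borel 1 \<partial>\<nu>)"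
      by (subst \<nu>.nn_integral_product_law_Suc) auto
    also have "\<dots> = (\<integral>\<^sup>+ x. indicator {u..} x \<partial>\<nu>)"
      by (intro nn_integral_cong) (subst nn_integral_return, auto)
    also have "\<dots> = (\<integral>\<^sup>+ g. indicator {u..} (?F g) \<partial>?C)" by (rule \<nu>_int) measurable
    also have "\<dots> \<le> (\<integral>\<^sup>+ g. indicator {g. u \<le> min_entry g} g \<partial>?C)"
      using 0 by (intro nn_integral_mono) (auto simp: truncated_min_entry_def split: split_indicator if_splits)
    finally show ?case by simp
  next
    case (Suc j)
    let ?D = "convolution_power \<mu> (m * Suc j)"
    have "(\<integral>\<^sup>+ x. indicator {u..} x \<partial>\<nu>.product_law (Suc (Suc j))) =
        (\<integral>\<^sup>+ x. \<integral>\<^sup>+ y. indicator {u..} (x * y) \<partial>\<nu>.product_law (Suc j) \<partial>\<nu>)"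
      by (rule \<nu>.nn_integral_product_law_Suc) measurable
    also have "\<dots> = (\<integral>\<^sup>+ g. \<integral>\<^sup>+ y. indicator {u..} (?F g * y) \<partial>\<nu>.product_law (Suc j) \<partial>?C)"
    proof (rule \<nu>_int)
      interpret A: prob_space "\<nu>.product_law (Suc j)" by (rule \<nu>.product_law_prob_space)
      have "(\<lambda>(x, y). indicator {u..} (x * y) :: ennreal) \<in> borel_measurable (borel \<Otimes>\<^sub>M \<nu>.product_law (Suc j))"
        by measurable
      from A.borel_measurable_nn_integral_fst[OF this]
      show "(\<lambda>x. \<integral>\<^sup>+ y. indicator {u..} (x * y) \<partial>\<nu>.product_law (Suc j)) \<in> borel_measurable borel"
        by simp
    qed
    also have "\<dots> \<le> (\<integral>\<^sup>+ g. \<integral>\<^sup>+ h. indicator {g. u \<le> min_entry g} (g ** h) \<partial>?D \<partial>?C)"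
    proof (rule nn_integral_mono_AE)
      show "AE g in ?C. (\<integral>\<^sup>+ y. indicator {u..} (?F g * y) \<partial>\<nu>.product_law (Suc j)) \<le>
          (\<integral>\<^sup>+ h. indicator {g. u \<le> min_entry g} (g ** h) \<partial>?D)"
        using convolution_pos[OF m]
      proof eventually_elim
        case g: (elim g)
        show ?case
        proof (cases "\<bar>ln (min_entry g)\<bar> \<le> K")
          case False
          then show ?thesis using Suc.prems by (simp add: truncated_min_entry_def)
        next
          case True
          then have F: "?F g = min_entry g" by (simp add: truncated_min_entry_def)
          have "(\<integral>\<^sup>+ y. indicator {u..} (?F g * y) \<partial>\<nu>.product_law (Suc j)) =
              (\<integral>\<^sup>+ y. indicator {u / min_entry g..} y \<partial>\<nu>.product_law (Suc j))"
            unfolding F using g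
            by (intro nn_integral_cong) (auto simp: divide_le_eq mult.commute split: split_indicator)
          also have "\<dots> \<le> (\<integral>\<^sup>+ h. indicator {h. u / min_entry g \<le> min_entry h} h \<partial>?D)"
            using g Suc.prems by (intro Suc.IH) auto
          also have "\<dots> \<le> (\<integral>\<^sup>+ h. indicator {g. u \<le> min_entry g} (g ** h) \<partial>?D)"
          proof (rule nn_integral_mono_AE)
            show "AE h in ?D. indicator {h. u / min_entry g \<le> min_entry h} h \<le>
                (indicator {g. u \<le> min_entry g} (g ** h) :: ennreal)"
              using convolution_nonneg
            proof eventually_elim
              case (elim h)
              have "min_entry g * min_entry h \<le> min_entry (g ** h)"
                using g elim by (intro min_entry_mult) (auto simp: nonneg_entries_iff_min_entry)
              then show ?case using g
                by (auto simp: divide_le_eq mult.commute split: split_indicator)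
            qed
          qed
          finally show ?thesis .
        qed
      qed
    qed
    also have "\<dots> = (\<integral>\<^sup>+ g. indicator {g. u \<le> min_entry g} g \<partial>convolution_power \<mu> (m + m * Suc j))"
      by (rule nn_integral_convolution_add[symmetric]) measurable
    finally show ?case by simp
  qed
  obtain j t where jt: "0 < j" "0 < t" "t \<le> 1"
    and large: "1 < t * (\<alpha> ^ m) ^ j * measure (\<nu>.product_law j) {x. t \<le> x}"
    using \<nu>.large_deviation_lower_bound[OF L LA \<phi>] by blast
  obtain i where i: "j = Suc i" using jt(1) by (cases j) auto
  interpret W: prob_space "\<nu>.product_law j" by (rule \<nu>.product_law_prob_space)
  interpret V: prob_space "convolution_power \<mu> (m * j)" by (rule convolution_prob_space)
  have "emeasure (\<nu>.product_law j) {x. t \<le> x} \<le> emeasure (convolution_power \<mu> (m * j)) {g. t \<le> min_entry g}"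
  proof -
    have "{g :: real^'d^'d. t \<le> min_entry g} \<in> sets borel" by measurable
    moreover have "{x. t \<le> x} = {t..}" by auto
    ultimately show ?thesis
      using compare[OF jt(2), of i] unfolding i[symmetric]
      by (simp add: nn_integral_indicator convolution_sets \<nu>.product_law_sets)
  qed
  then have "measure (\<nu>.product_law j) {x. t \<le> x} \<le> measure (convolution_power \<mu> (m * j)) {g. t \<le> min_entry g}"
    by (simp add: W.emeasure_eq_measure V.emeasure_eq_measure)
  then have "t * (\<alpha> ^ m) ^ j * measure (\<nu>.product_law j) {x. t \<le> x} \<le>
      t * (\<alpha> ^ m) ^ j * measure (convolution_power \<mu> (m * j)) {g. t \<le> min_entry g}"
    using jt \<alpha> by (intro mult_left_mono) auto
  with large have "1 < t * \<alpha> ^ (m * j) * measure (convolution_power \<mu> (m * j)) {g. t \<le> min_entry g}"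
    by (simp add: power_mult)
  then show thesis using jt m by (intro that[of "m * j" t]) auto
qed

end

section \<open>Trees, cutsets and flows\<close>

lemma tree_level_0: "tree_level B 0 = {[]}"
  by (auto simp: tree_level_def)

lemma tree_level_length: "v \<in> tree_level B n \<Longrightarrow> length v = n"
  by (simp add: tree_level_def)

lemma tree_level_snoc: "v @ [c] \<in> tree_level B (Suc n) \<longleftrightarrow> v \<in> tree_level B n \<and> c \<in> {1..B v}"
  by (auto simp: tree_level_def nth_append less_Suc_eq)

lemma tree_level_Suc: "tree_level B (Suc n) = (\<Union>u\<in>tree_level B n. (\<lambda>c. u @ [c]) ` {1..B u})"
proof (intro set_eqI iffI)
  fix v assume v: "v \<in> tree_level B (Suc n)"
  then obtain u c where uc: "v = u @ [c]"
    using tree_level_length[OF v] by (metis length_0_conv nat.distinct(1) rev_exhaust)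
  with v show "v \<in> (\<Union>u\<in>tree_level B n. (\<lambda>c. u @ [c]) ` {1..B u})"
    using tree_level_snoc by blast
qed (auto simp: tree_level_snoc)

lemma finite_tree_level: "finite (tree_level B n)"
  by (induction n) (auto simp: tree_level_0 tree_level_Suc)

lemma tree_level_take: "v \<in> tree_level B n \<Longrightarrow> m \<le> n \<Longrightarrow> take m v \<in> tree_level B m"
  by (auto simp: tree_level_def min_def)

lemma tree_level_vertices: "v \<in> tree_level B n \<Longrightarrow> v \<in> vertices B"
  by (auto simp: vertices_def)

lemma vertices_level: "v \<in> vertices B \<Longrightarrow> v \<in> tree_level B (length v)"
  by (auto simp: vertices_def tree_level_def)

lemma sum_tree_level_Suc:
  "(\<Sum>v\<in>tree_level B (Suc n). f v) = (\<Sum>u\<in>tree_level B n. \<Sum>c\<in>{1..B u}. f (u @ [c]))"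
proof -
  have "(\<Sum>v\<in>tree_level B (Suc n). f v) = (\<Sum>u\<in>tree_level B n. sum f ((\<lambda>c. u @ [c]) ` {1..B u}))"
    unfolding tree_level_Suc by (intro sum.UNION_disjoint) (auto simp: finite_tree_level)
  also have "\<dots> = (\<Sum>u\<in>tree_level B n. \<Sum>c\<in>{1..B u}. f (u @ [c]))"
    by (intro sum.cong refl sum.reindex_cong[where l = "\<lambda>c. _ @ [c]"]) (auto intro: inj_onI)
  finally show ?thesis .
qed

text \<open>The vertices of \<open>Q\<close> separate the subtree of \<open>v\<close> from its boundary.\<close>

definition covers_from :: "(vertex \<Rightarrow> nat) \<Rightarrow> vertex \<Rightarrow> vertex set \<Rightarrow> bool" where
  "covers_from B v Q \<longleftrightarrow> finite Q \<and>
     (\<forall>w\<in>boundary B. map w [0..<length v] = v \<longrightarrow> (\<exists>u\<in>Q. map w [0..<length u] = u))"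

lemma cylinder_diam:
  fixes u :: vertex and B :: "vertex \<Rightarrow> nat"
  defines "C \<equiv> {w \<in> boundary B. map w [0..<length u] = u}"
  shows "0 \<le> set_diam boundary_dist C" "set_diam boundary_dist C \<le> exp (- real (length u))"
    "\<forall>x\<in>C. \<forall>y\<in>C. boundary_dist x y \<le> exp (- real (length u))"
proof -
  have dist: "boundary_dist x y \<le> exp (- real (length u))" if x: "x \<in> C" and y: "y \<in> C" for x y
  proof (cases "x = y")
    case False
    have eq: "x k = y k" if "k < length u" for k
    proof -
      have "map x [0..<length u] ! k = map y [0..<length u] ! k" using x y by (simp add: C_def)
      then show ?thesis using that by simp
    qed
    obtain n where "x n \<noteq> y n" using False by blast
    then have "x (LEAST n. x n \<noteq> y n) \<noteq> y (LEAST n. x n \<noteq> y n)" by (rule LeastI)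
    then have "length u \<le> (LEAST n. x n \<noteq> y n)" using eq by (meson not_less)
    then show ?thesis using False by (simp add: boundary_dist_def)
  qed (simp add: boundary_dist_def)
  then show "\<forall>x\<in>C. \<forall>y\<in>C. boundary_dist x y \<le> exp (- real (length u))" by blast
  have bdd: "bdd_above ((\<lambda>(x, y). boundary_dist x y) ` (C \<times> C))"
    using dist by (intro bdd_aboveI2[where M = "exp (- real (length u))"]) auto
  show "set_diam boundary_dist C \<le> exp (- real (length u))"
    unfolding set_diam_def using dist by (auto intro!: cSUP_least)
  show "0 \<le> set_diam boundary_dist C"
  proof (cases "C = {}")
    case False
    then obtain x where "x \<in> C" by blast
    then have "(\<lambda>(x, y). boundary_dist x y) (x, x) \<le> (SUP (x, y)\<in>C \<times> C. boundary_dist x y)"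
      by (intro cSUP_upper bdd) auto
    moreover have "boundary_dist x x = 0" by (simp add: boundary_dist_def)
    ultimately show ?thesis using False by (simp add: set_diam_def)
  qed (simp add: set_diam_def)
qed

text \<open>Cylinders are the efficient covers of the boundary: the cylinder of \<open>u\<close> has diameter at most
  \<open>exp (- length u)\<close>.  A cutset of small weight consists of long words only, so it is a cover by sets of
  small diameter, and its weight is at least the Hausdorff premeasure at that scale.\<close>

lemma cutset_sum_bounded_below:
  assumes \<alpha>: "1 < \<alpha>" and dim: "ereal (ln \<alpha>) < hausdorff_dim boundary_dist (boundary B)"
  obtains c :: real where "0 < c" "\<And>Q. covers_from B [] Q \<Longrightarrow> c \<le> (\<Sum>u\<in>Q. (1 / \<alpha>) ^ length u)"
proof -
  let ?s = "ln \<alpha>" and ?d = boundary_dist and ?S = "boundary B"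
  have s: "0 < ?s" using \<alpha> by simp
  have "hausdorff_measure ?d ?S ?s \<noteq> 0"
  proof
    assume "hausdorff_measure ?d ?S ?s = 0"
    then have "hausdorff_dim ?d ?S \<le> ereal ?s"
      unfolding hausdorff_dim_def using s by (intro Inf_lower) auto
    with dim show False by simp
  qed
  then obtain \<epsilon> where \<epsilon>: "0 < \<epsilon>" "hausdorff_premeasure ?d ?S ?s \<epsilon> \<noteq> 0"
    unfolding hausdorff_measure_def by (metis SUP_bot_conv(1) bot_ennreal greaterThan_iff)
  obtain p where p: "0 < p" "ennreal p \<le> hausdorff_premeasure ?d ?S ?s \<epsilon>"
  proof (cases "hausdorff_premeasure ?d ?S ?s \<epsilon>")
    case (real r)
    then show thesis using \<epsilon>(2) by (intro that[of r]) (auto simp: less_le)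
  next
    case top
    then show thesis by (intro that[of 1]) auto
  qed
  \<comment> \<open>The second bound forces every cylinder of a lighter cutset to have diameter at most \<open>\<epsilon>\<close>.\<close>
  define c where "c = min p (\<epsilon> powr ?s)"
  have "c \<le> (\<Sum>u\<in>Q. (1 / \<alpha>) ^ length u)" if cov: "covers_from B [] Q" for Q
  proof (rule ccontr)
    assume "\<not> ?thesis"
    then have less: "(\<Sum>u\<in>Q. (1 / \<alpha>) ^ length u) < c" by simp
    have fin: "finite Q" using cov by (simp add: covers_from_def)
    have pw: "exp (- real (length u)) powr ?s = (1 / \<alpha>) ^ length u" for u :: vertex
    proof -
      have "exp (- real (length u)) powr ?s = exp (real (length u) * ln (1 / \<alpha>))"
        using \<alpha> by (simp add: powr_def ln_div)
      then show ?thesis using \<alpha> by (simp add: exp_of_nat_mult)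
    qed
    have small: "exp (- real (length u)) \<le> \<epsilon>" if "u \<in> Q" for u
    proof (rule ccontr)
      assume "\<not> ?thesis"
      then have "\<epsilon> powr ?s \<le> (1 / \<alpha>) ^ length u"
        unfolding pw[symmetric] using \<epsilon> s by (intro powr_mono2) auto
      also have "\<dots> \<le> (\<Sum>u\<in>Q. (1 / \<alpha>) ^ length u)"
        using \<alpha> by (intro member_le_sum that fin) auto
      finally show False using less by (simp add: c_def)
    qed
    obtain us where us: "set us = Q" "distinct us" using finite_distinct_list[OF fin] by blast
    define U where "U i = (if i < length us then {w \<in> ?S. map w [0..<length (us ! i)] = us ! i} else {})" for i
    have "(\<Union>i. U i) = ?S"
    proof
      show "?S \<subseteq> (\<Union>i. U i)"
      proof
        fix w assume w: "w \<in> ?S"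
        then obtain u where "u \<in> Q" "map w [0..<length u] = u" using cov by (auto simp: covers_from_def)
        then show "w \<in> (\<Union>i. U i)" using w us(1) by (force simp: U_def in_set_conv_nth)
      qed
    qed (auto simp: U_def split: if_splits)
    moreover have "\<forall>i. \<forall>x\<in>U i. \<forall>y\<in>U i. ?d x y \<le> \<epsilon>"
    proof (intro allI ballI)
      fix i x y assume xy: "x \<in> U i" "y \<in> U i"
      then have i: "i < length us" by (auto simp: U_def split: if_splits)
      then have "?d x y \<le> exp (- real (length (us ! i)))"
        using xy cylinder_diam(3)[of B "us ! i"] by (auto simp: U_def)
      also have "\<dots> \<le> \<epsilon>" using i us(1) by (intro small) auto
      finally show "?d x y \<le> \<epsilon>" .
    qed
    ultimately have "hausdorff_premeasure ?d ?S ?s \<epsilon> \<le> (\<Sum>i. ennreal (set_diam ?d (U i) powr ?s))"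
      unfolding hausdorff_premeasure_def by (intro INF_lower) auto
    also have "\<dots> = (\<Sum>i<length us. ennreal (set_diam ?d (U i) powr ?s))"
      using s by (intro suminf_finite) (auto simp: U_def set_diam_def)
    also have "\<dots> \<le> (\<Sum>i<length us. ennreal ((1 / \<alpha>) ^ length (us ! i)))"
    proof (intro sum_mono ennreal_leI)
      fix i assume i: "i \<in> {..<length us}"
      show "set_diam ?d (U i) powr ?s \<le> (1 / \<alpha>) ^ length (us ! i)"
        unfolding pw[symmetric] using i s cylinder_diam(1,2)[where u = "us ! i" and B = B]
        by (intro powr_mono2) (auto simp: U_def)
    qed
    also have "\<dots> = ennreal (\<Sum>i<length us. (1 / \<alpha>) ^ length (us ! i))"
      using \<alpha> by (intro sum_ennreal) auto
    also have "(\<Sum>i<length us. (1 / \<alpha>) ^ length (us ! i)) = (\<Sum>u\<in>Q. (1 / \<alpha>) ^ length u)"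
      using us by (simp add: sum.distinct_set_conv_list sum_list_sum_nth atLeast0LessThan flip: us(1))
    finally have "ennreal p \<le> ennreal (\<Sum>u\<in>Q. (1 / \<alpha>) ^ length u)" using p(2) by (rule order_trans[rotated])
    then have "p \<le> (\<Sum>u\<in>Q. (1 / \<alpha>) ^ length u)"
      using \<alpha> by (subst (asm) ennreal_le_iff) (auto intro: sum_nonneg)
    with less show False by (simp add: c_def)
  qed
  moreover have "0 < c" using p \<epsilon> by (simp add: c_def)
  ultimately show thesis by (rule that[rotated])
qed

text \<open>The least weight of a cutset of the first \<open>j\<close> generations below \<open>v\<close>.\<close>

primrec min_cut :: "(vertex \<Rightarrow> nat) \<Rightarrow> real \<Rightarrow> nat \<Rightarrow> vertex \<Rightarrow> real" where
  "min_cut B r 0 v = r ^ length v"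
| "min_cut B r (Suc j) v = min (r ^ length v) (\<Sum>c\<in>{1..B v}. min_cut B r j (v @ [c]))"

lemma min_cut_nonneg: "0 \<le> r \<Longrightarrow> 0 \<le> min_cut B r j v"
  by (induction j arbitrary: v) (auto intro: sum_nonneg)

lemma min_cut_le: "min_cut B r j v \<le> r ^ length v"
  by (cases j) auto

lemma sum_UNION_le:
  fixes f :: "'b \<Rightarrow> real"
  assumes "finite I" "\<And>i. i \<in> I \<Longrightarrow> finite (A i)" "\<And>x. 0 \<le> f x"
  shows "sum f (\<Union>i\<in>I. A i) \<le> (\<Sum>i\<in>I. sum f (A i))"
  using assms(1,2)
proof (induction I rule: finite_induct)
  case (insert i I)
  have "sum f (A i \<union> (\<Union>j\<in>I. A j)) = sum f (A i) + sum f (\<Union>j\<in>I. A j) - sum f (A i \<inter> (\<Union>j\<in>I. A j))"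
    using insert by (intro sum_Un) auto
  also have "\<dots> \<le> sum f (A i) + (\<Sum>j\<in>I. sum f (A j))"
    using insert assms(3) sum_nonneg[of "A i \<inter> (\<Union>j\<in>I. A j)" f] by auto
  finally show ?case using insert by simp
qed simp

text \<open>The recursion of \<open>min_cut\<close> chooses at each vertex between cutting there and cutting in the
  subtrees of its children, so it is realised by a cutset.\<close>

lemma min_cut_attained:
  assumes r: "0 \<le> r"
  shows "\<exists>Q. covers_from B v Q \<and> (\<Sum>u\<in>Q. r ^ length u) \<le> min_cut B r j v"
proof (induction j arbitrary: v)
  case 0
  show ?case by (intro exI[of _ "{v}"]) (auto simp: covers_from_def)
next
  case (Suc j)
  show ?case
  proof (cases "r ^ length v \<le> (\<Sum>c\<in>{1..B v}. min_cut B r j (v @ [c]))")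
    case True
    then show ?thesis by (intro exI[of _ "{v}"]) (auto simp: covers_from_def)
  next
    case False
    have "\<forall>c. \<exists>Q. covers_from B (v @ [c]) Q \<and> (\<Sum>u\<in>Q. r ^ length u) \<le> min_cut B r j (v @ [c])"
      using Suc.IH by blast
    from choice[OF this] obtain F where F: "\<And>c. covers_from B (v @ [c]) (F c)"
      "\<And>c. (\<Sum>u\<in>F c. r ^ length u) \<le> min_cut B r j (v @ [c])"
      by blast
    have "covers_from B v (\<Union>c\<in>{1..B v}. F c)"
      unfolding covers_from_def
    proof (intro conjI ballI impI)
      show "finite (\<Union>c\<in>{1..B v}. F c)" using F(1) by (auto simp: covers_from_def)
      fix w assume w: "w \<in> boundary B" and v: "map w [0..<length v] = v"
      let ?c = "w (length v)"
      have e: "map w [0..<length (v @ [?c])] = v @ [?c]" using v by simp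
      have "map w [0..<Suc (length v)] \<in> vertices B" using w by (simp add: boundary_def del: upt_Suc)
      then have "v @ [?c] \<in> vertices B" using v by simp
      then have "v @ [?c] \<in> tree_level B (Suc (length v))" using vertices_level by fastforce
      then have "?c \<in> {1..B v}" unfolding tree_level_snoc by simp
      moreover obtain u where "u \<in> F ?c" "map w [0..<length u] = u"
        using F(1)[of ?c] w e unfolding covers_from_def by blast
      ultimately show "\<exists>u\<in>\<Union>c\<in>{1..B v}. F c. map w [0..<length u] = u" by blast
    qed
    moreover have "(\<Sum>u\<in>(\<Union>c\<in>{1..B v}. F c). r ^ length u) \<le> (\<Sum>c\<in>{1..B v}. \<Sum>u\<in>F c. r ^ length u)"
      using F(1) r by (intro sum_UNION_le) (auto simp: covers_from_def)
    moreover have "\<dots> \<le> (\<Sum>c\<in>{1..B v}. min_cut B r j (v @ [c]))"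
      by (intro sum_mono F(2))
    ultimately show ?thesis using False by (intro exI[of _ "\<Union>c\<in>{1..B v}. F c"]) auto
  qed
qed

text \<open>Distributing mass from the root downwards in proportion to the minimal cuts gives a flow
  that never exceeds the minimal cut, in particular not the capacity.\<close>

definition cut_flow :: "(vertex \<Rightarrow> nat) \<Rightarrow> real \<Rightarrow> nat \<Rightarrow> vertex \<Rightarrow> real" where
  "cut_flow B r N v = min_cut B r N [] * (\<Prod>i<length v. min_cut B r (N - Suc i) (take (Suc i) v) /
     (\<Sum>c\<in>{1..B (take i v)}. min_cut B r (N - Suc i) (take i v @ [c])))"

lemma cut_flow_Nil: "cut_flow B r N [] = min_cut B r N []"
  by (simp add: cut_flow_def)

lemma cut_flow_snoc:
  "cut_flow B r N (v @ [x]) = cut_flow B r N v * (min_cut B r (N - Suc (length v)) (v @ [x]) /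
     (\<Sum>c\<in>{1..B v}. min_cut B r (N - Suc (length v)) (v @ [c])))"
  by (simp add: cut_flow_def)

lemma cut_flow_nonneg: "0 \<le> r \<Longrightarrow> 0 \<le> cut_flow B r N v"
  by (auto simp: cut_flow_def intro!: mult_nonneg_nonneg prod_nonneg divide_nonneg_nonneg sum_nonneg min_cut_nonneg)

lemma cut_flow_le_min_cut:
  assumes r: "0 \<le> r"
  shows "length v \<le> N \<Longrightarrow> cut_flow B r N v \<le> min_cut B r (N - length v) v"
proof (induction v rule: rev_induct)
  case Nil
  then show ?case by (simp add: cut_flow_Nil)
next
  case (snoc x v)
  let ?j = "N - Suc (length v)"
  let ?s = "\<Sum>c\<in>{1..B v}. min_cut B r ?j (v @ [c])"
  have j: "N - length v = Suc ?j" using snoc.prems by simp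
  have s0: "0 \<le> ?s" by (intro sum_nonneg min_cut_nonneg r)
  have x0: "0 \<le> min_cut B r ?j (v @ [x])" by (intro min_cut_nonneg r)
  have "cut_flow B r N v \<le> ?s" using snoc unfolding j by simp
  then have "cut_flow B r N (v @ [x]) \<le> ?s * (min_cut B r ?j (v @ [x]) / ?s)"
    unfolding cut_flow_snoc using s0 x0 by (intro mult_right_mono divide_nonneg_nonneg)
  also have "\<dots> \<le> min_cut B r ?j (v @ [x])" using x0 by (cases "?s = 0") auto
  finally show ?case by simp
qed

lemma cut_flow_conserved:
  assumes r: "0 \<le> r" and v: "length v < N"
  shows "(\<Sum>x\<in>{1..B v}. cut_flow B r N (v @ [x])) = cut_flow B r N v"
proof -
  let ?j = "N - Suc (length v)"
  let ?s = "\<Sum>c\<in>{1..B v}. min_cut B r ?j (v @ [c])"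
  have "(\<Sum>x\<in>{1..B v}. cut_flow B r N (v @ [x])) = cut_flow B r N v * (?s / ?s)"
    unfolding cut_flow_snoc by (simp add: sum_distrib_left[symmetric] sum_divide_distrib[symmetric])
  also have "\<dots> = cut_flow B r N v"
  proof (cases "?s = 0")
    case True
    have "N - length v = Suc ?j" using v by simp
    then have "cut_flow B r N v \<le> 0"
      using cut_flow_le_min_cut[OF r, of v N B] v True by simp
    then have "cut_flow B r N v = 0" using cut_flow_nonneg[OF r, of B N v] by simp
    then show ?thesis by simp
  qed simp
  finally show ?thesis .
qed

text \<open>Hence, if the boundary has dimension above \<open>ln \<alpha>\<close>, every truncation of the tree carries a
  flow of strength bounded below which is bounded by \<open>\<alpha>\<^sup>-\<^sup>n\<close> at generation \<open>n\<close>.\<close>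

lemma flow_exists:
  assumes \<alpha>: "1 < \<alpha>" and dim: "ereal (ln \<alpha>) < hausdorff_dim boundary_dist (boundary B)"
  obtains c :: real where "0 < c"
    "\<And>N. \<exists>m :: vertex \<Rightarrow> real. c \<le> m [] \<and> (\<forall>v. 0 \<le> m v) \<and>
       (\<forall>v. length v \<le> N \<longrightarrow> m v \<le> (1 / \<alpha>) ^ length v) \<and>
       (\<forall>v. length v < N \<longrightarrow> (\<Sum>x\<in>{1..B v}. m (v @ [x])) = m v)"
proof -
  obtain c where c: "0 < c" "\<And>Q. covers_from B [] Q \<Longrightarrow> c \<le> (\<Sum>u\<in>Q. (1 / \<alpha>) ^ length u)"
    using cutset_sum_bounded_below[OF assms] by blast
  let ?m = "cut_flow B (1 / \<alpha>)"
  have r: "0 \<le> 1 / \<alpha>" using \<alpha> by simp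
  have "c \<le> ?m N []" for N
    using c(2) min_cut_attained[OF r, of B "[]" N] unfolding cut_flow_Nil by (meson order_trans)
  then show thesis
    using c(1) cut_flow_nonneg[OF r] cut_flow_conserved[OF r]
      order_trans[OF cut_flow_le_min_cut[OF r] min_cut_le]
    by (intro that[of c] exI[of _ "?m _"] conjI) auto
qed

lemma flow_level_sum:
  fixes m :: "vertex \<Rightarrow> real"
  assumes cons: "\<And>v. length v < N \<Longrightarrow> (\<Sum>x\<in>{1..B v}. m (v @ [x])) = m v"
    and u: "u \<in> tree_level B j" and "j \<le> n" "n \<le> N"
  shows "(\<Sum>v | v \<in> tree_level B n \<and> take j v = u. m v) = m u"
  using assms(3,4)
proof (induction n rule: dec_induct)
  case base
  have "{v. v \<in> tree_level B j \<and> take j v = u} = {u}"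
    using u by (auto simp: tree_level_length)
  then show ?case by simp
next
  case (step n)
  have "(\<Sum>v | v \<in> tree_level B (Suc n) \<and> take j v = u. m v) =
      (\<Sum>v\<in>tree_level B (Suc n). if take j v = u then m v else 0)"
    by (simp add: sum.inter_filter[symmetric] finite_tree_level)
  also have "\<dots> = (\<Sum>v\<in>tree_level B n. \<Sum>c\<in>{1..B v}. if take j (v @ [c]) = u then m (v @ [c]) else 0)"
    by (rule sum_tree_level_Suc)
  also have "\<dots> = (\<Sum>v\<in>tree_level B n. if take j v = u then m v else 0)"
  proof (intro sum.cong refl)
    fix v assume "v \<in> tree_level B n"
    then have "length v = n" by (rule tree_level_length)
    then show "(\<Sum>c\<in>{1..B v}. if take j (v @ [c]) = u then m (v @ [c]) else 0) =
        (if take j v = u then m v else 0)"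
      using step cons[of v] by auto
  qed
  also have "\<dots> = (\<Sum>v | v \<in> tree_level B n \<and> take j v = u. m v)"
    by (simp add: sum.inter_filter[symmetric] finite_tree_level)
  finally show ?case using step by simp
qed

section \<open>Matrix products along paths\<close>

lemma borel_measurable_matrixI:
  fixes f :: "'a \<Rightarrow> real^'d^'d::finite"
  assumes "\<And>i j. (\<lambda>x. f x $ i $ j) \<in> borel_measurable N"
  shows "f \<in> borel_measurable N"
proof (subst borel_measurable_euclidean_space, intro ballI)
  fix b :: "real^'d^'d" assume "b \<in> Basis"
  then obtain i j where b: "b = axis i (axis j 1)"
    by (auto simp: Basis_vec_def)
  show "(\<lambda>x. f x \<bullet> b) \<in> borel_measurable N"
    using assms[of i j] unfolding b by (simp add: inner_axis)
qed

lemma ratio_matrix_measurable [measurable]: "ratio_matrix \<in> borel_measurable borel"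
proof (rule borel_measurable_matrixI)
  fix i j :: 'a
  have "(\<lambda>e::(real^'a^'a) \<times> (real^'a). fst e $ i $ j) \<in> borel_measurable borel"
    "(\<lambda>e::(real^'a^'a) \<times> (real^'a). snd e $ j) \<in> borel_measurable borel"
    by (intro borel_measurable_continuous_onI continuous_intros)+
  then show "(\<lambda>e. ratio_matrix e $ i $ j) \<in> borel_measurable borel"
    by (simp add: ratio_matrix_def)
qed

lemma ratio_matrix_pos: "positive_env e \<Longrightarrow> 0 < min_entry (ratio_matrix e)"
  by (simp add: min_entry_pos_iff ratio_matrix_def positive_env_def)

type_synonym 'd environment = "edge \<Rightarrow> 'd env"

definition step_matrix :: "('d::finite) environment \<Rightarrow> vertex \<Rightarrow> real^'d^'d" where
  "step_matrix e v = ratio_matrix (e (edge_to v))"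

text \<open>The product of the \<open>k\<close> matrices on the path to \<open>v\<close> that follow generation \<open>i\<close>.\<close>

primrec path_prod :: "('d::finite) environment \<Rightarrow> vertex \<Rightarrow> nat \<Rightarrow> nat \<Rightarrow> real^'d^'d" where
  "path_prod e v i 0 = mat 1"
| "path_prod e v i (Suc k) = path_prod e v i k ** step_matrix e (take (Suc (i + k)) v)"

definition path_edges :: "vertex \<Rightarrow> nat \<Rightarrow> nat \<Rightarrow> edge set" where
  "path_edges v i k = (\<lambda>l. edge_to (take (Suc l) v)) ` {i..<i + k}"

lemma path_prod_add: "path_prod e v i (j + k) = path_prod e v i j ** path_prod e v (i + j) k"
  by (induction k) (simp_all add: matrix_mul_assoc add.assoc)

lemma path_prod_take: "i + k \<le> n \<Longrightarrow> path_prod e (take n v) i k = path_prod e v i k"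
  by (induction k) (simp_all add: min_def)

lemma path_prod_cong:
  "(\<And>a. a \<in> path_edges v i k \<Longrightarrow> e a = e' a) \<Longrightarrow> path_prod e v i k = path_prod e' v i k"
proof (induction k)
  case (Suc k)
  have "path_prod e v i k = path_prod e' v i k"
  proof (rule Suc.IH)
    fix a assume "a \<in> path_edges v i k"
    then have "a \<in> path_edges v i (Suc k)" unfolding path_edges_def by force
    then show "e a = e' a" by (rule Suc.prems)
  qed
  moreover have "e (edge_to (take (Suc (i + k)) v)) = e' (edge_to (take (Suc (i + k)) v))"
    by (intro Suc.prems) (simp add: path_edges_def)
  ultimately show ?case by (simp add: step_matrix_def)
qed simp

lemma path_prod_measurable:
  assumes "path_edges v i k \<subseteq> J"
  shows "(\<lambda>e :: ('d::finite) environment. path_prod e v i k) \<in> borel_measurable (PiM J (\<lambda>_. borel))"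
  using assms
proof (induction k)
  case (Suc k)
  let ?a = "edge_to (take (Suc (i + k)) v)"
  have "path_edges v i k \<subseteq> J" using Suc.prems by (auto simp: path_edges_def)
  then have 1: "(\<lambda>e :: 'd environment. path_prod e v i k) \<in> borel_measurable (PiM J (\<lambda>_. borel))" by (rule Suc.IH)
  have "?a \<in> J" using Suc.prems by (auto simp: path_edges_def)
  then have "(\<lambda>e. e ?a) \<in> measurable (PiM J (\<lambda>_. borel :: 'd env measure)) borel"
    by (rule measurable_component_singleton)
  from measurable_compose[OF this ratio_matrix_measurable]
  have 2: "(\<lambda>e :: 'd environment. step_matrix e (take (Suc (i + k)) v)) \<in> borel_measurable (PiM J (\<lambda>_. borel))"
    by (simp add: step_matrix_def)
  from measurable_compose[OF measurable_Pair[OF 1 2] matrix_mult_measurable]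
  show ?case by simp
qed simp

lemma edge_to_inj: "inj edge_to"
  by (auto simp: edge_to_def intro: injI)

lemma take_vertices: "v \<in> vertices B \<Longrightarrow> take n v \<in> vertices B"
proof -
  assume v: "v \<in> vertices B"
  show ?thesis
  proof (cases "n \<le> length v")
    case True
    then show ?thesis using tree_level_take[OF vertices_level[OF v]] tree_level_vertices by blast
  qed (use v in simp)
qed

lemma path_edges_subset:
  assumes "v \<in> vertices B" "i + k \<le> length v"
  shows "path_edges v i k \<subseteq> edges B"
  using assms take_vertices[OF assms(1)] by (auto simp: path_edges_def edges_def)

locale random_environment = prob_space M for M :: "'w measure" +
  fixes B :: "vertex \<Rightarrow> nat"
    and \<Xi> :: "edge \<Rightarrow> 'w \<Rightarrow> ('d::finite) env"
    and \<rho> :: "'d env measure"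
    and \<mu> :: "(real^'d^'d) measure"
  assumes nonextinct: "without_extinction B"
    and indep: "indep_vars (\<lambda>_. borel) \<Xi> (edges B)"
    and law: "\<And>a. a \<in> edges B \<Longrightarrow> distr M borel (\<Xi> a) = \<rho>"
    and pos: "AE e in \<rho>. positive_env e"
    and law_ratio: "\<And>a. a \<in> edges B \<Longrightarrow> distr M borel (\<lambda>\<omega>. ratio_matrix (\<Xi> a \<omega>)) = \<mu>"
    and integrable: "integrability_condition \<mu>"
begin

lemma random_env [measurable]: "a \<in> edges B \<Longrightarrow> \<Xi> a \<in> borel_measurable M"
  using indep by (simp add: indep_vars_def)

lemma tree_level_nonempty: "tree_level B n \<noteq> {}"
proof -
  obtain w where "w \<in> boundary B" using nonextinct by (auto simp: without_extinction_def)
  then have "map w [0..<n] \<in> vertices B" by (simp add: boundary_def)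
  then have "map w [0..<n] \<in> tree_level B n" using vertices_level by fastforce
  then show ?thesis by blast
qed

lemma edge_to_mem: "v \<in> vertices B \<Longrightarrow> v \<noteq> [] \<Longrightarrow> edge_to v \<in> edges B"
  by (auto simp: edges_def)

lemma some_edge: "\<exists>a. a \<in> edges B"
proof -
  obtain v where v: "v \<in> tree_level B 1" using tree_level_nonempty by blast
  then have "v \<noteq> []" using tree_level_length[OF v] by auto
  then show ?thesis using v edge_to_mem tree_level_vertices by blast
qed

lemma AE_positive_env: "AE \<omega> in M. \<forall>a\<in>edges B. positive_env (\<Xi> a \<omega>)"
proof (subst AE_ball_countable)
  show "countable (edges B)" by auto
  show "\<forall>a\<in>edges B. AE \<omega> in M. positive_env (\<Xi> a \<omega>)"
  proof
    fix a assume a: "a \<in> edges B"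
    have "AE e in distr M borel (\<Xi> a). positive_env e" unfolding law[OF a] by (rule pos)
    then show "AE \<omega> in M. positive_env (\<Xi> a \<omega>)" by (rule AE_distrD[OF random_env[OF a]])
  qed
qed

sublocale positive_matrix_law \<mu>
proof (rule positive_matrix_law.intro)
  obtain a where a: "a \<in> edges B" using some_edge by blast
  have m: "(\<lambda>\<omega>. ratio_matrix (\<Xi> a \<omega>)) \<in> borel_measurable M"
    by (rule measurable_compose[OF random_env[OF a] ratio_matrix_measurable])
  show "prob_space \<mu>" using prob_space_distr[OF m] law_ratio[OF a] by simp
  show "sets \<mu> = sets borel" using law_ratio[OF a] by (metis sets_distr)
  have "AE \<omega> in M. 0 < min_entry (ratio_matrix (\<Xi> a \<omega>))"
    using AE_positive_env by eventually_elim (simp add: a ratio_matrix_pos)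
  then have "AE g in distr M borel (\<lambda>\<omega>. ratio_matrix (\<Xi> a \<omega>)). 0 < min_entry g"
    by (subst AE_distr_iff[OF m]) auto
  then show "AE g in \<mu>. 0 < min_entry g" unfolding law_ratio[OF a] .
  show "integrability_condition \<mu>" by (rule integrable)
qed

abbreviation env :: "'w \<Rightarrow> 'd environment" where
  "env \<omega> \<equiv> \<lambda>a. \<Xi> a \<omega>"

lemma env_restrict_measurable:
  assumes "J \<subseteq> edges B"
  shows "(\<lambda>\<omega>. restrict (env \<omega>) J) \<in> measurable M (PiM J (\<lambda>_. borel))"
  using assms by (intro measurable_restrict random_env) auto

lemma path_prod_restrict: "path_prod (restrict e (path_edges v i k)) v i k = path_prod e v i k"
  by (rule path_prod_cong) auto

lemma path_prod_rv [measurable]: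
  assumes "v \<in> vertices B" "i + k \<le> length v"
  shows "(\<lambda>\<omega>. path_prod (env \<omega>) v i k) \<in> borel_measurable M"
  using measurable_compose[OF env_restrict_measurable[OF path_edges_subset[OF assms]]
      path_prod_measurable[OF subset_refl]]
  by (simp add: path_prod_restrict)

text \<open>The convolution power appends its factors on the right, as the path does with its edges.\<close>

lemma distr_path_prod:
  assumes v: "v \<in> vertices B"
  shows "i + k \<le> length v \<Longrightarrow> distr M borel (\<lambda>\<omega>. path_prod (env \<omega>) v i k) = convolution_power \<mu> k"
proof (induction k)
  case 0
  show ?case by (simp add: distr_const)
next
  case (Suc k)
  let ?u = "take (Suc (i + k)) v"
  let ?A = "path_edges v i k" and ?E = "{edge_to ?u}"
  let ?X = "\<lambda>\<omega>. path_prod (env \<omega>) v i k" and ?Y = "\<lambda>\<omega>. step_matrix (env \<omega>) ?u"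
  have le: "i + k \<le> length v" using Suc.prems by simp
  have u: "?u \<in> vertices B" "?u \<noteq> []" using take_vertices[OF v] Suc.prems by auto
  have uE: "edge_to ?u \<in> edges B" by (rule edge_to_mem[OF u])
  have disj: "?A \<inter> ?E = {}"
  proof (rule ccontr)
    assume "?A \<inter> ?E \<noteq> {}"
    then obtain l where l: "l < i + k" "edge_to (take (Suc l) v) = edge_to ?u"
      by (auto simp: path_edges_def)
    then have "length (take (Suc l) v) = length ?u" using injD[OF edge_to_inj] by metis
    then show False using l(1) Suc.prems by simp
  qed
  have "indep_var (PiM ?A (\<lambda>_. borel)) (\<lambda>\<omega>. restrict (env \<omega>) ?A) (PiM ?E (\<lambda>_. borel)) (\<lambda>\<omega>. restrict (env \<omega>) ?E)"
    by (rule indep_var_restrict[OF indep disj]) (use path_edges_subset[OF v le] uE in auto)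
  moreover have "(\<lambda>e. step_matrix e ?u) \<in> borel_measurable (PiM ?E (\<lambda>_. borel :: 'd env measure))"
    using measurable_compose[OF measurable_component_singleton[of "edge_to ?u" ?E] ratio_matrix_measurable]
    by (simp add: step_matrix_def)
  ultimately have "indep_var borel ((\<lambda>e. path_prod e v i k) \<circ> (\<lambda>\<omega>. restrict (env \<omega>) ?A))
      borel ((\<lambda>e. step_matrix e ?u) \<circ> (\<lambda>\<omega>. restrict (env \<omega>) ?E))"
    by (intro indep_var_compose[OF _ path_prod_measurable[OF subset_refl]])
  then have iv: "indep_var borel ?X borel ?Y"
    by (simp add: comp_def path_prod_restrict step_matrix_def)
  have Y: "distr M borel ?Y = \<mu>" using law_ratio[OF uE] by (simp add: step_matrix_def)
  have rv: "(\<lambda>\<omega>. (?X \<omega>, ?Y \<omega>)) \<in> measurable M (borel \<Otimes>\<^sub>M borel)"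
    by (intro measurable_Pair indep_var_rv1[OF iv] indep_var_rv2[OF iv])
  have "distr M (borel \<Otimes>\<^sub>M borel) (\<lambda>\<omega>. (?X \<omega>, ?Y \<omega>)) = convolution_power \<mu> k \<Otimes>\<^sub>M \<mu>"
    using iv unfolding indep_var_distribution_eq Suc.IH[OF le] Y by simp
  then have "distr (convolution_power \<mu> k \<Otimes>\<^sub>M \<mu>) borel (\<lambda>(g, h). g ** h) =
      distr M borel ((\<lambda>(g, h). g ** h) \<circ> (\<lambda>\<omega>. (?X \<omega>, ?Y \<omega>)))"
    using distr_distr[OF matrix_mult_measurable rv] by simp
  then show ?case by (simp add: comp_def)
qed

text \<open>A block is indexed by its lower end, which determines its edges.\<close>

definition block :: "nat \<Rightarrow> vertex \<Rightarrow> 'w \<Rightarrow> real^'d^'d" where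
  "block k w \<omega> = path_prod (env \<omega>) w (length w - k) k"

abbreviation block_edges :: "nat \<Rightarrow> vertex \<Rightarrow> edge set" where
  "block_edges k w \<equiv> path_edges w (length w - k) k"

lemma block_rv [measurable]: "w \<in> vertices B \<Longrightarrow> k \<le> length w \<Longrightarrow> block k w \<in> borel_measurable M"
  unfolding block_def using path_prod_rv[of w "length w - k" k] by simp

text \<open>Blocks without common edges depend on disjoint parts of the environment.\<close>

lemma prob_blocks:
  assumes J: "finite J" "J \<subseteq> vertices B" "\<And>w. w \<in> J \<Longrightarrow> k \<le> length w"
    and disj: "disjoint_family_on (block_edges k) J" and A: "A \<in> sets borel"
  shows "prob {\<omega> \<in> space M. \<forall>w\<in>J. block k w \<omega> \<in> A} = measure (convolution_power \<mu> k) A ^ card J"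
proof (cases "J = {}")
  case True
  then show ?thesis by (simp add: prob_space)
next
  case False
  have "indep_vars (\<lambda>w. PiM (block_edges k w) (\<lambda>_. borel)) (\<lambda>w \<omega>. restrict (env \<omega>) (block_edges k w)) J"
    using J by (intro indep_vars_restrict[OF indep _ disj] path_edges_subset) auto
  then have "indep_vars (\<lambda>_. borel)
      (\<lambda>w \<omega>. path_prod (restrict (env \<omega>) (block_edges k w)) w (length w - k) k) J"
    by (rule indep_vars_compose2) (rule path_prod_measurable[OF subset_refl])
  then have iv: "indep_vars (\<lambda>_. borel) (block k) J"
    unfolding block_def path_prod_restrict .
  have "prob {\<omega> \<in> space M. \<forall>w\<in>J. block k w \<omega> \<in> A} = prob (\<Inter>w\<in>J. block k w -` A \<inter> space M)"
    using False by (intro arg_cong[where f = prob]) auto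
  also have "\<dots> = (\<Prod>w\<in>J. prob (block k w -` A \<inter> space M))"
    by (rule indep_varsD_finite[OF iv False J(1)]) (rule A)
  also have "\<dots> = (\<Prod>w\<in>J. measure (convolution_power \<mu> k) A)"
  proof (intro prod.cong refl)
    fix w assume w: "w \<in> J"
    then have "distr M borel (block k w) = convolution_power \<mu> k"
      unfolding block_def using J by (intro distr_path_prod) auto
    then have "measure (convolution_power \<mu> k) A = measure (distr M borel (block k w)) A" by simp
    also have "\<dots> = prob (block k w -` A \<inter> space M)"
      using w J A by (intro measure_distr block_rv) auto
    finally show "prob (block k w -` A \<inter> space M) = measure (convolution_power \<mu> k) A" by simp
  qed
  finally show ?thesis by simp
qed

end

section \<open>Percolation of blocks\<close>

lemma Max_common_block:
  fixes P :: "nat \<Rightarrow> bool"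
  assumes "P 0"
  obtains j where "j \<le> n" "P j" "\<And>i. j < i \<Longrightarrow> i \<le> n \<Longrightarrow> \<not> P i"
proof -
  let ?S = "{j. j \<le> n \<and> P j}"
  have f: "finite ?S" "?S \<noteq> {}" using assms by auto
  have m: "Max ?S \<in> ?S" using f by (rule Max_in)
  have none: "\<not> P i" if i: "Max ?S < i" "i \<le> n" for i
  proof
    assume "P i"
    then have "i \<le> Max ?S" using i(2) by (intro Max_ge f) simp
    with i(1) show False by simp
  qed
  show thesis
  proof (rule that)
    show "Max ?S \<le> n" "P (Max ?S)" using m by blast+
  qed (rule none)
qed

locale block_percolation = random_environment +
  fixes k n0 :: nat and t :: real
  assumes k: "0 < k"
begin

definition block_end :: "vertex \<Rightarrow> nat \<Rightarrow> vertex" where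
  "block_end v i = take (n0 + Suc i * k) v"

definition p :: real where
  "p = measure (convolution_power \<mu> k) {g. t \<le> min_entry g}"

definition block_open :: "vertex \<Rightarrow> nat \<Rightarrow> 'a \<Rightarrow> bool" where
  "block_open v i \<omega> \<longleftrightarrow> t \<le> min_entry (block k (block_end v i) \<omega>)"

lemma p_le_1: "p \<le> 1"
proof -
  interpret C: prob_space "convolution_power \<mu> k" by (rule convolution_prob_space)
  show ?thesis unfolding p_def by (rule C.prob_le_1)
qed

lemma p_nonneg: "0 \<le> p"
  by (simp add: p_def)

lemma block_le: "i < n \<Longrightarrow> n0 + Suc i * k \<le> n0 + n * k"
  by (metis Suc_leI add_left_mono mult_le_mono1)

lemma block_end_properties:
  assumes v: "v \<in> tree_level B (n0 + n * k)" and i: "i < n"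
  shows "block_end v i \<in> vertices B" "length (block_end v i) = n0 + Suc i * k"
    "block_edges k (block_end v i) = (\<lambda>l. edge_to (take (Suc l) v)) ` {n0 + i * k..<n0 + Suc i * k}"
proof -
  have le: "n0 + Suc i * k \<le> length v" using tree_level_length[OF v] block_le[OF i] by simp
  show "block_end v i \<in> vertices B"
    unfolding block_end_def using tree_level_vertices[OF v] by (rule take_vertices)
  show len: "length (block_end v i) = n0 + Suc i * k" using le by (simp add: block_end_def)
  then show "block_edges k (block_end v i) = (\<lambda>l. edge_to (take (Suc l) v)) ` {n0 + i * k..<n0 + Suc i * k}"
    unfolding path_edges_def by (intro image_cong) (auto simp: block_end_def min_def)
qed

text \<open>Edges are determined by their lower ends, so two blocks with a common edge are in the same
  generation and their paths agree at least up to its beginning.\<close>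

lemma block_edges_disjoint:
  assumes v: "v \<in> tree_level B (n0 + n * k)" "v' \<in> tree_level B (n0 + n * k)"
    and i: "i < n" "i' < n" and ne: "i \<noteq> i' \<or> take (n0 + i * k) v \<noteq> take (n0 + i * k) v'"
  shows "block_edges k (block_end v i) \<inter> block_edges k (block_end v' i') = {}"
proof (rule ccontr)
  assume "\<not> ?thesis"
  then obtain a where a: "a \<in> block_edges k (block_end v i)" "a \<in> block_edges k (block_end v' i')" by blast
  obtain l where l1: "l \<in> {n0 + i * k..<n0 + Suc i * k}" "a = edge_to (take (Suc l) v)"
    using a(1) unfolding block_end_properties(3)[OF v(1) i(1)] by (rule imageE)
  obtain l' where l2: "l' \<in> {n0 + i' * k..<n0 + Suc i' * k}" "a = edge_to (take (Suc l') v')"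
    using a(2) unfolding block_end_properties(3)[OF v(2) i(2)] by (rule imageE)
  have l: "n0 + i * k \<le> l" "l < n0 + Suc i * k" "n0 + i' * k \<le> l'" "l' < n0 + Suc i' * k"
    using l1(1) l2(1) by auto
  have "edge_to (take (Suc l) v) = edge_to (take (Suc l') v')" using l1(2) l2(2) by simp
  then have eq: "take (Suc l) v = take (Suc l') v'" using injD[OF edge_to_inj] by metis
  have "Suc l \<le> length v" "Suc l' \<le> length v'"
    using l block_le[OF i(1)] block_le[OF i(2)] tree_level_length[OF v(1)] tree_level_length[OF v(2)] by linarith+
  then have ll: "l = l'" using arg_cong[OF eq, of length] by simp
  have "i * k < Suc i' * k" "i' * k < Suc i * k" using l ll by linarith+
  then have "i < Suc i'" "i' < Suc i" by (simp_all only: mult_less_cancel2)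
  then have "i = i'" by simp
  moreover have "take (n0 + i * k) v = take (n0 + i * k) v'"
  proof -
    have "take (n0 + i * k) (take (Suc l) v) = take (n0 + i * k) (take (Suc l) v')" using eq ll by simp
    then show ?thesis using l(1) by (simp add: min_def split: if_splits)
  qed
  ultimately show False using ne by simp
qed

lemma block_open_event:
  assumes "v \<in> tree_level B (n0 + n * k)" "i < n"
  shows "{\<omega> \<in> space M. block_open v i \<omega>} \<in> sets M"
proof -
  have "k \<le> n0 + Suc i * k" by simp
  then have "block k (block_end v i) \<in> borel_measurable M"
    using block_end_properties(1,2)[OF assms] by (intro block_rv) auto
  then show ?thesis unfolding block_open_def by measurable
qed

text \<open>The blocks \<open>I\<close> on the path to \<open>v\<close> and the blocks \<open>I'\<close> on the path to \<open>v'\<close> have no common edge, if the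
  paths have separated before each of the blocks \<open>I'\<close>.\<close>

lemma prob_pair_open:
  assumes v: "v \<in> tree_level B (n0 + n * k)" "v' \<in> tree_level B (n0 + n * k)"
    and I: "I \<subseteq> {..<n}" "I' \<subseteq> {..<n}"
    and ne: "\<And>i. i \<in> I' \<Longrightarrow> take (n0 + i * k) v \<noteq> take (n0 + i * k) v'"
  shows "prob {\<omega> \<in> space M. (\<forall>i\<in>I. block_open v i \<omega>) \<and> (\<forall>i\<in>I'. block_open v' i \<omega>)} = p ^ (card I + card I')"
proof -
  have fin: "finite I" "finite I'" using I by (auto intro: finite_subset)
  let ?J = "block_end v ` I \<union> block_end v' ` I'"
  have lenv: "length (block_end v i) = n0 + Suc i * k" if "i \<in> I" for i
    using block_end_properties(2)[OF v(1)] that I by auto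
  have lenv': "length (block_end v' i) = n0 + Suc i * k" if "i \<in> I'" for i
    using block_end_properties(2)[OF v(2)] that I by auto
  have inj: "inj_on (block_end v) I"
    by (rule inj_onI) (metis (no_types) lenv add_left_cancel k less_irrefl mult_cancel2 nat.inject)
  have inj': "inj_on (block_end v') I'"
    by (rule inj_onI) (metis (no_types) lenv' add_left_cancel k less_irrefl mult_cancel2 nat.inject)
  have sep: "block_edges k (block_end v i) \<inter> block_edges k (block_end v' i') = {}" if "i \<in> I" "i' \<in> I'" for i i'
    using that I ne[of i'] by (intro block_edges_disjoint[OF v]) auto
  have sep1: "block_edges k (block_end v i) \<inter> block_edges k (block_end v i') = {}" if "i \<in> I" "i' \<in> I" "i \<noteq> i'" for i i'
    using that I by (intro block_edges_disjoint[OF v(1) v(1)]) auto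
  have sep2: "block_edges k (block_end v' i) \<inter> block_edges k (block_end v' i') = {}" if "i \<in> I'" "i' \<in> I'" "i \<noteq> i'" for i i'
    using that I by (intro block_edges_disjoint[OF v(2) v(2)]) auto
  have nonempty: "block_edges k (block_end v i) \<noteq> {}" if "i \<in> I" for i
    using that k by (simp add: path_edges_def)
  have "block_end v ` I \<inter> block_end v' ` I' = {}"
    using sep nonempty by fastforce
  then have card: "card ?J = card I + card I'"
    using fin inj inj' by (simp add: card_Un_disjoint card_image)
  have "disjoint_family_on (block_edges k) ?J"
    unfolding disjoint_family_on_def
  proof (intro ballI impI)
    fix a b assume ab: "a \<in> ?J" "b \<in> ?J" "a \<noteq> b"
    consider (1) i i' where "a = block_end v i" "b = block_end v i'" "i \<in> I" "i' \<in> I"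
      | (2) i i' where "a = block_end v i" "b = block_end v' i'" "i \<in> I" "i' \<in> I'"
      | (3) i i' where "a = block_end v' i" "b = block_end v i'" "i \<in> I'" "i' \<in> I"
      | (4) i i' where "a = block_end v' i" "b = block_end v' i'" "i \<in> I'" "i' \<in> I'"
      using ab(1,2) by blast
    then show "block_edges k a \<inter> block_edges k b = {}"
    proof cases
      case 1
      then show ?thesis using sep1 ab(3) by metis
    next
      case 2
      then show ?thesis using sep by simp
    next
      case 3
      then show ?thesis using sep by (simp add: Int_commute)
    next
      case 4
      then show ?thesis using sep2 ab(3) by metis
    qed
  qed
  moreover have "?J \<subseteq> vertices B"
    using block_end_properties(1)[OF v(1)] block_end_properties(1)[OF v(2)] I by auto
  moreover have "k \<le> length w" if "w \<in> ?J" for w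
    using that lenv lenv' by auto
  moreover have "{g :: real^'b^'b. t \<le> min_entry g} \<in> sets borel" by measurable
  ultimately have "prob {\<omega> \<in> space M. \<forall>w\<in>?J. block k w \<omega> \<in> {g. t \<le> min_entry g}} = p ^ card ?J"
    unfolding p_def using fin by (intro prob_blocks) auto
  moreover have "{\<omega> \<in> space M. \<forall>w\<in>?J. block k w \<omega> \<in> {g. t \<le> min_entry g}} =
      {\<omega> \<in> space M. (\<forall>i\<in>I. block_open v i \<omega>) \<and> (\<forall>i\<in>I'. block_open v' i \<omega>)}"
    by (auto simp: block_open_def)
  ultimately show ?thesis using card by simp
qed

definition path_open :: "nat \<Rightarrow> vertex \<Rightarrow> 'a \<Rightarrow> bool" where
  "path_open n v \<omega> \<longleftrightarrow> (\<forall>i<n. block_open v i \<omega>)"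

lemma path_open_event:
  "v \<in> tree_level B (n0 + n * k) \<Longrightarrow> {\<omega> \<in> space M. path_open n v \<omega>} \<in> sets M"
  unfolding path_open_def
  using block_open_event by (intro sets.sets_Collect_finite_All[of "{..<n}", simplified lessThan_iff Ball_def]) auto

lemma prob_path_open:
  assumes "v \<in> tree_level B (n0 + n * k)"
  shows "prob {\<omega> \<in> space M. path_open n v \<omega>} = p ^ n"
  using prob_pair_open[OF assms assms, of "{..<n}" "{}"] by (simp add: path_open_def lessThan_iff Ball_def)

text \<open>Two paths that separate within the block \<open>j\<close> share the blocks before it and are independent after
  it.  In the block \<open>j\<close> itself they may share some edges, so it is left out; hence the exponent
  \<open>j + 2\<close>.  Bounding the maximal \<open>j\<close> by the sum over all \<open>j\<close> makes the bound easy to sum over pairs.\<close>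

lemma prob_both_open_le:
  assumes p: "0 < p" and v: "v \<in> tree_level B (n0 + n * k)" "v' \<in> tree_level B (n0 + n * k)"
  shows "prob {\<omega> \<in> space M. path_open n v \<omega> \<and> path_open n v' \<omega>} \<le>
    p ^ (2 * n) * (1 + (\<Sum>j\<le>n. if take (n0 + j * k) v = take (n0 + j * k) v' then (1 / p) ^ (j + 2) else 0))"
    (is "prob ?E \<le> _ * (1 + ?S)")
proof (cases "take n0 v = take n0 v'")
  case False
  have "take (n0 + i * k) v \<noteq> take (n0 + i * k) v'" for i
  proof
    assume "take (n0 + i * k) v = take (n0 + i * k) v'"
    then have "take n0 (take (n0 + i * k) v) = take n0 (take (n0 + i * k) v')" by simp
    with False show False by (simp add: min_def split: if_splits)
  qed
  then have "prob ?E = p ^ (2 * n)"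
    using prob_pair_open[OF v, of "{..<n}" "{..<n}"] by (simp add: path_open_def mult_2 Ball_def)
  also have "\<dots> \<le> p ^ (2 * n) * (1 + ?S)"
    using p by (auto intro!: mult_left_mono[of 1, simplified] sum_nonneg)
  finally show ?thesis .
next
  case True
  then obtain j where j: "j \<le> n" "take (n0 + j * k) v = take (n0 + j * k) v'"
    "\<And>i. j < i \<Longrightarrow> i \<le> n \<Longrightarrow> take (n0 + i * k) v \<noteq> take (n0 + i * k) v'"
    using Max_common_block[of "\<lambda>j. take (n0 + j * k) v = take (n0 + j * k) v'" n] by auto
  let ?I = "{..<n} - {j}" and ?I' = "{j<..<n}"
  have "prob ?E \<le> prob {\<omega> \<in> space M. (\<forall>i\<in>?I. block_open v i \<omega>) \<and> (\<forall>i\<in>?I'. block_open v' i \<omega>)}"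
  proof (rule finite_measure_mono)
    have "{\<omega> \<in> space M. \<forall>i\<in>I. block_open u i \<omega>} \<in> sets M" if "u \<in> tree_level B (n0 + n * k)" "I \<subseteq> {..<n}" for u I
      using that block_open_event finite_subset[OF that(2)]
      by (intro sets.sets_Collect_finite_All) auto
    then show "{\<omega> \<in> space M. (\<forall>i\<in>?I. block_open v i \<omega>) \<and> (\<forall>i\<in>?I'. block_open v' i \<omega>)} \<in> sets M"
      using v by (intro sets.sets_Collect_conj) (auto simp: subset_eq)
  qed (auto simp: path_open_def)
  also have "\<dots> = p ^ (card ?I + card ?I')"
    using j(3) by (intro prob_pair_open[OF v]) auto
  also have "\<dots> \<le> p ^ (2 * n) * (1 / p) ^ (j + 2)"
  proof -
    have c: "2 * n \<le> card ?I + card ?I' + (j + 2)"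
      using j(1) by (cases "j < n") auto
    have "p ^ (card ?I + card ?I' + (j + 2)) \<le> p ^ (2 * n)"
      using p p_le_1 by (intro power_decreasing c) auto
    then show ?thesis using p by (simp add: power_add power_one_over field_simps)
  qed
  also have "(1 / p) ^ (j + 2) \<le> ?S"
    using member_le_sum[of j "{..n}" "\<lambda>j. if take (n0 + j * k) v = take (n0 + j * k) v' then (1 / p) ^ (j + 2) else 0"]
      j(1,2) p by simp
  also have "p ^ (2 * n) * ?S \<le> p ^ (2 * n) * (1 + ?S)" using p by (intro mult_left_mono) auto
  finally show ?thesis using p by (simp add: mult_left_mono)
qed

text \<open>Chebyshev's inequality for the open part of a flow.  Pairs of paths that separate before
  generation \<open>n0\<close> are independent and do not contribute to the variance.  Pairs that agree up to
  generation \<open>n0 + j k\<close> carry mass at most \<open>\<alpha>\<close> to the power \<open>- n0 - j k\<close>, against a factor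
  \<open>p\<close> to the power \<open>- j\<close>; since \<open>p \<alpha>\<^sup>k > 1\<close>, the sum over \<open>j\<close> is geometric.\<close>

lemma open_flow_large:
  fixes m :: "vertex \<Rightarrow> real"
  assumes p: "0 < p" and \<alpha>: "1 < \<alpha>" "1 < p * \<alpha> ^ k" and c: "0 < c"
    and m: "c \<le> m []" "\<And>v. 0 \<le> m v" "\<And>v. length v \<le> n0 + n * k \<Longrightarrow> m v \<le> (1 / \<alpha>) ^ length v"
      "\<And>v. length v < n0 + n * k \<Longrightarrow> (\<Sum>x\<in>{1..B v}. m (v @ [x])) = m v"
  defines "Z \<equiv> \<lambda>\<omega>. \<Sum>v\<in>tree_level B (n0 + n * k). m v * of_bool (path_open n v \<omega>)"
  shows "Z \<in> borel_measurable M"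
    "prob {\<omega> \<in> space M. Z \<omega> < p ^ n * c / 2} \<le> 4 / (p\<^sup>2 * (1 - 1 / (p * \<alpha> ^ k)) * c) * (1 / \<alpha>) ^ n0"
proof -
  let ?L = "tree_level B (n0 + n * k)" and ?N = "n0 + n * k"
  define r where "r = 1 / (p * \<alpha> ^ k)"
  have r: "0 < r" "r < 1" using p \<alpha> by (auto simp: r_def)
  define C where "C = 1 / (p\<^sup>2 * (1 - r))"
  have C: "0 < C" using p r by (simp add: C_def)
  have ind: "of_bool (path_open n v \<omega>) = indicator {\<omega> \<in> space M. path_open n v \<omega>} \<omega>"
    if "\<omega> \<in> space M" for v \<omega> using that by (simp add: indicator_def)
  have rv: "(\<lambda>\<omega>. of_bool (path_open n v \<omega>) :: real) \<in> borel_measurable M" if "v \<in> ?L" for v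
    using path_open_event[OF that] by (subst measurable_cong[OF ind]) auto
  show Zm: "Z \<in> borel_measurable M"
    unfolding Z_def using rv by (intro borel_measurable_sum borel_measurable_times) auto
  have level: "(\<Sum>v\<in>?L. m v) = m []"
    using flow_level_sum[OF m(4), where j = 0 and n = ?N and u = "[]"] by (simp add: tree_level_0)
  have level_j: "(\<Sum>u\<in>tree_level B j. m u) = m []" if "j \<le> ?N" for j
    using flow_level_sum[OF m(4), where j = 0 and n = j and u = "[]"] that by (simp add: tree_level_0)
  have int1: "integrable M (\<lambda>\<omega>. of_bool (path_open n v \<omega>) :: real)" if "v \<in> ?L" for v
    by (rule integrable_const_bound[of _ 1]) (use rv[OF that] in auto)
  have E1: "(\<integral>\<omega>. of_bool (path_open n v \<omega>) \<partial>M) = p ^ n" if "v \<in> ?L" for v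
  proof -
    have "(\<integral>\<omega>. of_bool (path_open n v \<omega>) \<partial>M) = (\<integral>\<omega>. (indicator {\<omega> \<in> space M. path_open n v \<omega>} \<omega> :: real) \<partial>M)"
      by (intro Bochner_Integration.integral_cong refl ind)
    then show ?thesis using path_open_event[OF that] prob_path_open[OF that] by simp
  qed
  have EZ: "expectation Z = p ^ n * m []"
    unfolding Z_def
    using int1 E1 by (simp add: integrable_mult_right level[symmetric] sum_distrib_left mult.commute)
  have Z0: "0 \<le> Z \<omega>" for \<omega> unfolding Z_def using m(2) by (intro sum_nonneg) auto
  have int2: "integrable M (\<lambda>\<omega>. of_bool (path_open n v \<omega>) * of_bool (path_open n v' \<omega>) :: real)"
    if "v \<in> ?L" "v' \<in> ?L" for v v'
    by (rule integrable_const_bound[of _ 1]) (use rv[OF that(1)] rv[OF that(2)] in auto)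
  have E2: "(\<integral>\<omega>. of_bool (path_open n v \<omega>) * of_bool (path_open n v' \<omega>) \<partial>M) =
      prob {\<omega> \<in> space M. path_open n v \<omega> \<and> path_open n v' \<omega>}" if "v \<in> ?L" "v' \<in> ?L" for v v'
  proof -
    have "(\<integral>\<omega>. of_bool (path_open n v \<omega>) * of_bool (path_open n v' \<omega>) \<partial>M) =
        (\<integral>\<omega>. (indicator {\<omega> \<in> space M. path_open n v \<omega> \<and> path_open n v' \<omega>} \<omega> :: real) \<partial>M)"
      by (intro Bochner_Integration.integral_cong refl) (auto simp: indicator_def)
    moreover have "{\<omega> \<in> space M. path_open n v \<omega> \<and> path_open n v' \<omega>} \<in> sets M"
      by (intro sets.sets_Collect_conj path_open_event that)
    ultimately show ?thesis by simp
  qed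
  have sq: "(Z \<omega>)\<^sup>2 = (\<Sum>v\<in>?L. \<Sum>v'\<in>?L. m v * m v' * (of_bool (path_open n v \<omega>) * of_bool (path_open n v' \<omega>)))" for \<omega>
    unfolding Z_def power2_eq_square sum_product by (intro sum.cong refl) (simp add: mult_ac)
  have intZ2: "integrable M (\<lambda>\<omega>. (Z \<omega>)\<^sup>2)"
    unfolding sq using int2 by (intro Bochner_Integration.integrable_sum integrable_mult_right) auto
  \<comment> \<open>The mass of the pairs with a common ancestor in generation \<open>n0 + j k\<close>.\<close>
  have common: "(\<Sum>v\<in>?L. \<Sum>v'\<in>?L. if take (n0 + j * k) v = take (n0 + j * k) v' then m v * m v' else 0)
      \<le> (1 / \<alpha>) ^ (n0 + j * k) * m []" if j: "j \<le> n" for j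
  proof -
    let ?j = "n0 + j * k"
    have jN: "?j \<le> ?N" using j by simp
    have fibre: "(\<Sum>v | v \<in> ?L \<and> take ?j v = u. m v) = m u" if "u \<in> tree_level B ?j" for u
      using that jN by (intro flow_level_sum[OF m(4)]) auto
    have "(\<Sum>v\<in>?L. \<Sum>v'\<in>?L. if take ?j v = take ?j v' then m v * m v' else 0) =
        (\<Sum>v\<in>?L. m v * m (take ?j v))"
    proof (intro sum.cong refl)
      fix v assume v: "v \<in> ?L"
      have "(\<Sum>v'\<in>?L. if take ?j v = take ?j v' then m v * m v' else 0) =
          (\<Sum>v' | v' \<in> ?L \<and> take ?j v' = take ?j v. m v * m v')"
        by (simp add: sum.inter_filter[symmetric] finite_tree_level eq_commute)
      also have "\<dots> = m v * m (take ?j v)"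
        using fibre[OF tree_level_take[OF v jN]] by (simp add: sum_distrib_left[symmetric])
      finally show "(\<Sum>v'\<in>?L. if take ?j v = take ?j v' then m v * m v' else 0) = m v * m (take ?j v)" .
    qed
    also have "\<dots> \<le> (\<Sum>v\<in>?L. m v * (1 / \<alpha>) ^ ?j)"
    proof (intro sum_mono mult_left_mono m(2))
      fix v assume v: "v \<in> ?L"
      have "length (take ?j v) = ?j" using tree_level_length[OF tree_level_take[OF v jN]] .
      then show "m (take ?j v) \<le> (1 / \<alpha>) ^ ?j" using m(3)[of "take ?j v"] jN by simp
    qed
    also have "\<dots> = (\<Sum>v\<in>?L. m v) * (1 / \<alpha>) ^ ?j"
      by (rule sum_distrib_right[symmetric])
    also have "\<dots> = (1 / \<alpha>) ^ ?j * m []"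
      unfolding level by (rule mult.commute)
    finally show ?thesis .
  qed
  have "expectation (\<lambda>\<omega>. (Z \<omega>)\<^sup>2) = (\<Sum>v\<in>?L. \<Sum>v'\<in>?L. m v * m v' *
      prob {\<omega> \<in> space M. path_open n v \<omega> \<and> path_open n v' \<omega>})"
    unfolding sq using int2 E2 by (simp add: Bochner_Integration.integral_sum integrable_mult_right)
  also have "\<dots> \<le> (\<Sum>v\<in>?L. \<Sum>v'\<in>?L. m v * m v' * (p ^ (2 * n) * (1 + (\<Sum>j\<le>n.
      if take (n0 + j * k) v = take (n0 + j * k) v' then (1 / p) ^ (j + 2) else 0))))"
    using m(2) by (intro sum_mono mult_left_mono prob_both_open_le p) auto
  also have "\<dots> = p ^ (2 * n) * ((\<Sum>v\<in>?L. \<Sum>v'\<in>?L. m v * m v') + (\<Sum>j\<le>n. (1 / p) ^ (j + 2) *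
      (\<Sum>v\<in>?L. \<Sum>v'\<in>?L. if take (n0 + j * k) v = take (n0 + j * k) v' then m v * m v' else 0)))"
  proof -
    have 1: "m v * m v' * (p ^ (2 * n) * (1 + (\<Sum>j\<le>n.
        if take (n0 + j * k) v = take (n0 + j * k) v' then (1 / p) ^ (j + 2) else 0))) =
      p ^ (2 * n) * (m v * m v') + p ^ (2 * n) * (\<Sum>j\<le>n. (1 / p) ^ (j + 2) *
        (if take (n0 + j * k) v = take (n0 + j * k) v' then m v * m v' else 0))" for v v'
    proof -
      have X: "m v * m v' * (\<Sum>j\<le>n. if take (n0 + j * k) v = take (n0 + j * k) v' then (1 / p) ^ (j + 2) else 0) =
          (\<Sum>j\<le>n. (1 / p) ^ (j + 2) * (if take (n0 + j * k) v = take (n0 + j * k) v' then m v * m v' else 0))"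
        unfolding sum_distrib_left by (intro sum.cong refl) auto
      have Y: "a * (P * (1 + S)) = P * a + P * (a * S)" for a P S :: real
        by (simp add: algebra_simps)
      show ?thesis unfolding Y X ..
    qed
    have 2: "(\<Sum>v\<in>?L. \<Sum>v'\<in>?L. \<Sum>j\<le>n. f j v v') = (\<Sum>j\<le>n. \<Sum>v\<in>?L. \<Sum>v'\<in>?L. f j v v')"
      for f :: "nat \<Rightarrow> vertex \<Rightarrow> vertex \<Rightarrow> real"
    proof -
      have "(\<Sum>v\<in>?L. \<Sum>v'\<in>?L. \<Sum>j\<le>n. f j v v') = (\<Sum>v\<in>?L. \<Sum>j\<le>n. \<Sum>v'\<in>?L. f j v v')"
        by (intro sum.cong refl) (rule sum.swap)
      also have "\<dots> = (\<Sum>j\<le>n. \<Sum>v\<in>?L. \<Sum>v'\<in>?L. f j v v')" by (rule sum.swap)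
      finally show ?thesis .
    qed
    have 3: "(\<Sum>v\<in>?L. \<Sum>v'\<in>?L. P * a v v' + P * (\<Sum>j\<le>n. w j * T j v v')) =
        P * ((\<Sum>v\<in>?L. \<Sum>v'\<in>?L. a v v') + (\<Sum>j\<le>n. w j * (\<Sum>v\<in>?L. \<Sum>v'\<in>?L. T j v v')))"
      for P :: real and w :: "nat \<Rightarrow> real" and a :: "vertex \<Rightarrow> vertex \<Rightarrow> real" and T
    proof -
      have "(\<Sum>v\<in>?L. \<Sum>v'\<in>?L. P * a v v' + P * (\<Sum>j\<le>n. w j * T j v v')) =
          P * (\<Sum>v\<in>?L. \<Sum>v'\<in>?L. a v v' + (\<Sum>j\<le>n. w j * T j v v'))"
        by (simp add: sum_distrib_left distrib_left)
      also have "\<dots> = P * ((\<Sum>v\<in>?L. \<Sum>v'\<in>?L. a v v') + (\<Sum>v\<in>?L. \<Sum>v'\<in>?L. \<Sum>j\<le>n. w j * T j v v'))"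
        by (simp add: sum.distrib)
      also have "\<dots> = P * ((\<Sum>v\<in>?L. \<Sum>v'\<in>?L. a v v') + (\<Sum>j\<le>n. \<Sum>v\<in>?L. \<Sum>v'\<in>?L. w j * T j v v'))"
        unfolding 2 ..
      also have "\<dots> = P * ((\<Sum>v\<in>?L. \<Sum>v'\<in>?L. a v v') + (\<Sum>j\<le>n. w j * (\<Sum>v\<in>?L. \<Sum>v'\<in>?L. T j v v')))"
        by (simp add: sum_distrib_left)
      finally show ?thesis .
    qed
    show ?thesis unfolding 1 by (rule 3)
  qed
  also have "\<dots> \<le> p ^ (2 * n) * ((m [])\<^sup>2 + C * (1 / \<alpha>) ^ n0 * m [])"
  proof (intro mult_left_mono add_mono)
    show "(\<Sum>v\<in>?L. \<Sum>v'\<in>?L. m v * m v') \<le> (m [])\<^sup>2"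
      unfolding sum_product[symmetric] level power2_eq_square by simp
    have "(\<Sum>j\<le>n. (1 / p) ^ (j + 2) *
        (\<Sum>v\<in>?L. \<Sum>v'\<in>?L. if take (n0 + j * k) v = take (n0 + j * k) v' then m v * m v' else 0))
      \<le> (\<Sum>j\<le>n. (1 / p) ^ (j + 2) * ((1 / \<alpha>) ^ (n0 + j * k) * m []))"
      using p by (intro sum_mono mult_left_mono common) auto
    also have "\<dots> = (1 / p)\<^sup>2 * (1 / \<alpha>) ^ n0 * m [] * (\<Sum>j\<le>n. r ^ j)"
      unfolding sum_distrib_left
    proof (intro sum.cong refl)
      fix j
      have "r ^ j = (1 / p) ^ j * (1 / \<alpha>) ^ (j * k)"
        by (simp add: r_def power_divide power_mult_distrib power_mult mult.commute[of j])
      then show "(1 / p) ^ (j + 2) * ((1 / \<alpha>) ^ (n0 + j * k) * m []) = (1 / p)\<^sup>2 * (1 / \<alpha>) ^ n0 * m [] * r ^ j"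
        by (simp only: power_add mult_ac)
    qed
    also have "\<dots> \<le> (1 / p)\<^sup>2 * (1 / \<alpha>) ^ n0 * m [] * (1 / (1 - r))"
    proof (intro mult_left_mono)
      have "(\<Sum>j\<le>n. r ^ j) = (1 - r ^ Suc n) / (1 - r)"
        using r by (simp add: sum_gp0)
      also have "\<dots> \<le> 1 / (1 - r)" using r by (intro divide_right_mono) auto
      finally show "(\<Sum>j\<le>n. r ^ j) \<le> 1 / (1 - r)" .
    qed (use p \<alpha> m in auto)
    also have "\<dots> = C * (1 / \<alpha>) ^ n0 * m []" by (simp add: C_def power_one_over)
    finally show "(\<Sum>j\<le>n. (1 / p) ^ (j + 2) *
        (\<Sum>v\<in>?L. \<Sum>v'\<in>?L. if take (n0 + j * k) v = take (n0 + j * k) v' then m v * m v' else 0))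
      \<le> C * (1 / \<alpha>) ^ n0 * m []" .
  qed (use p in auto)
  finally have EZ2: "expectation (\<lambda>\<omega>. (Z \<omega>)\<^sup>2) \<le> p ^ (2 * n) * ((m [])\<^sup>2 + C * (1 / \<alpha>) ^ n0 * m [])" .
  have intZ: "integrable M Z"
    unfolding Z_def using int1 by (intro Bochner_Integration.integrable_sum integrable_mult_right) auto
  have m0: "0 < m []" using c m(1) by simp
  have var: "variance Z \<le> p ^ (2 * n) * (C * (1 / \<alpha>) ^ n0 * m [])"
    using EZ2 by (subst variance_eq[OF intZ intZ2])
      (simp add: EZ power_mult_distrib power_mult[symmetric] mult.commute algebra_simps)
  let ?a = "p ^ n * m [] / 2"
  have a: "0 < ?a" using p m0 by simp
  have "prob {\<omega> \<in> space M. Z \<omega> < p ^ n * c / 2} \<le> prob {\<omega> \<in> space M. ?a \<le> \<bar>Z \<omega> - expectation Z\<bar>}"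
  proof (rule finite_measure_mono)
    show "{\<omega> \<in> space M. Z \<omega> < p ^ n * c / 2} \<subseteq> {\<omega> \<in> space M. ?a \<le> \<bar>Z \<omega> - expectation Z\<bar>}"
    proof safe
      fix \<omega> assume "Z \<omega> < p ^ n * c / 2"
      also have "p ^ n * c / 2 \<le> ?a" using p m(1) by simp
      finally have "?a \<le> p ^ n * m [] - Z \<omega>" by linarith
      then show "?a \<le> \<bar>Z \<omega> - expectation Z\<bar>" unfolding EZ by linarith
    qed
  qed (use Zm in measurable)
  also have "\<dots> \<le> variance Z / ?a\<^sup>2"
    using intZ2 a by (intro Chebyshev_inequality Zm) auto
  also have "\<dots> \<le> p ^ (2 * n) * (C * (1 / \<alpha>) ^ n0 * m []) / ?a\<^sup>2"
    using var by (intro divide_right_mono) auto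
  also have "\<dots> = 4 * C * (1 / \<alpha>) ^ n0 / m []"
    using p m0 by (simp add: power2_eq_square power_mult field_simps)
  also have "\<dots> \<le> 4 * C * (1 / \<alpha>) ^ n0 / c"
    using m(1) c C \<alpha> by (intro divide_left_mono) auto
  also have "\<dots> = 4 / (p\<^sup>2 * (1 - 1 / (p * \<alpha> ^ k)) * c) * (1 / \<alpha>) ^ n0"
    by (simp add: C_def r_def)
  finally show "prob {\<omega> \<in> space M. Z \<omega> < p ^ n * c / 2} \<le>
      4 / (p\<^sup>2 * (1 - 1 / (p * \<alpha> ^ k)) * c) * (1 / \<alpha>) ^ n0" .
qed

end

section \<open>Divergence of the mass\<close>

lemma path_prod_nonneg_pos:
  assumes "\<And>l. i \<le> l \<Longrightarrow> l < i + k \<Longrightarrow> 0 < min_entry (step_matrix e (take (Suc l) v))"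
  shows "nonneg_entries (path_prod e v i k)" "0 < k \<Longrightarrow> 0 < min_entry (path_prod e v i k)"
proof -
  have "nonneg_entries (path_prod e v i k) \<and> (0 < k \<longrightarrow> 0 < min_entry (path_prod e v i k))"
    using assms
  proof (induction k)
    case 0
    then show ?case by (simp add: nonneg_entries_mat_1)
  next
    case (Suc k)
    let ?g = "path_prod e v i k" and ?h = "step_matrix e (take (Suc (i + k)) v)"
    have IH: "nonneg_entries ?g" "0 < k \<longrightarrow> 0 < min_entry ?g" using Suc by auto
    have h: "0 < min_entry ?h" by (rule Suc.prems) auto
    have "0 < min_entry (path_prod e v i (Suc k))"
    proof (cases "k = 0")
      case False
      then have "0 < min_entry ?g * min_entry ?h" using IH h by simp
      also have "\<dots> \<le> min_entry (?g ** ?h)"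
        using IH h by (intro min_entry_mult) (auto simp: nonneg_entries_iff_min_entry)
      finally show ?thesis by simp
    qed (use h in simp)
    then show ?case by (simp add: nonneg_entries_iff_min_entry)
  qed
  then show "nonneg_entries (path_prod e v i k)" "0 < k \<Longrightarrow> 0 < min_entry (path_prod e v i k)" by auto
qed

definition level_mass :: "(vertex \<Rightarrow> nat) \<Rightarrow> ('d::finite) environment \<Rightarrow> nat \<Rightarrow> real" where
  "level_mass B e n = (\<Sum>v\<in>tree_level B n. entry_sum (path_prod e v 0 n))"

context random_environment
begin

lemma step_matrix_pos:
  assumes "\<forall>a\<in>edges B. positive_env (\<Xi> a \<omega>)" "v \<in> vertices B" "v \<noteq> []"
  shows "0 < min_entry (step_matrix (env \<omega>) v)"
  unfolding step_matrix_def using assms edge_to_mem by (intro ratio_matrix_pos) auto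

lemma path_prod_pos:
  assumes "\<forall>a\<in>edges B. positive_env (\<Xi> a \<omega>)" "v \<in> vertices B" "i + k \<le> length v"
  shows "nonneg_entries (path_prod (env \<omega>) v i k)" "0 < k \<Longrightarrow> 0 < min_entry (path_prod (env \<omega>) v i k)"
proof -
  have *: "0 < min_entry (step_matrix (env \<omega>) (take (Suc l) v))" if "i \<le> l" "l < i + k" for l
  proof (rule step_matrix_pos[OF assms(1)])
    show "take (Suc l) v \<in> vertices B" by (rule take_vertices[OF assms(2)])
    show "take (Suc l) v \<noteq> []" using that assms(3) by auto
  qed
  show "nonneg_entries (path_prod (env \<omega>) v i k)" "0 < k \<Longrightarrow> 0 < min_entry (path_prod (env \<omega>) v i k)"
    using path_prod_nonneg_pos[of i k "env \<omega>" v] * by auto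
qed

end

context block_percolation
begin

lemma path_prod_open_ge:
  assumes pos: "\<forall>a\<in>edges B. positive_env (\<Xi> a \<omega>)" and v: "v \<in> tree_level B (n0 + N * k)"
    and b: "0 < b" "b \<le> min_entry (path_prod (env \<omega>) v 0 n0)" and t: "0 < t"
  shows "n \<le> N \<Longrightarrow> \<forall>i<n. block_open v i \<omega> \<Longrightarrow> b * t ^ n \<le> min_entry (path_prod (env \<omega>) v 0 (n0 + n * k))"
proof (induction n)
  case 0
  then show ?case using b by simp
next
  case (Suc n)
  let ?g = "path_prod (env \<omega>) v 0 (n0 + n * k)" and ?h = "path_prod (env \<omega>) v (n0 + n * k) k"
  have le: "n0 + Suc n * k \<le> n0 + N * k" using Suc.prems(1) by (intro block_le) auto
  then have len: "n0 + n * k + k \<le> length v" using tree_level_length[OF v] by simp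
  have g: "nonneg_entries ?g"
    using len by (intro path_prod_pos(1)[OF pos tree_level_vertices[OF v]]) auto
  have h: "nonneg_entries ?h"
    using len by (intro path_prod_pos(1)[OF pos tree_level_vertices[OF v]]) auto
  have "?h = block k (block_end v n) \<omega>"
  proof -
    have "length (block_end v n) = n0 + Suc n * k"
      using block_end_properties(2)[OF v, of n] Suc.prems by simp
    then show ?thesis unfolding block_def block_end_def by (simp add: path_prod_take)
  qed
  then have t: "t \<le> min_entry ?h" using Suc.prems(2) by (simp add: block_open_def)
  have "b * t ^ Suc n = (b * t ^ n) * t" by simp
  also have "\<dots> \<le> min_entry ?g * min_entry ?h"
    using Suc t b(1) \<open>0 < t\<close> g by (intro mult_mono) (auto simp: nonneg_entries_iff_min_entry)
  also have "\<dots> \<le> min_entry (?g ** ?h)" by (intro min_entry_mult g h)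
  also have "?g ** ?h = path_prod (env \<omega>) v 0 (n0 + Suc n * k)"
    using path_prod_add[of "env \<omega>" v 0 "n0 + n * k" k] by (simp add: add_ac)
  finally show ?case .
qed

text \<open>If the open flow is not small, then by the bound on the flow there are at least of order
  \<open>(p \<alpha>\<^sup>k)\<^sup>n\<close> open paths, and each of them has entries of order \<open>t\<^sup>n\<close>.  As \<open>t p \<alpha>\<^sup>k > 1\<close>, the level mass
  is then bounded below.  So in an environment of finite mass the open flow is small at all late
  generations, and each single one of these events is unlikely.\<close>

lemma finite_mass_unlikely:
  assumes t: "0 < t" "t \<le> 1" and \<alpha>: "1 < \<alpha>" "1 < t * \<alpha> ^ k * p" and c: "0 < c" and n0: "0 < n0"
    and flow: "\<And>N. \<exists>m :: vertex \<Rightarrow> real. c \<le> m [] \<and> (\<forall>v. 0 \<le> m v) \<and>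
       (\<forall>v. length v \<le> N \<longrightarrow> m v \<le> (1 / \<alpha>) ^ length v) \<and>
       (\<forall>v. length v < N \<longrightarrow> (\<Sum>x\<in>{1..B v}. m (v @ [x])) = m v)"
  obtains E where "E \<in> sets M" "prob E \<le> 4 / (p\<^sup>2 * (1 - 1 / (p * \<alpha> ^ k)) * c) * (1 / \<alpha>) ^ n0"
    "\<And>\<omega>. \<omega> \<in> space M \<Longrightarrow> \<forall>a\<in>edges B. positive_env (\<Xi> a \<omega>) \<Longrightarrow> summable (level_mass B (env \<omega>)) \<Longrightarrow> \<omega> \<in> E"
proof -
  have p: "0 < p"
  proof (rule ccontr)
    assume "\<not> 0 < p"
    then have "p = 0" using p_nonneg by simp
    then show False using \<alpha>(2) by simp
  qed
  have tp: "t * (\<alpha> ^ k * p) \<le> 1 * (\<alpha> ^ k * p)" using t p \<alpha> by (intro mult_right_mono) auto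
  then have p\<alpha>: "1 < p * \<alpha> ^ k" using \<alpha>(2) by (simp add: mult_ac)
  obtain m where M: "\<forall>N. c \<le> m N [] \<and> (\<forall>v. 0 \<le> m N v) \<and>
       (\<forall>v. length v \<le> N \<longrightarrow> m N v \<le> (1 / \<alpha>) ^ length v) \<and>
       (\<forall>v. length v < N \<longrightarrow> (\<Sum>x\<in>{1..B v}. m N (v @ [x])) = m N v)"
    using choice[OF allI[OF flow]] by (rule exE)
  have m: "c \<le> m N []" "0 \<le> m N v" "length v \<le> N \<Longrightarrow> m N v \<le> (1 / \<alpha>) ^ length v"
    "length v < N \<Longrightarrow> (\<Sum>x\<in>{1..B v}. m N (v @ [x])) = m N v" for N v
    using M[THEN spec[of _ N]] by simp_all
  define Z where "Z n \<omega> = (\<Sum>v\<in>tree_level B (n0 + n * k). m (n0 + n * k) v * of_bool (path_open n v \<omega>))" for n \<omega>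
  define A where "A n = {\<omega> \<in> space M. Z n \<omega> < p ^ n * c / 2}" for n
  let ?\<epsilon> = "4 / (p\<^sup>2 * (1 - 1 / (p * \<alpha> ^ k)) * c) * (1 / \<alpha>) ^ n0"
  have Zm: "Z n \<in> borel_measurable M" for n
    unfolding Z_def by (rule open_flow_large(1)[OF p \<alpha>(1) p\<alpha> c]) (use m in auto)
  have PA: "prob (A n) \<le> ?\<epsilon>" for n
    unfolding A_def Z_def by (rule open_flow_large(2)[OF p \<alpha>(1) p\<alpha> c]) (use m in auto)
  have Am: "A n \<in> sets M" for n unfolding A_def using Zm by measurable
  define I where "I j = (\<Inter>n\<in>{j..}. A n)" for j
  have Im: "I j \<in> sets M" for j unfolding I_def using Am by (intro sets.countable_INT') auto
  have PI: "prob (I j) \<le> ?\<epsilon>" for j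
    using PA[of j] by (rule order_trans[rotated]) (auto simp: I_def Am intro: finite_measure_mono)
  have "(\<lambda>j. prob (I j)) \<longlonglongrightarrow> prob (\<Union>j. I j)"
    using Im by (intro finite_Lim_measure_incseq) (auto simp: incseq_def I_def)
  then have PE: "prob (\<Union>j. I j) \<le> ?\<epsilon>"
    using PI by (intro LIMSEQ_le_const2) auto
  show thesis
  proof (rule that[OF _ PE])
    show "(\<Union>j. I j) \<in> sets M" using Im by auto
    fix \<omega> assume \<omega>: "\<omega> \<in> space M" and pos: "\<forall>a\<in>edges B. positive_env (\<Xi> a \<omega>)"
      and sum: "summable (level_mass B (env \<omega>))"
    \<comment> \<open>The first \<open>n0\<close> generations need not be open, but they have positive products, finitely many in number.\<close>
    define b where "b = Min ((\<lambda>u. min_entry (path_prod (env \<omega>) u 0 n0)) ` tree_level B n0)"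
    have b: "0 < b"
      unfolding b_def using finite_tree_level tree_level_nonempty n0
      by (subst Min_gr_iff) (auto simp: tree_level_length tree_level_vertices intro!: path_prod_pos(2)[OF pos])
    have b_le: "b \<le> min_entry (path_prod (env \<omega>) v 0 n0)" if "v \<in> tree_level B (n0 + n * k)" for v n
    proof -
      have "take n0 v \<in> tree_level B n0" using that by (rule tree_level_take) simp
      then have "b \<le> min_entry (path_prod (env \<omega>) (take n0 v) 0 n0)"
        unfolding b_def using finite_tree_level by (intro Min_le) auto
      then show ?thesis by (simp add: path_prod_take)
    qed
    define x where "x = b * \<alpha> ^ n0 * c / 2"
    have x: "0 < x" using b \<alpha> c by (simp add: x_def)
    have large: "x \<le> level_mass B (env \<omega>) (n0 + n * k)" if "\<omega> \<notin> A n" for n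
    proof -
      let ?L = "tree_level B (n0 + n * k)"
      have Z: "p ^ n * c / 2 \<le> Z n \<omega>" using that \<omega> by (simp add: A_def)
      have "x = b * \<alpha> ^ n0 * (1 * (c / 2))" by (simp add: x_def)
      also have "\<dots> \<le> b * \<alpha> ^ n0 * ((t * \<alpha> ^ k * p) ^ n * (c / 2))"
        using b \<alpha> c by (intro mult_left_mono mult_right_mono one_le_power) auto
      also have "\<dots> = b * t ^ n * \<alpha> ^ (n0 + n * k) * (p ^ n * c / 2)"
        by (simp add: power_mult_distrib power_add power_mult[symmetric] mult_ac)
      also have "\<dots> \<le> b * t ^ n * \<alpha> ^ (n0 + n * k) * Z n \<omega>"
        using b t \<alpha> by (intro mult_left_mono Z) auto
      also have "\<dots> = (\<Sum>v\<in>?L. b * t ^ n * (\<alpha> ^ (n0 + n * k) * m (n0 + n * k) v) * of_bool (path_open n v \<omega>))"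
        unfolding Z_def sum_distrib_left by (simp add: mult_ac)
      also have "\<dots> \<le> (\<Sum>v\<in>?L. entry_sum (path_prod (env \<omega>) v 0 (n0 + n * k)))"
      proof (rule sum_mono)
        fix v assume v: "v \<in> ?L"
        have nn: "nonneg_entries (path_prod (env \<omega>) v 0 (n0 + n * k))"
          using tree_level_length[OF v] by (intro path_prod_pos(1)[OF pos tree_level_vertices[OF v]]) simp
        show "b * t ^ n * (\<alpha> ^ (n0 + n * k) * m (n0 + n * k) v) * of_bool (path_open n v \<omega>)
          \<le> entry_sum (path_prod (env \<omega>) v 0 (n0 + n * k))"
        proof (cases "path_open n v \<omega>")
          case True
          have "m (n0 + n * k) v \<le> (1 / \<alpha>) ^ (n0 + n * k)"
            using m(3)[of v "n0 + n * k"] tree_level_length[OF v] by simp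
          then have "\<alpha> ^ (n0 + n * k) * m (n0 + n * k) v \<le> 1"
            using \<alpha> by (simp add: power_one_over field_simps)
          then have "b * t ^ n * (\<alpha> ^ (n0 + n * k) * m (n0 + n * k) v) \<le> b * t ^ n * 1"
            using b t by (intro mult_left_mono) auto
          also have "\<dots> \<le> min_entry (path_prod (env \<omega>) v 0 (n0 + n * k))"
            using path_prod_open_ge[OF pos v b b_le[OF v] t(1), of n] True by (simp add: path_open_def)
          also have "\<dots> \<le> entry_sum (path_prod (env \<omega>) v 0 (n0 + n * k))"
            by (rule min_entry_le_entry_sum[OF nn])
          finally show ?thesis using True by simp
        next
          case False
          then show ?thesis using nn unfolding entry_sum_def nonneg_entries_def by (simp add: sum_nonneg)
        qed
      qed
      finally show ?thesis by (simp add: level_mass_def)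
    qed
    have "level_mass B (env \<omega>) \<longlonglongrightarrow> 0" using sum by (rule summable_LIMSEQ_zero)
    then have "\<forall>\<^sub>F n in sequentially. level_mass B (env \<omega>) n < x" using x by (rule order_tendstoD)
    then obtain j where j: "\<And>n. j \<le> n \<Longrightarrow> level_mass B (env \<omega>) n < x"
      by (auto simp: eventually_sequentially)
    have "\<omega> \<in> A n" if "j \<le> n" for n
    proof (rule ccontr)
      assume "\<omega> \<notin> A n"
      then have "x \<le> level_mass B (env \<omega>) (n0 + n * k)" by (rule large)
      moreover have "n * 1 \<le> n * k" using k by (intro mult_le_mono2) simp
      then have "j \<le> n0 + n * k" using that by linarith
      then have "level_mass B (env \<omega>) (n0 + n * k) < x" by (rule j)
      ultimately show False by simp
    qed
    then show "\<omega> \<in> (\<Union>j. I j)" by (auto simp: I_def)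
  qed
qed

end

context random_environment
begin

text \<open>The bound for a fixed \<open>n0\<close> holds with the same constants for all \<open>n0\<close>, so the limit \<open>n0 \<rightarrow> \<infinity>\<close> gives
  probability 0.\<close>

lemma infinite_mass:
  assumes large: "1 < min_moment_rate \<mu> * branching_rate B"
  shows "AE \<omega> in M. \<not> summable (level_mass B (env \<omega>))"
proof -
  let ?l = "min_moment_rate \<mu>" and ?dim = "hausdorff_dim boundary_dist (boundary B)"
  have l: "0 < ?l" "?l \<le> 1"
    using min_moment_rate_pos min_moment_rate_le[of 0] moment_rate_0 by auto
  have br: "1 / ?l < branching_rate B" using large l by (simp add: divide_less_eq mult.commute)
  define \<alpha> where "\<alpha> = (1 / ?l + branching_rate B) / 2"
  have \<alpha>: "1 / ?l < \<alpha>" "\<alpha> < branching_rate B" using br by (auto simp: \<alpha>_def)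
  have inv: "1 \<le> 1 / ?l" using l by simp
  then have \<alpha>1: "1 < \<alpha>" using \<alpha> by linarith
  have l\<alpha>: "1 < ?l * \<alpha>" using \<alpha>(1) l by (simp add: divide_less_eq mult.commute)
  have "ln \<alpha> < real_of_ereal ?dim"
  proof -
    have "exp (ln \<alpha>) < exp (real_of_ereal ?dim)"
      using \<alpha>(2) \<alpha>1 unfolding branching_rate_def by simp
    then show ?thesis by (simp only: exp_less_cancel_iff)
  qed
  moreover have "0 < ln \<alpha>" using \<alpha>1 by simp
  ultimately have dim: "ereal (ln \<alpha>) < ?dim"
    by (cases ?dim) auto
  obtain c where c: "0 < c"
    "\<And>N. \<exists>m :: vertex \<Rightarrow> real. c \<le> m [] \<and> (\<forall>v. 0 \<le> m v) \<and>
       (\<forall>v. length v \<le> N \<longrightarrow> m v \<le> (1 / \<alpha>) ^ length v) \<and>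
       (\<forall>v. length v < N \<longrightarrow> (\<Sum>x\<in>{1..B v}. m (v @ [x])) = m v)"
    using flow_exists[OF \<alpha>1 dim] by blast
  obtain k t where kt: "0 < k" "0 < t" "t \<le> 1"
    "1 < t * \<alpha> ^ k * measure (convolution_power \<mu> k) {g. t \<le> min_entry g}"
    using percolation_parameters[of \<alpha>] \<alpha>1 l\<alpha> by auto
  let ?p = "measure (convolution_power \<mu> k) {g. t \<le> min_entry g}"
  let ?C = "4 / (?p\<^sup>2 * (1 - 1 / (?p * \<alpha> ^ k)) * c)"
  have "\<exists>E. E \<in> sets M \<and> prob E \<le> ?C * (1 / \<alpha>) ^ Suc n \<and>
    (\<forall>\<omega>\<in>space M. (\<forall>a\<in>edges B. positive_env (\<Xi> a \<omega>)) \<longrightarrow> summable (level_mass B (env \<omega>)) \<longrightarrow> \<omega> \<in> E)" for n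
  proof -
    interpret P: block_percolation M B \<Xi> \<rho> \<mu> k "Suc n" t
      by unfold_locales (rule kt)
    have pp: "1 < t * \<alpha> ^ k * P.p" using kt unfolding P.p_def by simp
    obtain E where "E \<in> sets M" "prob E \<le> ?C * (1 / \<alpha>) ^ Suc n"
      "\<And>\<omega>. \<omega> \<in> space M \<Longrightarrow> \<forall>a\<in>edges B. positive_env (\<Xi> a \<omega>) \<Longrightarrow> summable (level_mass B (env \<omega>)) \<Longrightarrow> \<omega> \<in> E"
      using P.finite_mass_unlikely[OF kt(2,3) \<alpha>1 pp c(1) zero_less_Suc c(2)] unfolding P.p_def by blast
    then show ?thesis by blast
  qed
  from choice[OF allI[OF this]] obtain E where EE: "\<forall>n. E n \<in> sets M \<and> prob (E n) \<le> ?C * (1 / \<alpha>) ^ Suc n \<and>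
    (\<forall>\<omega>\<in>space M. (\<forall>a\<in>edges B. positive_env (\<Xi> a \<omega>)) \<longrightarrow> summable (level_mass B (env \<omega>)) \<longrightarrow> \<omega> \<in> E n)"
    by (rule exE)
  have E: "E n \<in> sets M" "prob (E n) \<le> ?C * (1 / \<alpha>) ^ Suc n"
    "\<omega> \<in> space M \<Longrightarrow> \<forall>a\<in>edges B. positive_env (\<Xi> a \<omega>) \<Longrightarrow> summable (level_mass B (env \<omega>)) \<Longrightarrow> \<omega> \<in> E n"
    for n \<omega>
    using EE[THEN spec[of _ n]] by blast+
  have NE: "(\<Inter>n. E n) \<in> sets M" using E(1) by auto
  have "prob (\<Inter>n. E n) \<le> 0"
  proof (rule LIMSEQ_le_const)
    have "(\<lambda>n. (1 / \<alpha>) ^ n) \<longlonglongrightarrow> 0" using \<alpha>1 by (intro LIMSEQ_power_zero) auto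
    then have "(\<lambda>n. (1 / \<alpha>) ^ Suc n) \<longlonglongrightarrow> 0" by (rule LIMSEQ_Suc)
    then show "(\<lambda>n. ?C * (1 / \<alpha>) ^ Suc n) \<longlonglongrightarrow> 0" by (rule tendsto_mult_right_zero)
    have "prob (\<Inter>n. E n) \<le> ?C * (1 / \<alpha>) ^ Suc n" for n
      using E(2)[of n] by (rule order_trans[rotated]) (auto intro: finite_measure_mono E(1))
    then show "\<exists>N. \<forall>n\<ge>N. prob (\<Inter>n. E n) \<le> ?C * (1 / \<alpha>) ^ Suc n" by blast
  qed
  then have "prob (\<Inter>n. E n) = 0" by (simp add: measure_le_0_iff)
  then have "(\<Inter>n. E n) \<in> null_sets M" using NE by (simp add: null_sets_def emeasure_eq_measure)
  then have "AE \<omega> in M. \<omega> \<notin> (\<Inter>n. E n)" by (rule AE_not_in)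
  with AE_positive_env AE_space show ?thesis
  proof eventually_elim
    case (elim \<omega>)
    then show ?case using E(3)[of \<omega>] by blast
  qed
qed

end

section \<open>Summability of the mass and slow cutsets\<close>

context random_environment
begin

text \<open>The moment rates are bounded away from 0, so the hypothesis forces the growth rate to be finite.\<close>

lemma growth_bound:
  assumes small: "ereal (min_moment_rate \<mu>) * upper_growth_rate B < 1"
  obtains R where "0 < R" "min_moment_rate \<mu> * R < 1"
    "\<forall>\<^sub>F n in sequentially. real (card (tree_level B n)) \<le> R ^ n"
proof -
  let ?l = "min_moment_rate \<mu>"
  have l: "0 < ?l" by (rule min_moment_rate_pos)
  have nonneg: "0 \<le> upper_growth_rate B"
    unfolding upper_growth_rate_def by (intro le_Limsup always_eventually) (auto intro: real_root_ge_zero)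
  then obtain g where g: "upper_growth_rate B = ereal g" "0 \<le> g"
    using small l by (cases "upper_growth_rate B") auto
  have lg: "?l * g < 1" using small g by simp
  define R where "R = (g + 1 / ?l) / 2"
  have gl: "g < 1 / ?l" using lg l by (simp add: less_divide_eq mult.commute)
  have R: "g < R" "R < 1 / ?l" using gl by (auto simp: R_def)
  have "limsup (\<lambda>n. ereal (root n (real (card (tree_level B n))))) < ereal R"
    using g R by (simp add: upper_growth_rate_def)
  then have "\<forall>\<^sub>F n in sequentially. ereal (root n (real (card (tree_level B n)))) < ereal R"
    by (rule Limsup_lessD)
  then have "\<forall>\<^sub>F n in sequentially. real (card (tree_level B n)) \<le> R ^ n"
    using eventually_gt_at_top[of 0]
  proof eventually_elim
    case (elim n)
    then have "root n (real (card (tree_level B n))) ^ n \<le> R ^ n"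
      by (intro power_mono) (auto intro: real_root_ge_zero)
    then show ?case using elim by simp
  qed
  moreover have "0 < R" using g R by simp
  moreover have "?l * R < 1" using R l by (simp add: less_divide_eq mult.commute)
  ultimately show thesis by (intro that)
qed

text \<open>The moment of order \<open>s \<le> 1\<close> of the norms is summable over the tree, and eventually all
  norms are below 1, where they are bounded by their \<open>s\<close>-th powers.\<close>

lemma finite_mass:
  assumes R: "0 < R" "min_moment_rate \<mu> * R < 1"
    and growth: "\<forall>\<^sub>F n in sequentially. real (card (tree_level B n)) \<le> R ^ n"
  shows "AE \<omega> in M. summable (level_mass B (env \<omega>))"
proof -
  have "min_moment_rate \<mu> < 1 / R" using R by (simp add: less_divide_eq)
  then obtain s where s: "0 \<le> s" "s \<le> 1" and ks: "moment_rate \<mu> s < 1 / R"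
    unfolding min_moment_rate_def
    by (subst (asm) cINF_less_iff) (auto intro!: bdd_belowI2[of _ c0] simp: moment_rate_properties)
  define r where "r = (moment_rate \<mu> s + 1 / R) / 2"
  have r: "moment_rate \<mu> s < r" "r < 1 / R" using ks by (auto simp: r_def)
  have r0: "0 < r" using r moment_rate_properties(2)[OF s] c0_pos by linarith
  have rR: "r * R < 1" using r R by (simp add: less_divide_eq)
  define a where "a n = enn2real (moment n s)" for n
  have am: "moment n s = ennreal (a n)" "0 \<le> a n" for n
    using moment_finite[OF s(1), of n] by (simp_all add: a_def)
  have "\<forall>\<^sub>F n in sequentially. root n (a n) < r"
    unfolding a_def by (rule order_tendstoD(2)[OF moment_rate_properties(1)[OF s] r(1)])
  then have ev: "\<forall>\<^sub>F n in sequentially. norm (real (card (tree_level B n)) * a n) \<le> (r * R) ^ n"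
    using eventually_gt_at_top[of 0] growth
  proof eventually_elim
    case (elim n)
    then have "root n (a n) ^ n \<le> r ^ n"
      using am(2) by (intro power_mono) (auto intro: real_root_ge_zero)
    then have "a n \<le> r ^ n" using elim am(2) by simp
    then have "real (card (tree_level B n)) * a n \<le> R ^ n * r ^ n"
      using elim R am(2) by (intro mult_mono) auto
    then show ?case using am(2) by (simp add: power_mult_distrib mult.commute)
  qed
  have "summable (\<lambda>n. (r * R) ^ n)" using r0 R rR by (intro summable_geometric) simp
  with ev have sum: "summable (\<lambda>n. real (card (tree_level B n)) * a n)"
    by (rule summable_comparison_test_ev)
  define T where "T n \<omega> = (\<Sum>v\<in>tree_level B n. l1_opnorm (path_prod (env \<omega>) v 0 n) powr s)" for n \<omega>
  have T0: "0 \<le> T n \<omega>" for n \<omega> unfolding T_def by (intro sum_nonneg) auto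
  have rv: "(\<lambda>\<omega>. path_prod (env \<omega>) v 0 n) \<in> borel_measurable M" if "v \<in> tree_level B n" for v n
    using tree_level_vertices[OF that] tree_level_length[OF that] by (intro path_prod_rv) auto
  have Tv: "(\<lambda>\<omega>. l1_opnorm (path_prod (env \<omega>) v 0 n) powr s) \<in> borel_measurable M" if "v \<in> tree_level B n" for v n
    using measurable_compose[OF rv[OF that] l1_opnorm_measurable] by measurable
  have Tm: "T n \<in> borel_measurable M" for n unfolding T_def using Tv by (intro borel_measurable_sum) auto
  have ET: "(\<integral>\<^sup>+ \<omega>. ennreal (T n \<omega>) \<partial>M) = ennreal (real (card (tree_level B n)) * a n)" for n
  proof -
    have "(\<integral>\<^sup>+ \<omega>. ennreal (T n \<omega>) \<partial>M) =
        (\<integral>\<^sup>+ \<omega>. (\<Sum>v\<in>tree_level B n. ennreal (l1_opnorm (path_prod (env \<omega>) v 0 n) powr s)) \<partial>M)"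
      unfolding T_def by (simp add: sum_ennreal)
    also have "\<dots> = (\<Sum>v\<in>tree_level B n. \<integral>\<^sup>+ \<omega>. ennreal (l1_opnorm (path_prod (env \<omega>) v 0 n) powr s) \<partial>M)"
      using Tv by (intro nn_integral_sum) auto
    also have "\<dots> = (\<Sum>v\<in>tree_level B n. ennreal (a n))"
    proof (intro sum.cong refl)
      fix v assume v: "v \<in> tree_level B n"
      have "(\<integral>\<^sup>+ \<omega>. ennreal (l1_opnorm (path_prod (env \<omega>) v 0 n) powr s) \<partial>M) =
          (\<integral>\<^sup>+ g. ennreal (l1_opnorm g powr s) \<partial>distr M borel (\<lambda>\<omega>. path_prod (env \<omega>) v 0 n))"
        using rv[OF v] by (subst nn_integral_distr) auto
      also have "distr M borel (\<lambda>\<omega>. path_prod (env \<omega>) v 0 n) = convolution_power \<mu> n"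
        using tree_level_vertices[OF v] tree_level_length[OF v] by (intro distr_path_prod) auto
      finally show "(\<integral>\<^sup>+ \<omega>. ennreal (l1_opnorm (path_prod (env \<omega>) v 0 n) powr s) \<partial>M) = ennreal (a n)"
        by (simp add: am(1)[symmetric] moment_def)
    qed
    also have "\<dots> = ennreal (real (card (tree_level B n)) * a n)"
      using am(2)[of n] by (simp add: ennreal_mult ennreal_of_nat_eq_real_of_nat)
    finally show ?thesis .
  qed
  have "(\<integral>\<^sup>+ \<omega>. (\<Sum>n. ennreal (T n \<omega>)) \<partial>M) = (\<Sum>n. ennreal (real (card (tree_level B n)) * a n))"
    using Tm by (subst nn_integral_suminf) (auto simp: ET)
  also have "\<dots> = ennreal (\<Sum>n. real (card (tree_level B n)) * a n)"
    using am(2) by (intro suminf_ennreal2 sum) auto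
  finally have "(\<integral>\<^sup>+ \<omega>. (\<Sum>n. ennreal (T n \<omega>)) \<partial>M) \<noteq> \<infinity>" by simp
  then have "AE \<omega> in M. (\<Sum>n. ennreal (T n \<omega>)) \<noteq> \<infinity>"
    using Tm by (intro nn_integral_PInf_AE) auto
  with AE_positive_env show ?thesis
  proof eventually_elim
    case (elim \<omega>)
    have sT: "summable (\<lambda>n. T n \<omega>)"
      using elim(2) T0 by (intro summable_suminf_not_top) auto
    then have "(\<lambda>n. T n \<omega>) \<longlonglongrightarrow> 0" by (rule summable_LIMSEQ_zero)
    then have "\<forall>\<^sub>F n in sequentially. T n \<omega> < 1" by (rule order_tendstoD) simp
    then have "\<forall>\<^sub>F n in sequentially. norm (level_mass B (env \<omega>) n) \<le> real CARD('d) * T n \<omega>"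
    proof eventually_elim
      case (elim n)
      have each: "l1_opnorm (path_prod (env \<omega>) v 0 n) \<le> l1_opnorm (path_prod (env \<omega>) v 0 n) powr s"
        if v: "v \<in> tree_level B n" for v
      proof (cases "l1_opnorm (path_prod (env \<omega>) v 0 n) = 0")
        case False
        let ?x = "l1_opnorm (path_prod (env \<omega>) v 0 n)"
        have x: "0 < ?x" using False l1_opnorm_nonneg[of "path_prod (env \<omega>) v 0 n"] by simp
        have "?x powr s \<le> T n \<omega>"
          unfolding T_def using finite_tree_level v
          by (intro member_le_sum[of v _ "\<lambda>v. l1_opnorm (path_prod (env \<omega>) v 0 n) powr s"]) auto
        then have "?x powr s < 1" using elim by simp
        then have "?x \<le> 1" using ge_one_powr_ge_zero[of ?x s] s by force
        then have "?x powr 1 \<le> ?x powr s" using x s by (intro powr_mono') auto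
        then show ?thesis using x by simp
      qed simp
      have nn: "0 \<le> entry_sum (path_prod (env \<omega>) v 0 n)" if v: "v \<in> tree_level B n" for v
      proof -
        have "nonneg_entries (path_prod (env \<omega>) v 0 n)"
          using \<open>\<forall>a\<in>edges B. positive_env (\<Xi> a \<omega>)\<close> tree_level_vertices[OF v] tree_level_length[OF v]
          by (intro path_prod_pos(1)) auto
        then show ?thesis by (auto simp: entry_sum_def nonneg_entries_def intro!: sum_nonneg)
      qed
      have "level_mass B (env \<omega>) n \<le> (\<Sum>v\<in>tree_level B n. real CARD('d) * l1_opnorm (path_prod (env \<omega>) v 0 n) powr s)"
        unfolding level_mass_def
        by (intro sum_mono order_trans[OF entry_sum_le_l1_opnorm] mult_left_mono each) auto
      also have "\<dots> = real CARD('d) * T n \<omega>" by (simp add: T_def sum_distrib_left)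
      finally show ?case using nn by (simp add: level_mass_def sum_nonneg)
    qed
    then show ?case
      using sT by (rule summable_comparison_test_ev[OF _ summable_mult])
  qed
qed

definition slow :: "real \<Rightarrow> 'd env \<Rightarrow> bool" where
  "slow K e \<longleftrightarrow> (\<forall>y. snd e $ y \<le> K)"

lemma slow_event: "{e. \<not> slow K e} \<in> sets borel"
proof -
  have [measurable]: "(\<lambda>e :: 'd env. snd e $ y) \<in> borel_measurable borel" for y
    by (intro borel_measurable_continuous_onI continuous_intros)
  show ?thesis unfolding slow_def by measurable
qed

text \<open>The downward rates are not controlled by any moment condition.  But edges with large downward
  rates are rare and so do not percolate: slow edges block every path.\<close>

lemma slow_cutsets:
  assumes R: "0 < R"
    and growth: "\<forall>\<^sub>F n in sequentially. real (card (tree_level B n)) \<le> R ^ n"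
  obtains K where "0 < K" "AE \<omega> in M. \<forall>N. \<exists>n1. \<forall>v\<in>vertices B. n1 \<le> length v \<longrightarrow>
     (\<exists>l. N \<le> l \<and> l < length v \<and> slow K (\<Xi> (edge_to (take (Suc l) v)) \<omega>))"
proof -
  obtain a where a: "a \<in> edges B" using some_edge by blast
  interpret \<rho>: prob_space \<rho>
    using prob_space_distr[OF random_env[OF a]] by (simp add: law[OF a])
  have sets_\<rho>: "sets \<rho> = sets borel" unfolding law[OF a, symmetric] by simp
  have "(\<lambda>j. measure \<rho> {e. \<not> slow (real j) e}) \<longlonglongrightarrow> measure \<rho> (\<Inter>j. {e. \<not> slow (real j) e})"
  proof (rule \<rho>.finite_Lim_measure_decseq)
    show "range (\<lambda>j. {e. \<not> slow (real j) e}) \<subseteq> sets \<rho>" using slow_event sets_\<rho> by auto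
    show "decseq (\<lambda>j. {e. \<not> slow (real j) e})"
      unfolding decseq_def slow_def by (auto intro: order_trans)
  qed
  also have "(\<Inter>j. {e. \<not> slow (real j) e}) = {}"
  proof -
    have "\<exists>j. slow (real j) e" for e :: "'d env"
    proof -
      obtain j where j: "Max (range (\<lambda>y. snd e $ y)) \<le> real j" using real_arch_simple by blast
      have "snd e $ y \<le> real j" for y
        using Max_ge[of "range (\<lambda>y. snd e $ y)" "snd e $ y"] j by simp
      then show ?thesis unfolding slow_def by blast
    qed
    then show ?thesis by auto
  qed
  finally have lim: "(\<lambda>j. measure \<rho> {e. \<not> slow (real j) e}) \<longlonglongrightarrow> 0" by simp
  have "\<forall>\<^sub>F j in sequentially. measure \<rho> {e. \<not> slow (real j) e} < 1 / (2 * R) \<and> 0 < j"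
    using order_tendstoD(2)[OF lim, of "1 / (2 * R)"] R eventually_gt_at_top[of 0]
    by (auto elim: eventually_conj)
  then obtain j where j: "measure \<rho> {e. \<not> slow (real j) e} < 1 / (2 * R)" "0 < j"
    by (auto simp: eventually_sequentially)
  define K where "K = real j"
  define p where "p = measure \<rho> {e. \<not> slow K e}"
  have p: "0 \<le> p" "p * R \<le> 1 / 2" using j R by (auto simp: p_def K_def field_simps)
  have path: "prob {\<omega> \<in> space M. \<forall>l. N \<le> l \<and> l < n \<longrightarrow> \<not> slow K (\<Xi> (edge_to (take (Suc l) v)) \<omega>)} = p ^ (n - N)
      \<and> {\<omega> \<in> space M. \<forall>l. N \<le> l \<and> l < n \<longrightarrow> \<not> slow K (\<Xi> (edge_to (take (Suc l) v)) \<omega>)} \<in> sets M"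
    if v: "v \<in> tree_level B n" and N: "N < n" for v N n
  proof -
    let ?I = "path_edges v N (n - N)"
    have IE: "?I \<subseteq> edges B"
      using tree_level_vertices[OF v] tree_level_length[OF v] N by (intro path_edges_subset) auto
    have fin: "finite ?I" "?I \<noteq> {}" using N by (auto simp: path_edges_def)
    have "inj_on (\<lambda>l. edge_to (take (Suc l) v)) {N..<N + (n - N)}"
    proof (rule inj_onI)
      fix l l' assume l: "l \<in> {N..<N + (n - N)}" "l' \<in> {N..<N + (n - N)}"
        and "edge_to (take (Suc l) v) = edge_to (take (Suc l') v)"
      then have "take (Suc l) v = take (Suc l') v" using injD[OF edge_to_inj] by blast
      then have "length (take (Suc l) v) = length (take (Suc l') v)" by simp
      then show "l = l'" using l N tree_level_length[OF v] by (simp add: min_def split: if_splits)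
    qed
    then have card: "card ?I = n - N" by (simp add: path_edges_def card_image)
    have ev: "\<Xi> a -` {e. \<not> slow K e} \<inter> space M \<in> sets M" if "a \<in> ?I" for a
      using that IE random_env by (intro measurable_sets[OF _ slow_event]) auto
    have eq: "{\<omega> \<in> space M. \<forall>l. N \<le> l \<and> l < n \<longrightarrow> \<not> slow K (\<Xi> (edge_to (take (Suc l) v)) \<omega>)} =
        (\<Inter>a\<in>?I. \<Xi> a -` {e. \<not> slow K e} \<inter> space M)"
      using fin(2) N by (auto simp: path_edges_def)
    have "prob (\<Inter>a\<in>?I. \<Xi> a -` {e. \<not> slow K e} \<inter> space M) = (\<Prod>a\<in>?I. prob (\<Xi> a -` {e. \<not> slow K e} \<inter> space M))"
      using fin IE slow_event by (intro indep_varsD[OF indep]) auto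
    also have "\<dots> = (\<Prod>a\<in>?I. p)"
    proof (intro prod.cong refl)
      fix a assume "a \<in> ?I"
      then have a: "a \<in> edges B" using IE by blast
      have "p = measure (distr M borel (\<Xi> a)) {e. \<not> slow K e}" unfolding p_def law[OF a] ..
      also have "\<dots> = prob (\<Xi> a -` {e. \<not> slow K e} \<inter> space M)"
        by (rule measure_distr[OF random_env[OF a] slow_event])
      finally show "prob (\<Xi> a -` {e. \<not> slow K e} \<inter> space M) = p" by simp
    qed
    finally have "prob (\<Inter>a\<in>?I. \<Xi> a -` {e. \<not> slow K e} \<inter> space M) = p ^ (n - N)"
      using card by simp
    moreover have "(\<Inter>a\<in>?I. \<Xi> a -` {e. \<not> slow K e} \<inter> space M) \<in> sets M"
      by (rule sets.finite_INT[OF fin ev])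
    ultimately show ?thesis unfolding eq by blast
  qed
  have "AE \<omega> in M. \<exists>n1. \<forall>v\<in>vertices B. n1 \<le> length v \<longrightarrow>
     (\<exists>l. N \<le> l \<and> l < length v \<and> slow K (\<Xi> (edge_to (take (Suc l) v)) \<omega>))" for N
  proof -
    define F where "F v n = {\<omega> \<in> space M. \<forall>l. N \<le> l \<and> l < n \<longrightarrow> \<not> slow K (\<Xi> (edge_to (take (Suc l) v)) \<omega>)}" for v n
    define A where "A n = (if N < n then \<Union>v\<in>tree_level B n. F v n else {})" for n
    have Am: "A n \<in> sets M" for n
    proof (cases "N < n")
      case True
      then have "(\<Union>v\<in>tree_level B n. F v n) \<in> sets M"
        using path unfolding F_def by (intro sets.finite_UN finite_tree_level) blast
      then show ?thesis using True by (simp add: A_def)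
    qed (simp add: A_def)
    have PA: "\<forall>\<^sub>F n in sequentially. norm (prob (A n)) \<le> R ^ N * (1 / 2) ^ (n - N)"
      using growth eventually_gt_at_top[of N]
    proof eventually_elim
      case (elim n)
      have "prob (A n) \<le> (\<Sum>v\<in>tree_level B n. prob (F v n))"
      proof -
        have "prob (\<Union>v\<in>tree_level B n. F v n) \<le> (\<Sum>v\<in>tree_level B n. prob (F v n))"
          using path elim unfolding F_def
          by (intro finite_measure_subadditive_finite finite_tree_level) blast
        then show ?thesis using elim by (simp add: A_def)
      qed
      also have "\<dots> = (\<Sum>v\<in>tree_level B n. p ^ (n - N))"
        unfolding F_def using path elim by (intro sum.cong refl) blast
      also have "\<dots> \<le> R ^ n * p ^ (n - N)" using elim p by (simp add: mult_right_mono)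
      also have "\<dots> = R ^ N * (p * R) ^ (n - N)"
        using elim by (simp add: power_mult_distrib power_add[symmetric] mult_ac)
      also have "\<dots> \<le> R ^ N * (1 / 2) ^ (n - N)"
        using p R by (intro mult_left_mono power_mono) auto
      finally show ?case by simp
    qed
    have "summable (\<lambda>n. (1 / 2 :: real) ^ n)" by (intro summable_geometric) simp
    then have "summable (\<lambda>n. (1 / 2 :: real) ^ (n + N - N))" by simp
    then have "summable (\<lambda>n. (1 / 2 :: real) ^ (n - N))" by (subst (asm) summable_iff_shift)
    then have "summable (\<lambda>n. R ^ N * (1 / 2) ^ (n - N))" by (rule summable_mult)
    with PA have "summable (\<lambda>n. prob (A n))" by (rule summable_comparison_test_ev)
    then have "AE \<omega> in M. \<forall>\<^sub>F n in sequentially. \<omega> \<in> space M - A n"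
      using Am by (intro borel_cantelli_AE1) (auto simp: emeasure_eq_measure)
    then show ?thesis
    proof eventually_elim
      case (elim \<omega>)
      then obtain n1 where n1: "\<And>n. n1 \<le> n \<Longrightarrow> \<omega> \<in> space M - A n" by (auto simp: eventually_sequentially)
      have "\<exists>l. N \<le> l \<and> l < length v \<and> slow K (\<Xi> (edge_to (take (Suc l) v)) \<omega>)"
        if v: "v \<in> vertices B" and len: "max n1 (Suc N) \<le> length v" for v
      proof (rule ccontr)
        assume neg: "\<not> ?thesis"
        have \<omega>: "\<omega> \<in> space M" "\<omega> \<notin> A (length v)" using n1[of "length v"] len by auto
        then have "\<omega> \<in> F v (length v)" using neg by (auto simp: F_def)
        then have "\<omega> \<in> A (length v)" unfolding A_def using len vertices_level[OF v] by auto
        with \<omega> show False by simp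
      qed
      then show ?case by blast
    qed
  qed
  then have "AE \<omega> in M. \<forall>N. \<exists>n1. \<forall>v\<in>vertices B. n1 \<le> length v \<longrightarrow>
     (\<exists>l. N \<le> l \<and> l < length v \<and> slow K (\<Xi> (edge_to (take (Suc l) v)) \<omega>))"
    by (subst AE_all_countable) blast
  then show thesis using j(2) by (intro that[of K]) (auto simp: K_def)
qed

end

section \<open>The bindweed model as a reversible chain\<close>

fun weight :: "('d::finite) environment \<Rightarrow> 'd state \<Rightarrow> real" where
  "weight e Special = 1"
| "weight e (At u \<sigma>) = (\<Prod>i<length u. step_matrix e (take (Suc i) u) $ (\<sigma> ! i) $ (\<sigma> ! Suc i))"

lemma weight_snoc:
  assumes "length \<sigma> = Suc (length u)"
  shows "weight e (At (u @ [c]) (\<sigma> @ [z])) = weight e (At u \<sigma>) * step_matrix e (u @ [c]) $ last \<sigma> $ z"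
proof -
  have \<sigma>: "\<sigma> \<noteq> []" using assms by auto
  have "(\<Prod>i<length u. step_matrix e (take (Suc i) (u @ [c])) $ ((\<sigma> @ [z]) ! i) $ ((\<sigma> @ [z]) ! Suc i)) = weight e (At u \<sigma>)"
    unfolding weight.simps using assms by (intro prod.cong refl) (auto simp: nth_append)
  then show ?thesis using assms \<sigma> by (simp add: nth_append last_conv_nth)
qed

lemma At_mem_state_space: "At u \<sigma> \<in> state_space B \<longleftrightarrow> u \<in> vertices B \<and> length \<sigma> = Suc (length u)"
  by (auto simp: state_space_def)

lemma Special_mem_state_space: "Special \<in> state_space B"
  by (simp add: state_space_def)

lemma vertices_snoc: "u @ [c] \<in> vertices B \<longleftrightarrow> u \<in> vertices B \<and> c \<in> {1..B u}"
proof
  assume "u @ [c] \<in> vertices B"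
  then have "u @ [c] \<in> tree_level B (Suc (length u))" using vertices_level by fastforce
  then show "u \<in> vertices B \<and> c \<in> {1..B u}" unfolding tree_level_snoc using tree_level_vertices by blast
next
  assume "u \<in> vertices B \<and> c \<in> {1..B u}"
  then have "u @ [c] \<in> tree_level B (Suc (length u))" unfolding tree_level_snoc using vertices_level by blast
  then show "u @ [c] \<in> vertices B" by (rule tree_level_vertices)
qed

lemma Nil_vertices: "[] \<in> vertices B"
  by (rule tree_level_vertices[of _ _ 0]) (simp add: tree_level_0)

fun parent :: "'d state \<Rightarrow> 'd state" where
  "parent Special = Special"
| "parent (At v \<tau>) = (if v = [] then Special else At (butlast v) (butlast \<tau>))"

lemma state_cases:
  assumes "x \<in> state_space B"
  obtains (special) "x = Special" | (root) s where "x = At [] [s]"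
    | (child) u c \<sigma> z where "x = At (u @ [c]) (\<sigma> @ [z])" "At u \<sigma> \<in> state_space B" "c \<in> {1..B u}"
proof (cases x)
  case (At v \<tau>)
  then have v: "v \<in> vertices B" "length \<tau> = Suc (length v)" using assms by (auto simp: At_mem_state_space)
  show ?thesis
  proof (cases v rule: rev_cases)
    case Nil
    then obtain s where "\<tau> = [s]" using v(2) by (auto simp: length_Suc_conv)
    then show ?thesis using At Nil root by simp
  next
    case (snoc u c)
    obtain \<sigma> z where \<tau>: "\<tau> = \<sigma> @ [z]" using v(2) by (cases \<tau> rule: rev_cases) auto
    show ?thesis
    proof (rule child)
      show "x = At (u @ [c]) (\<sigma> @ [z])" using At snoc \<tau> by simp
      show "At u \<sigma> \<in> state_space B" "c \<in> {1..B u}"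
        using v snoc \<tau> vertices_snoc[of u c B] by (auto simp: At_mem_state_space)
    qed
  qed
qed (rule special)

text \<open>The chain only moves between a state and its parent, which makes it reversible.\<close>

lemma jump_rate_neighbours:
  assumes x: "x \<in> state_space B" and y: "y \<in> state_space B" and q: "jump_rate e x y \<noteq> 0"
  shows "(y \<noteq> Special \<and> parent y = x) \<or> (x \<noteq> Special \<and> parent x = y)"
  using q by (cases x; cases y) (auto split: if_splits)

lemma rate_down:
  assumes "At u \<sigma> \<in> state_space B"
  shows "jump_rate e (At u \<sigma>) (At (u @ [c]) (\<sigma> @ [z])) = fst (e (edge_to (u @ [c]))) $ last \<sigma> $ z"
    "jump_rate e (At (u @ [c]) (\<sigma> @ [z])) (At u \<sigma>) = snd (e (edge_to (u @ [c]))) $ z"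
  using assms by (auto simp: At_mem_state_space dest: arg_cong[where f = length])

locale positive_environment =
  fixes B :: "vertex \<Rightarrow> nat" and e :: "('d::finite) environment"
  assumes pos_env: "\<And>a. a \<in> edges B \<Longrightarrow> positive_env (e a)"
begin

lemma pos_edge: "u \<in> vertices B \<Longrightarrow> c \<in> {1..B u} \<Longrightarrow> positive_env (e (edge_to (u @ [c])))"
  using vertices_snoc[of u c B] by (intro pos_env) (auto simp: edges_def)

lemma parent_mem: "x \<in> state_space B \<Longrightarrow> parent x \<in> state_space B"
  by (erule state_cases) (auto simp: Special_mem_state_space)

lemma rate_pos:
  assumes x: "x \<in> state_space B" "x \<noteq> Special"
  shows "0 < jump_rate e (parent x) x" "0 < jump_rate e x (parent x)"
proof -
  have "0 < jump_rate e (parent x) x \<and> 0 < jump_rate e x (parent x)"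
    using x(1)
  proof (cases rule: state_cases)
    case (child u c \<sigma> z)
    then have "u \<in> vertices B" by (simp add: At_mem_state_space)
    then have "positive_env (e (edge_to (u @ [c])))" using child(3) by (rule pos_edge)
    then show ?thesis using child rate_down[OF child(2), of e c z]
      by (simp add: positive_env_def del: jump_rate.simps)
  qed (use x in auto)
  then show "0 < jump_rate e (parent x) x" "0 < jump_rate e x (parent x)" by auto
qed

lemma rate_nonneg: "x \<in> state_space B \<Longrightarrow> y \<in> state_space B \<Longrightarrow> 0 \<le> jump_rate e x y"
  using jump_rate_neighbours[of x B y e] rate_pos[of x] rate_pos[of y]
  by (cases "jump_rate e x y = 0") (auto intro: less_imp_le)

lemma weight_pos: "x \<in> state_space B \<Longrightarrow> 0 < weight e x"
proof (cases x)
  case (At u \<sigma>)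
  assume x: "x \<in> state_space B"
  have "0 < step_matrix e (take (Suc i) u) $ a $ b" if "i < length u" for i a b
  proof -
    have "take (Suc i) u \<in> vertices B" using x At take_vertices by (auto simp: At_mem_state_space)
    then have "positive_env (e (edge_to (take (Suc i) u)))"
      using that by (intro pos_env) (auto simp: edges_def)
    then show ?thesis by (simp add: step_matrix_def ratio_matrix_def positive_env_def)
  qed
  then show ?thesis using At by (auto intro!: prod_pos)
qed simp

lemma weight_parent:
  assumes x: "x \<in> state_space B" "x \<noteq> Special"
  shows "weight e (parent x) * jump_rate e (parent x) x = weight e x * jump_rate e x (parent x)"
  using x(1)
proof (cases rule: state_cases)
  case (child u c \<sigma> z)
  have u: "u \<in> vertices B" "length \<sigma> = Suc (length u)" using child(2) by (auto simp: At_mem_state_space)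
  have "snd (e (edge_to (u @ [c]))) $ z \<noteq> 0"
    using pos_edge[OF u(1) child(3)] by (simp add: positive_env_def) (metis less_irrefl)
  then show ?thesis
    using child weight_snoc[OF u(2), of e c z] rate_down[OF child(2), of e c z]
    by (simp add: step_matrix_def ratio_matrix_def del: jump_rate.simps weight.simps)
qed (use x in auto)

lemma finite_children:
  fixes x :: "'d state"
  shows "finite {y \<in> state_space B. y \<noteq> Special \<and> parent y = x}"
proof (cases x)
  case Special
  have "{y \<in> state_space B. y \<noteq> Special \<and> parent y = x} \<subseteq> range (\<lambda>s. At [] [s])"
  proof
    fix y assume y: "y \<in> {y \<in> state_space B. y \<noteq> Special \<and> parent y = x}"
    then have "y \<in> state_space B" by simp
    then show "y \<in> range (\<lambda>s. At [] [s])"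
      by (cases rule: state_cases) (use y Special in auto)
  qed
  then show ?thesis by (rule finite_subset) simp
next
  case (At u \<sigma>)
  have "{y \<in> state_space B. y \<noteq> Special \<and> parent y = x} \<subseteq>
      (\<lambda>(c, z). At (u @ [c]) (\<sigma> @ [z])) ` ({1..B u} \<times> UNIV)"
  proof
    fix y assume y: "y \<in> {y \<in> state_space B. y \<noteq> Special \<and> parent y = x}"
    then have "y \<in> state_space B" by simp
    then show "y \<in> (\<lambda>(c, z). At (u @ [c]) (\<sigma> @ [z])) ` ({1..B u} \<times> UNIV)"
      by (cases rule: state_cases) (use y At in auto)
  qed
  then show ?thesis by (rule finite_subset) simp
qed

sublocale chain: reversible_chain "state_space B" "bindweed_rate B e" "weight e"
proof
  fix x :: "'d state" assume x: "x \<in> state_space B"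
  show "0 \<le> bindweed_rate B e x y" for y
    using rate_nonneg x by (simp add: bindweed_rate_def)
  have "{y. bindweed_rate B e x y \<noteq> 0} \<subseteq> insert (parent x) {y \<in> state_space B. y \<noteq> Special \<and> parent y = x}"
  proof
    fix y :: "'d state" assume "y \<in> {y. bindweed_rate B e x y \<noteq> 0}"
    then have "y \<in> state_space B" "jump_rate e x y \<noteq> 0"
      by (auto simp: bindweed_rate_def split: if_splits)
    then show "y \<in> insert (parent x) {y \<in> state_space B. y \<noteq> Special \<and> parent y = x}"
      using jump_rate_neighbours[OF x, of y e] by auto
  qed
  then show "finite {y. bindweed_rate B e x y \<noteq> 0}"
    by (rule finite_subset) (simp add: finite_children)
  show "y \<in> state_space B" if "bindweed_rate B e x y \<noteq> 0" for y
    using that by (simp add: bindweed_rate_def split: if_splits)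
  show "\<exists>y. bindweed_rate B e x y \<noteq> 0"
  proof (cases "x = Special")
    case True
    have "At [] [undefined] \<in> state_space B" by (simp add: At_mem_state_space Nil_vertices)
    then have "bindweed_rate B e x (At [] [undefined]) \<noteq> 0"
      using True by (simp add: bindweed_rate_def Special_mem_state_space)
    then show ?thesis by blast
  next
    case False
    then have "bindweed_rate B e x (parent x) \<noteq> 0"
      using rate_pos(2)[OF x False] parent_mem[OF x] x by (simp add: bindweed_rate_def)
    then show ?thesis by blast
  qed
  show "0 < weight e x" using x by (rule weight_pos)
next
  fix x y :: "'d state" assume x: "x \<in> state_space B" and y: "y \<in> state_space B"
  show "weight e x * bindweed_rate B e x y = weight e y * bindweed_rate B e y x"
  proof (cases "jump_rate e x y = 0 \<and> jump_rate e y x = 0")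
    case False
    then consider "y \<noteq> Special" "parent y = x" | "x \<noteq> Special" "parent x = y"
      using jump_rate_neighbours[OF x y] jump_rate_neighbours[OF y x] by blast
    then show ?thesis
      using weight_parent[OF x] weight_parent[OF y] x y by cases (auto simp: bindweed_rate_def)
  qed (simp add: bindweed_rate_def)
qed

definition states_at :: "nat \<Rightarrow> 'd state set" where
  "states_at n = (\<lambda>(u, \<sigma>). At u \<sigma>) ` (tree_level B n \<times> {\<sigma>. length \<sigma> = Suc n})"

lemma finite_words: "finite {\<sigma> :: 'd list. length \<sigma> = n}"
  using finite_lists_length_eq[of "UNIV :: 'd set" n] by simp

lemma finite_states_at: "finite (states_at n)"
  unfolding states_at_def by (intro finite_imageI finite_cartesian_product finite_tree_level finite_words)

lemma sum_words_Suc: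
  fixes f :: "'d list \<Rightarrow> real"
  shows "(\<Sum>\<sigma> | length \<sigma> = Suc n. f \<sigma>) = (\<Sum>\<sigma> | length \<sigma> = n. \<Sum>y\<in>UNIV. f (\<sigma> @ [y]))"
proof -
  have "{\<sigma> :: 'd list. length \<sigma> = Suc n} = (\<lambda>(\<sigma>, y). \<sigma> @ [y]) ` ({\<sigma>. length \<sigma> = n} \<times> UNIV)"
  proof (intro set_eqI iffI)
    fix \<sigma> :: "'d list" assume "\<sigma> \<in> {\<sigma>. length \<sigma> = Suc n}"
    then show "\<sigma> \<in> (\<lambda>(\<sigma>, y). \<sigma> @ [y]) ` ({\<sigma>. length \<sigma> = n} \<times> UNIV)"
      by (cases \<sigma> rule: rev_cases) auto
  qed auto
  moreover have "inj_on (\<lambda>(\<sigma>, y). \<sigma> @ [y]) ({\<sigma> :: 'd list. length \<sigma> = n} \<times> UNIV)"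
    by (auto intro: inj_onI)
  ultimately have "(\<Sum>\<sigma> | length \<sigma> = Suc n. f \<sigma>) = (\<Sum>(\<sigma>, y)\<in>{\<sigma>. length \<sigma> = n} \<times> UNIV. f (\<sigma> @ [y]))"
    by (simp add: sum.reindex case_prod_beta')
  then show ?thesis by (simp add: sum.cartesian_product)
qed

text \<open>Summing the weight over all words with a given last letter is a product of matrices.\<close>

lemma sum_weight_last:
  "length u = n \<Longrightarrow> (\<Sum>\<sigma> | length \<sigma> = n. weight e (At u (\<sigma> @ [z]))) = (\<Sum>x\<in>UNIV. path_prod e u 0 n $ x $ z)"
proof (induction n arbitrary: u z)
  case 0
  have "{\<sigma> :: 'd list. length \<sigma> = 0} = {[]}" by auto
  then show ?case using 0 by (simp add: mat_def if_distrib cong: if_cong)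
next
  case (Suc n)
  obtain v c where u: "u = v @ [c]" "length v = n"
    using Suc.prems by (cases u rule: rev_cases) auto
  let ?g = "step_matrix e u"
  have "(\<Sum>\<sigma> | length \<sigma> = Suc n. weight e (At u (\<sigma> @ [z]))) =
      (\<Sum>\<sigma> | length \<sigma> = Suc n. weight e (At v \<sigma>) * ?g $ last \<sigma> $ z)"
    unfolding u(1) using u(2) by (intro sum.cong refl weight_snoc) simp
  also have "\<dots> = (\<Sum>\<sigma> | length \<sigma> = n. \<Sum>y\<in>UNIV. weight e (At v (\<sigma> @ [y])) * ?g $ y $ z)"
    unfolding sum_words_Suc by simp
  also have "\<dots> = (\<Sum>y\<in>UNIV. (\<Sum>\<sigma> | length \<sigma> = n. weight e (At v (\<sigma> @ [y]))) * ?g $ y $ z)"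
    by (subst sum.swap) (simp only: sum_distrib_right)
  also have "\<dots> = (\<Sum>y\<in>UNIV. (\<Sum>x\<in>UNIV. path_prod e v 0 n $ x $ y) * ?g $ y $ z)"
    using Suc.IH[OF u(2)] by simp
  also have "\<dots> = (\<Sum>x\<in>UNIV. \<Sum>y\<in>UNIV. path_prod e v 0 n $ x $ y * ?g $ y $ z)"
    by (subst sum.swap) (simp only: sum_distrib_right)
  also have "\<dots> = (\<Sum>x\<in>UNIV. path_prod e u 0 (Suc n) $ x $ z)"
  proof -
    have "path_prod e u 0 n = path_prod e v 0 n"
      using path_prod_take[of 0 n n e u] u by simp
    moreover have "take (Suc n) u = u" using u by simp
    ultimately show ?thesis by (simp add: matrix_matrix_mult_def)
  qed
  finally show ?case .
qed

lemma sum_states_at: "(\<Sum>x\<in>states_at n. weight e x) = level_mass B e n"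
proof -
  have "(\<Sum>x\<in>states_at n. weight e x) = (\<Sum>(u, \<sigma>)\<in>tree_level B n \<times> {\<sigma>. length \<sigma> = Suc n}. weight e (At u \<sigma>))"
    unfolding states_at_def by (subst sum.reindex) (auto intro: inj_onI simp: case_prod_beta')
  also have "\<dots> = (\<Sum>u\<in>tree_level B n. \<Sum>\<sigma> | length \<sigma> = Suc n. weight e (At u \<sigma>))"
    by (simp add: sum.cartesian_product)
  also have "\<dots> = (\<Sum>u\<in>tree_level B n. entry_sum (path_prod e u 0 n))"
  proof (intro sum.cong refl)
    fix u assume "u \<in> tree_level B n"
    then have "length u = n" by (rule tree_level_length)
    have "(\<Sum>\<sigma> | length \<sigma> = Suc n. weight e (At u \<sigma>)) = (\<Sum>z\<in>UNIV. \<Sum>\<sigma> | length \<sigma> = n. weight e (At u (\<sigma> @ [z])))"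
      unfolding sum_words_Suc by (rule sum.swap)
    also have "\<dots> = (\<Sum>z\<in>UNIV. \<Sum>x\<in>UNIV. path_prod e u 0 n $ x $ z)"
      using sum_weight_last[OF \<open>length u = n\<close>] by simp
    also have "\<dots> = entry_sum (path_prod e u 0 n)" unfolding entry_sum_def by (rule sum.swap)
    finally show "(\<Sum>\<sigma> | length \<sigma> = Suc n. weight e (At u \<sigma>)) = entry_sum (path_prod e u 0 n)" .
  qed
  finally show ?thesis by (simp add: level_mass_def)
qed

lemma states_at_subset: "states_at n \<subseteq> state_space B"
  by (auto simp: states_at_def At_mem_state_space tree_level_length tree_level_vertices)

lemma level_mass_nonneg: "0 \<le> level_mass B e n"
  unfolding sum_states_at[symmetric] using states_at_subset weight_pos
  by (intro sum_nonneg) (auto intro: less_imp_le)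

lemma states_at_disjoint: "n \<noteq> m \<Longrightarrow> states_at n \<inter> states_at m = {}"
  by (auto simp: states_at_def tree_level_length)

lemma total_weight:
  "(\<integral>\<^sup>+ x. ennreal (weight e x) \<partial>count_space (state_space B)) = 1 + (\<Sum>n. ennreal (level_mass B e n))"
proof -
  have ind: "indicator (state_space B) x = (indicator {Special} x + (\<Sum>n. indicator (states_at n) x) :: ennreal)" for x
  proof -
    have "(\<Sum>n. indicator (states_at n) x :: ennreal) = indicator (\<Union>n. states_at n) x"
      using states_at_disjoint by (intro suminf_indicator) (auto simp: disjoint_family_on_def)
    moreover have "x \<in> state_space B \<longleftrightarrow> x = Special \<or> x \<in> (\<Union>n. states_at n)"
      using states_at_subset Special_mem_state_space
      by (cases x) (force simp: states_at_def At_mem_state_space dest: vertices_level)+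
    moreover have "Special \<notin> (\<Union>n. states_at n)" by (auto simp: states_at_def)
    ultimately show ?thesis by (auto split: split_indicator)
  qed
  have "(\<integral>\<^sup>+ x. ennreal (weight e x) \<partial>count_space (state_space B)) =
      (\<integral>\<^sup>+ x. ennreal (weight e x) * indicator {Special} x + (\<Sum>n. ennreal (weight e x) * indicator (states_at n) x) \<partial>count_space UNIV)"
    by (simp add: nn_integral_count_space_indicator ind distrib_left ennreal_suminf_cmult)
  also have "\<dots> = 1 + (\<Sum>n. \<integral>\<^sup>+ x. ennreal (weight e x) * indicator (states_at n) x \<partial>count_space UNIV)"
  proof -
    have "(\<integral>\<^sup>+ x. ennreal (weight e x) * indicator {Special} x \<partial>count_space UNIV) = 1" by simp
    moreover have "(\<integral>\<^sup>+ x. (\<Sum>n. ennreal (weight e x) * indicator (states_at n) x) \<partial>count_space UNIV) =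
        (\<Sum>n. \<integral>\<^sup>+ x. ennreal (weight e x) * indicator (states_at n) x \<partial>count_space UNIV)"
      by (rule nn_integral_suminf) simp
    ultimately show ?thesis by (subst nn_integral_add) (simp_all only: borel_measurable_count_space)
  qed
  also have "(\<lambda>n. \<integral>\<^sup>+ x. ennreal (weight e x) * indicator (states_at n) x \<partial>count_space UNIV) = (\<lambda>n. ennreal (level_mass B e n))"
  proof
    fix n
    have "(\<integral>\<^sup>+ x. ennreal (weight e x) * indicator (states_at n) x \<partial>count_space UNIV) = (\<Sum>x\<in>states_at n. ennreal (weight e x))"
      using finite_states_at[of n]
      by (simp add: nn_integral_count_space_indicator[symmetric] nn_integral_count_space_finite)
    also have "\<dots> = ennreal (level_mass B e n)"
      unfolding sum_states_at[symmetric] using states_at_subset[of n] weight_pos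
      by (intro sum_ennreal) (auto intro: less_imp_le)
    finally show "(\<integral>\<^sup>+ x. ennreal (weight e x) * indicator (states_at n) x \<partial>count_space UNIV) = ennreal (level_mass B e n)" .
  qed
  finally show ?thesis .
qed

text \<open>Every state is reached from the special state by successively appending letters.\<close>

lemma connected_from_Special:
  assumes "x \<in> state_space B"
  shows "(Special, x) \<in> {(a, b). a \<in> state_space B \<and> bindweed_rate B e a b \<noteq> 0}\<^sup>*"
proof -
  let ?R = "{(a, b). a \<in> state_space B \<and> bindweed_rate B e a b \<noteq> 0}"
  have step: "(parent x, x) \<in> ?R" if "x \<in> state_space B" "x \<noteq> Special" for x
    using rate_pos(1)[OF that] parent_mem[OF that(1)] that(1) by (simp add: bindweed_rate_def)
  have "At u \<sigma> \<in> state_space B \<Longrightarrow> (Special, At u \<sigma>) \<in> ?R\<^sup>*" for u \<sigma>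
  proof (induction u arbitrary: \<sigma> rule: rev_induct)
    case Nil
    then show ?case using step[of "At [] \<sigma>"] by (simp add: r_into_rtrancl)
  next
    case (snoc c u)
    have p: "parent (At (u @ [c]) \<sigma>) = At u (butlast \<sigma>)" by simp
    have "At u (butlast \<sigma>) \<in> state_space B" using parent_mem[OF snoc.prems] by simp
    then have "(Special, At u (butlast \<sigma>)) \<in> ?R\<^sup>*" by (rule snoc.IH)
    moreover have "(At u (butlast \<sigma>), At (u @ [c]) \<sigma>) \<in> ?R" using step[OF snoc.prems] unfolding p by simp
    ultimately show ?case by (rule rtrancl_into_rtrancl)
  qed
  then show ?thesis using assms by (cases x) auto
qed

text \<open>The invariant measure of a positive recurrent chain is unique up to a factor and finite.\<close>

lemma summable_if_positive_recurrent:
  assumes "bindweed_positive_recurrent B e"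
  shows "summable (level_mass B e)"
proof -
  have "mean_return_time (bindweed_rate B e) Special < \<infinity>"
    using assms Special_mem_state_space unfolding bindweed_positive_recurrent_def positive_recurrent_def by blast
  then have "(\<integral>\<^sup>+ x. ennreal (weight e x) \<partial>count_space (state_space B)) < \<infinity>"
    using connected_from_Special by (rule chain.summable_weight_if_finite_mean[OF Special_mem_state_space])
  then have "(\<Sum>n. ennreal (level_mass B e n)) \<noteq> top"
    unfolding total_weight by (auto simp: less_top)
  then show ?thesis using level_mass_nonneg by (intro summable_suminf_not_top)
qed

text \<open>Let \<open>V\<close> consist of the first \<open>N\<close> generations and of all later vertices that are reached from them
  without using a slow edge.  It is finite, and its boundary edges are slow and lie beyond generation
  \<open>N\<close>.  So the conductance of the boundary is at most \<open>K\<close> times the mass beyond generation \<open>N\<close>.\<close>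

lemma positive_recurrent_if_summable:
  assumes sum: "summable (level_mass B e)" and K: "0 < K"
    and slow: "\<And>N. \<exists>n1. \<forall>v\<in>vertices B. n1 \<le> length v \<longrightarrow>
       (\<exists>l. N \<le> l \<and> l < length v \<and> (\<forall>y. snd (e (edge_to (take (Suc l) v))) $ y \<le> K))"
  shows "bindweed_positive_recurrent B e"
  unfolding bindweed_positive_recurrent_def positive_recurrent_def
proof
  fix x :: "'d state" assume x: "x \<in> state_space B"
  show "mean_return_time (bindweed_rate B e) x < \<infinity>"
  proof (rule chain.positive_recurrent_at[OF x])
    show "(\<integral>\<^sup>+ y. ennreal (weight e y) \<partial>count_space (state_space B)) < \<infinity>"
      unfolding total_weight using sum level_mass_nonneg
      by (simp add: suminf_ennreal2 ennreal_add_less_top)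
    fix \<epsilon> :: real assume \<epsilon>: "0 < \<epsilon>"
    obtain N0 where N0: "\<And>m n. N0 \<le> m \<Longrightarrow> norm (\<Sum>i=m..<n. level_mass B e i) < \<epsilon> / K"
      using summable_Cauchy[THEN iffD1, OF sum, rule_format, of "\<epsilon> / K"] \<epsilon> K by auto
    define N where "N = max N0 (case x of Special \<Rightarrow> 0 | At u \<sigma> \<Rightarrow> length u)"
    obtain n1 where n1: "\<And>v. v \<in> vertices B \<Longrightarrow> n1 \<le> length v \<Longrightarrow>
       \<exists>l. N \<le> l \<and> l < length v \<and> (\<forall>y. snd (e (edge_to (take (Suc l) v))) $ y \<le> K)"
      using slow[of N] by blast
    define good where "good v \<longleftrightarrow> (\<forall>y. snd (e (edge_to v)) $ y \<le> K)" for v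
    define V where "V = {v \<in> vertices B. \<forall>l. N \<le> l \<longrightarrow> l < length v \<longrightarrow> \<not> good (take (Suc l) v)}"
    have Vlen: "length v < n1" if "v \<in> V" for v
    proof (rule ccontr)
      assume "\<not> length v < n1"
      then have "n1 \<le> length v" "v \<in> vertices B" using that by (auto simp: V_def)
      from n1[OF this(2,1)] obtain l where "N \<le> l" "l < length v" "good (take (Suc l) v)"
        unfolding good_def by blast
      with that show False by (simp add: V_def)
    qed
    have V_short: "v \<in> V" if "v \<in> vertices B" "length v \<le> N" for v
      using that by (auto simp: V_def)
    have V_butlast: "u \<in> V" if "u @ [c] \<in> V" for u c
    proof -
      have "u \<in> vertices B" using that vertices_snoc[of u c B] by (auto simp: V_def)
      moreover have "\<not> good (take (Suc l) u)" if l: "N \<le> l" "l < length u" for l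
      proof -
        have "\<not> good (take (Suc l) (u @ [c]))" using \<open>u @ [c] \<in> V\<close> l by (auto simp: V_def)
        then show ?thesis using l by simp
      qed
      ultimately show ?thesis by (auto simp: V_def)
    qed
    have V_exit: "good (u @ [c]) \<and> N \<le> length u" if uc: "u \<in> V" "u @ [c] \<in> vertices B" "u @ [c] \<notin> V" for u c
    proof -
      obtain l where l: "N \<le> l" "l < length (u @ [c])" "good (take (Suc l) (u @ [c]))"
        using uc(2,3) by (auto simp: V_def)
      have "l = length u"
      proof (rule ccontr)
        assume "l \<noteq> length u"
        then have "l < length u" using l(2) by simp
        then have "good (take (Suc l) u)" "\<not> good (take (Suc l) u)" using l uc(1) by (auto simp: V_def)
        then show False by simp
      qed
      then show ?thesis using l by simp
    qed
    define \<Lambda> :: "'d state set" where "\<Lambda> = insert Special {At v \<sigma> | v \<sigma>. At v \<sigma> \<in> state_space B \<and> v \<in> V}"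
    have "\<Lambda> \<subseteq> insert Special (\<Union>n<n1. states_at n)"
      using Vlen vertices_level by (force simp: \<Lambda>_def states_at_def At_mem_state_space)
    then have fin: "finite \<Lambda>" by (rule finite_subset) (simp add: finite_states_at)
    have sub: "\<Lambda> \<subseteq> state_space B" by (auto simp: \<Lambda>_def Special_mem_state_space)
    have x\<Lambda>: "x \<in> \<Lambda>"
    proof (cases x)
      case (At u \<sigma>)
      then have "u \<in> V" using x by (intro V_short) (auto simp: N_def At_mem_state_space)
      then show ?thesis using x At by (simp add: \<Lambda>_def)
    qed (simp add: \<Lambda>_def)
    let ?q = "bindweed_rate B e"
    let ?C = "SIGMA y:\<Lambda>. {z. ?q y z \<noteq> 0 \<and> z \<notin> \<Lambda>}"
    \<comment> \<open>A step out of \<open>\<Lambda>\<close> goes from a state to a child, along a slow edge beyond generation \<open>N\<close>.\<close>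
    have cut: "y = parent z \<and> z \<in> (\<Union>n\<in>{N..<Suc n1}. states_at n) \<and> weight e y * ?q y z \<le> K * weight e z"
      if "(y, z) \<in> ?C" for y z
    proof -
      have y: "y \<in> \<Lambda>" "y \<in> state_space B" and z: "z \<notin> \<Lambda>" and q: "?q y z \<noteq> 0"
        using that sub by auto
      have zS: "z \<in> state_space B" using q by (simp add: bindweed_rate_def split: if_splits)
      have zs: "z \<noteq> Special" using z by (auto simp: \<Lambda>_def)
      from zS obtain u c \<sigma> a where zc: "z = At (u @ [c]) (\<sigma> @ [a])" "At u \<sigma> \<in> state_space B" "c \<in> {1..B u}"
      proof (cases rule: state_cases)
        case (root s)
        then have "z \<in> \<Lambda>" using zS V_short[of "[]"] by (auto simp: \<Lambda>_def Nil_vertices)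
        with z show ?thesis by simp
      qed (use zs in auto)
      have uc: "u @ [c] \<in> vertices B" using zS zc(1) by (simp add: At_mem_state_space)
      have ucV: "u @ [c] \<notin> V" using z zS zc(1) by (auto simp: \<Lambda>_def)
      have yz: "y = parent z"
      proof (rule ccontr)
        assume "y \<noteq> parent z"
        then have "y \<noteq> Special" "parent y = z"
          using jump_rate_neighbours[OF y(2) zS, of e] q by (auto simp: bindweed_rate_def split: if_splits)
        then obtain v \<tau> where yv: "y = At v \<tau>" "v \<noteq> []" "z = At (butlast v) (butlast \<tau>)"
          using zs by (cases y) (auto split: if_splits)
        then have "v \<in> V" using y(1) by (auto simp: \<Lambda>_def)
        then have "butlast v \<in> V" using V_butlast[of "butlast v" "last v"] yv(2) by simp
        then have "z \<in> \<Lambda>" using zS yv(3) by (auto simp: \<Lambda>_def)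
        with z show False by simp
      qed
      then have y_eq: "y = At u \<sigma>" using zc(1) by simp
      then have uV: "u \<in> V" using y(1) by (auto simp: \<Lambda>_def)
      have ex: "good (u @ [c])" "N \<le> length u" using V_exit[OF uV uc ucV] by auto
      have "z \<in> states_at (Suc (length u))"
        using zS zc(1) vertices_level[OF uc] by (auto simp: states_at_def At_mem_state_space)
      moreover have "Suc (length u) \<in> {N..<Suc n1}" using ex(2) Vlen[OF uV] by simp
      moreover have "weight e y * ?q y z \<le> K * weight e z"
      proof -
        have "weight e y * ?q y z = weight e z * jump_rate e z y"
          using weight_parent[OF zS zs] yz y(2) zS by (simp add: bindweed_rate_def)
        also have "jump_rate e z y = snd (e (edge_to (u @ [c]))) $ a"
          unfolding y_eq zc(1) by (rule rate_down(2)[OF zc(2)])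
        also have "weight e z * snd (e (edge_to (u @ [c]))) $ a \<le> weight e z * K"
          using ex(1) weight_pos[OF zS] unfolding good_def by (intro mult_left_mono) auto
        finally show ?thesis by (simp add: mult.commute)
      qed
      ultimately show ?thesis using yz by blast
    qed
    have finz: "finite {z. ?q y z \<noteq> 0 \<and> z \<notin> \<Lambda>}" if "y \<in> \<Lambda>" for y
      using chain.finite_neighbours[of y] that sub by (auto intro: finite_subset[rotated])
    have "(\<Sum>y\<in>\<Lambda>. \<Sum>z | ?q y z \<noteq> 0 \<and> z \<notin> \<Lambda>. weight e y * ?q y z) = (\<Sum>(y, z)\<in>?C. weight e y * ?q y z)"
      using fin finz by (intro sum.Sigma) auto
    also have "\<dots> \<le> (\<Sum>(y, z)\<in>?C. K * weight e z)"
      using cut by (intro sum_mono) auto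
    also have "\<dots> = (\<Sum>z\<in>snd ` ?C. K * weight e z)"
    proof (rule sum.reindex_cong[symmetric, where l = snd])
      show "inj_on snd ?C"
      proof (rule inj_onI)
        fix a b assume ab: "a \<in> ?C" "b \<in> ?C" "snd a = snd b"
        have "fst a = parent (snd a)" using cut[of "fst a" "snd a"] ab(1) unfolding prod.collapse by blast
        moreover have "fst b = parent (snd b)" using cut[of "fst b" "snd b"] ab(2) unfolding prod.collapse by blast
        ultimately show "a = b" using ab(3) by (simp add: prod_eq_iff)
      qed
    qed (auto simp: case_prod_beta)
    also have "\<dots> \<le> (\<Sum>z\<in>(\<Union>n\<in>{N..<Suc n1}. states_at n). K * weight e z)"
    proof (rule sum_mono2)
      show "finite (\<Union>n\<in>{N..<Suc n1}. states_at n)" by (simp add: finite_states_at)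
      show "snd ` ?C \<subseteq> (\<Union>n\<in>{N..<Suc n1}. states_at n)"
      proof
        fix z assume "z \<in> snd ` ?C"
        then obtain y where "(y, z) \<in> ?C" by force
        from cut[OF this] show "z \<in> (\<Union>n\<in>{N..<Suc n1}. states_at n)" by blast
      qed
      fix z assume "z \<in> (\<Union>n\<in>{N..<Suc n1}. states_at n) - snd ` ?C"
      then have "z \<in> state_space B" using states_at_subset by blast
      then show "0 \<le> K * weight e z" using K weight_pos[of z] by simp
    qed
    also have "\<dots> = (\<Sum>n\<in>{N..<Suc n1}. \<Sum>z\<in>states_at n. K * weight e z)"
      by (intro sum.UNION_disjoint) (auto simp: finite_states_at states_at_disjoint)
    also have "\<dots> = K * (\<Sum>n=N..<Suc n1. level_mass B e n)"
      by (simp only: sum_distrib_left[symmetric] sum_states_at)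
    also have "\<dots> \<le> K * (\<epsilon> / K)"
    proof -
      have "N0 \<le> N" by (simp add: N_def)
      from N0[OF this, of "Suc n1"] show ?thesis using K by (intro mult_left_mono) auto
    qed
    also have "\<dots> = \<epsilon>" using K by simp
    finally show "\<exists>\<Lambda>. finite \<Lambda> \<and> \<Lambda> \<subseteq> state_space B \<and> x \<in> \<Lambda> \<and>
        (\<Sum>y\<in>\<Lambda>. \<Sum>z | ?q y z \<noteq> 0 \<and> z \<notin> \<Lambda>. weight e y * ?q y z) \<le> \<epsilon>"
      using fin sub x\<Lambda> by blast
  qed
qed

end

section \<open>Positive recurrence of the bindweed model\<close>

theorem proposition4p1:
  fixes B :: "vertex \<Rightarrow> nat"
    and M :: "'w measure"
    and \<Xi> :: "edge \<Rightarrow> 'w \<Rightarrow> ('d::finite) env"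
    and \<rho> :: "'d env measure"
    and \<mu> :: "(real^'d^'d) measure"
  assumes B: "without_extinction B"
    and M: "prob_space M"
    and indep: "prob_space.indep_vars M (\<lambda>_. borel) \<Xi> (edges B)"
    and law: "\<And>a. a \<in> edges B \<Longrightarrow> distr M borel (\<Xi> a) = \<rho>"
    and pos: "AE e in \<rho>. positive_env e"
    and law_ratio: "\<And>a. a \<in> edges B \<Longrightarrow> distr M borel (\<lambda>\<omega>. ratio_matrix (\<Xi> a \<omega>)) = \<mu>"
    and GL: "AE g in \<mu>. g \<in> GL"
    and cond1: "integrability_condition \<mu>"
    and cond2: "strong_irreducibility_condition \<mu>"
    and cond3: "strict_positivity_condition \<mu>"
  shows "(ereal (min_moment_rate \<mu>) * upper_growth_rate B < 1 \<longrightarrow>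
            (AE \<omega> in M. bindweed_positive_recurrent B (\<lambda>a. \<Xi> a \<omega>))) \<and>
         (bounded_branching B \<and> min_moment_rate \<mu> * branching_rate B > 1 \<longrightarrow>
            (AE \<omega> in M. \<not> bindweed_positive_recurrent B (\<lambda>a. \<Xi> a \<omega>)))"
proof -
  interpret random_environment M B \<Xi> \<rho> \<mu>
    using B M indep law pos law_ratio cond1
    by (intro random_environment.intro random_environment_axioms.intro)
  have chain: "positive_environment B (env \<omega>)" if "\<forall>a\<in>edges B. positive_env (\<Xi> a \<omega>)" for \<omega>
    using that by unfold_locales blast
  show ?thesis
  proof (intro conjI impI)
    assume "ereal (min_moment_rate \<mu>) * upper_growth_rate B < 1"
    then obtain R where R: "0 < R" "min_moment_rate \<mu> * R < 1"
      and growth: "\<forall>\<^sub>F n in sequentially. real (card (tree_level B n)) \<le> R ^ n"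
      by (rule growth_bound)
    obtain K where K: "0 < K" and slow: "AE \<omega> in M. \<forall>N. \<exists>n1. \<forall>v\<in>vertices B. n1 \<le> length v \<longrightarrow>
        (\<exists>l. N \<le> l \<and> l < length v \<and> slow K (\<Xi> (edge_to (take (Suc l) v)) \<omega>))"
      by (rule slow_cutsets[OF R(1) growth])
    show "AE \<omega> in M. bindweed_positive_recurrent B (\<lambda>a. \<Xi> a \<omega>)"
      using AE_positive_env finite_mass[OF R growth] slow
    proof eventually_elim
      case (elim \<omega>)
      then show ?case
        by (intro positive_environment.positive_recurrent_if_summable[OF chain _ K])
           (auto simp: slow_def)
    qed
  next
    assume "bounded_branching B \<and> 1 < min_moment_rate \<mu> * branching_rate B"
    then have "AE \<omega> in M. \<not> summable (level_mass B (env \<omega>))"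
      by (intro infinite_mass) simp
    with AE_positive_env show "AE \<omega> in M. \<not> bindweed_positive_recurrent B (\<lambda>a. \<Xi> a \<omega>)"
    proof eventually_elim
      case (elim \<omega>)
      then show ?case
        using positive_environment.summable_if_positive_recurrent[OF chain] by blast
    qed
  qed
qed

end
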